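(* Let $(F;+,\cdot,D_1,\ldots,D_m)$ be a differential field with $m$ commuting derivations, let $n\geq 1$, and let $V\subseteq G_n(F)\subseteq F^{2n}$ be a rotund variety. Then there exists a differential field extension $K$ of $F$ such that $V(K)\cap \mathrm{Exp}(K)\neq\emptyset$, that is, there is a point $(x_1,\ldots,x_n,y_1,\ldots,y_n)\in V(K)$ with $(x_i,y_i)\in\mathrm{Exp}(K)$ for all $i=1,\ldots,n$. In particular, when $F$ is differentially closed, $V(F)\cap\mathrm{Exp}(F)\neq\emptyset$.
   Context: All fields have characteristic $0$. A differential field extension of $(F;+,\cdot,D_1,\ldots,D_m)$ is a field extension $K$ with $m$ commuting derivations extending $D_1,\ldots,D_m$; differentially closed means differentially closed as a field with $m$ commuting derivations. A variety in $F^{N}$ means a variety defined over $F$, identified with its set of $F^{\mathrm{alg}}$-points; $V(K)$ is its set of $K$-points. In a differential field $(K;+,\cdot,D_1,\ldots,D_m)$ the binary relation $\mathrm{Exp}(x,y)$ is defined by $\bigwedge_{k=1}^m D_ky=y\,D_kx$, and $\mathrm{Exp}(K)$ is the set of pairs satisfying it (for tuples, coordinatewise as in the claim). Let $\mathbb{G}_a$ and $\mathbb{G}_m$ be the additive and multiplicative groups, and $G_n:=\mathbb{G}_a^n\times\mathbb{G}_m^n$. For a $k\times n$ integer matrix $M=(m_{ij})$ let $[M]:G_n\to G_k$ be the map $(\bar x,\bar y)\mapsto(u_1,\ldots,u_k,v_1,\ldots,v_k)$ with $u_i=\sum_{j=1}^n m_{ij}x_j$ and $v_i=\prod_{j=1}^n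 y_j^{m_{ij}}$. An irreducible variety $V\subseteq G_n$ is rotund if for every $1\leq k\leq n$ and every $k\times n$ integer matrix $M$ we have $\dim [M](V)\geq \mathrm{rk}\, M$ (dimension of the Zariski closure of the image). *)

theory Defs
  imports
    "HOL-Algebra.Algebraic_Closure_Type"
    "HOL-Library.Poly_Mapping"
    "HOL-Library.Extended_Nat"
    "Jordan_Normal_Form.DL_Rank"
begin

text \<open>
  Conventions. The ground field \<open>F\<close> is a type \<open>'a\<close> of class \<open>field_char_0\<close>, viewed as the record
  \<open>ring_of_type_algebra :: 'a ring\<close> where a structure with a carrier is wanted; its algebraic closure
  is the library type \<open>'a alg_closure\<close> with embedding \<open>to_ac\<close>. Extension fields of \<open>F\<close>, which have to
  be quantified existentially, are records \<open>K\<close> together with an embedding \<open>h\<close> of \<open>F\<close> into \<open>K\<close>.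
  Indices start at 0: the derivations are \<open>D 0, \<dots>, D (m - 1)\<close>, and a point \<open>(x, y)\<close> of
  \<open>G\<^sub>n\<close> is a vector of length \<open>2 * n\<close> with \<open>x\<^sub>i\<close> in position \<open>i\<close> and \<open>y\<^sub>i\<close> in position \<open>n + i\<close>.
\<close>

type_synonym ('v, 'a) mpol = "('v \<Rightarrow>\<^sub>0 nat) \<Rightarrow>\<^sub>0 'a"

definition mpol_vars :: "('v, 'a::zero) mpol \<Rightarrow> 'v set" where
  "mpol_vars p = (\<Union>t\<in>Poly_Mapping.keys p. Poly_Mapping.keys t)"

definition mpol_eval ::
    "'k ring \<Rightarrow> ('a::zero \<Rightarrow> 'k) \<Rightarrow> ('v, 'a) mpol \<Rightarrow> ('v \<Rightarrow> 'k) \<Rightarrow> 'k" where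
  "mpol_eval K h p a =
     (\<Oplus>\<^bsub>K\<^esub>t\<in>Poly_Mapping.keys p.
        h (Poly_Mapping.lookup p t) \<otimes>\<^bsub>K\<^esub> (\<Otimes>\<^bsub>K\<^esub>v\<in>Poly_Mapping.keys t. a v [^]\<^bsub>K\<^esub> Poly_Mapping.lookup t v))"

text \<open>
  Closed sets are sets of points over the algebraic closure, cut out by polynomials with coefficients
  in \<open>F\<close> itself; closure, irreducibility and dimension below refer to this topology (the one of
  affine space as an \<open>F\<close>-variety). By Hilbert's basis theorem, allowing infinite sets of equations would
  not give more closed sets.
\<close>

definition zariski_closed :: "nat \<Rightarrow> 'a::field_char_0 alg_closure vec set \<Rightarrow> bool" where
  "zariski_closed N Z \<longleftrightarrow>
     (\<exists>S :: (nat, 'a) mpol set. finite S \<and> (\<forall>p\<in>S. mpol_vars p \<subseteq> {..<N}) \<and>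
        Z = {v \<in> carrier_vec N. \<forall>p\<in>S. mpol_eval ring_of_type_algebra to_ac p (\<lambda>i. v $ i) = 0})"

definition zariski_closure ::
    "nat \<Rightarrow> 'a::field_char_0 alg_closure vec set \<Rightarrow> 'a alg_closure vec set" where
  "zariski_closure N A = \<Inter>{Z. zariski_closed N Z \<and> A \<subseteq> Z}"

definition zariski_irreducible :: "nat \<Rightarrow> 'a::field_char_0 alg_closure vec set \<Rightarrow> bool" where
  "zariski_irreducible N A \<longleftrightarrow> A \<noteq> {} \<and>
     (\<forall>Z\<^sub>1 Z\<^sub>2. zariski_closed N Z\<^sub>1 \<longrightarrow> zariski_closed N Z\<^sub>2 \<longrightarrow> A \<subseteq> Z\<^sub>1 \<union> Z\<^sub>2 \<longrightarrow> A \<subseteq> Z\<^sub>1 \<or> A \<subseteq> Z\<^sub>2)"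

text \<open>Krull dimension of a closed set. (The dimension of the empty set comes out as 0.)\<close>

definition zariski_dim :: "nat \<Rightarrow> 'a::field_char_0 alg_closure vec set \<Rightarrow> enat" where
  "zariski_dim N W = Sup {enat d | d. \<exists>Z.
     (\<forall>i\<le>d. zariski_closed N (Z i) \<and> zariski_irreducible N (Z i) \<and> Z i \<subseteq> W) \<and>
     (\<forall>i<d. Z i \<subset> Z (Suc i))}"

definition vanishing_ideal ::
    "nat \<Rightarrow> 'a::field_char_0 alg_closure vec set \<Rightarrow> (nat, 'a) mpol set" where
  "vanishing_ideal N A = {p. mpol_vars p \<subseteq> {..<N} \<and>
     (\<forall>v\<in>A. mpol_eval ring_of_type_algebra to_ac p (\<lambda>i. v $ i) = 0)}"

definition G_points :: "nat \<Rightarrow> 'k ring \<Rightarrow> 'k vec set" where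
  "G_points n K = {v \<in> carrier_vec (2 * n).
     (\<forall>i<2 * n. v $ i \<in> carrier K) \<and> (\<forall>i<n. v $ (n + i) \<noteq> \<zero>\<^bsub>K\<^esub>)}"

definition G_variety :: "nat \<Rightarrow> 'a::field_char_0 alg_closure vec set \<Rightarrow> bool" where
  "G_variety n V \<longleftrightarrow>
     (\<exists>Z. zariski_closed (2 * n) Z \<and> V = Z \<inter> G_points n ring_of_type_algebra)"

text \<open>The set \<open>V(K)\<close> of points of \<open>V\<close> in an extension field \<open>h : F \<rightarrow> K\<close>.\<close>

definition K_points ::
    "nat \<Rightarrow> 'a::field_char_0 alg_closure vec set \<Rightarrow> 'k ring \<Rightarrow> ('a \<Rightarrow> 'k) \<Rightarrow> 'k vec set" where
  "K_points n V K h = {v \<in> G_points n K.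
     \<forall>p\<in>vanishing_ideal (2 * n) V. mpol_eval K h p (\<lambda>i. v $ i) = \<zero>\<^bsub>K\<^esub>}"

definition G_map :: "int mat \<Rightarrow> 'b::field vec \<Rightarrow> 'b vec" where
  "G_map M v = (let k = dim_row M; n = dim_col M in
     vec (2 * k) (\<lambda>i. if i < k then \<Sum>j<n. of_int (M $$ (i, j)) * v $ j
                      else \<Prod>j<n. v $ (n + j) powi (M $$ (i - k, j))))"

definition int_mat_rank :: "int mat \<Rightarrow> nat" where
  "int_mat_rank M = vec_space.rank (dim_row M) (map_mat rat_of_int M)"

definition rotund :: "nat \<Rightarrow> 'a::field_char_0 alg_closure vec set \<Rightarrow> bool" where
  "rotund n V \<longleftrightarrow> G_variety n V \<and> zariski_irreducible (2 * n) V \<and>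
     (\<forall>k M. 1 \<le> k \<longrightarrow> k \<le> n \<longrightarrow> M \<in> carrier_mat k n \<longrightarrow>
        zariski_dim (2 * k) (zariski_closure (2 * k) (G_map M ` V)) \<ge> enat (int_mat_rank M))"

definition derivation :: "'k ring \<Rightarrow> ('k \<Rightarrow> 'k) \<Rightarrow> bool" where
  "derivation K d \<longleftrightarrow> d \<in> carrier K \<rightarrow> carrier K \<and>
     (\<forall>a\<in>carrier K. \<forall>b\<in>carrier K.
        d (a \<oplus>\<^bsub>K\<^esub> b) = d a \<oplus>\<^bsub>K\<^esub> d b \<and>
        d (a \<otimes>\<^bsub>K\<^esub> b) = a \<otimes>\<^bsub>K\<^esub> d b \<oplus>\<^bsub>K\<^esub> b \<otimes>\<^bsub>K\<^esub> d a)"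

definition diff_field :: "nat \<Rightarrow> 'k ring \<Rightarrow> (nat \<Rightarrow> 'k \<Rightarrow> 'k) \<Rightarrow> bool" where
  "diff_field m K D \<longleftrightarrow> field K \<and>
     (\<forall>n::nat. n > 0 \<longrightarrow> [n] \<cdot>\<^bsub>K\<^esub> \<one>\<^bsub>K\<^esub> \<noteq> \<zero>\<^bsub>K\<^esub>) \<and>
     (\<forall>k<m. derivation K (D k)) \<and>
     (\<forall>j<m. \<forall>k<m. \<forall>a\<in>carrier K. D j (D k a) = D k (D j a))"

definition diff_field_ext ::
    "nat \<Rightarrow> 'f ring \<Rightarrow> (nat \<Rightarrow> 'f \<Rightarrow> 'f) \<Rightarrow> 'k ring \<Rightarrow> (nat \<Rightarrow> 'k \<Rightarrow> 'k) \<Rightarrow> ('f \<Rightarrow> 'k) \<Rightarrow> bool" where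
  "diff_field_ext m F D K E h \<longleftrightarrow> diff_field m F D \<and> diff_field m K E \<and> h \<in> Ring.ring_hom F K \<and>
     (\<forall>k<m. \<forall>a\<in>carrier F. E k (h a) = h (D k a))"

definition Exp :: "nat \<Rightarrow> 'k ring \<Rightarrow> (nat \<Rightarrow> 'k \<Rightarrow> 'k) \<Rightarrow> ('k \<times> 'k) set" where
  "Exp m K E = {(x, y). x \<in> carrier K \<and> y \<in> carrier K \<and> (\<forall>k<m. E k y = y \<otimes>\<^bsub>K\<^esub> E k x)}"

text \<open>
  A differential polynomial is a polynomial in variables \<open>(j, e)\<close>, which stand for the derivative
  \<open>D\<^sub>0\<^bsup>e(0)\<^esup> \<cdots> D\<^sub>m\<^sub>-\<^sub>1\<^bsup>e(m-1)\<^esup> x\<^sub>j\<close>; the values of \<open>e\<close> outside \<open>{0..<m}\<close> are irrelevant.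
\<close>

definition deriv_op :: "nat \<Rightarrow> (nat \<Rightarrow> 'k \<Rightarrow> 'k) \<Rightarrow> (nat \<Rightarrow> nat) \<Rightarrow> 'k \<Rightarrow> 'k" where
  "deriv_op m E e = foldr (\<lambda>k f. (E k ^^ e k) \<circ> f) [0..<m] id"

definition diff_pol_eval ::
    "nat \<Rightarrow> 'k ring \<Rightarrow> (nat \<Rightarrow> 'k \<Rightarrow> 'k) \<Rightarrow> ('a::zero \<Rightarrow> 'k) \<Rightarrow>
      (nat \<times> (nat \<Rightarrow> nat), 'a) mpol \<Rightarrow> (nat \<Rightarrow> 'k) \<Rightarrow> 'k" where
  "diff_pol_eval m K E h p x = mpol_eval K h p (\<lambda>(j, e). deriv_op m E e (x j))"

text \<open>
  Differentially closed means existentially closed among differential fields: every finite system of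
  differential polynomial equations and inequations over \<open>F\<close> that is solvable in some differential field
  extension is solvable in \<open>F\<close>. Letting the extension range over structures on the type \<open>'a\<close> loses
  nothing: the differential subfield generated by \<open>F\<close> and a solution has the cardinality of the
  (infinite) field \<open>F\<close>, so it is isomorphic to a structure with carrier in \<open>'a\<close>.
\<close>

definition differentially_closed :: "nat \<Rightarrow> (nat \<Rightarrow> 'a::field_char_0 \<Rightarrow> 'a) \<Rightarrow> bool" where
  "differentially_closed m D \<longleftrightarrow>
     diff_field m (ring_of_type_algebra :: 'a ring) D \<and>
     (\<forall>(S :: (nat \<times> (nat \<Rightarrow> nat), 'a) mpol set) T. finite S \<longrightarrow> finite T \<longrightarrow>
        (\<exists>(K :: 'a ring) E h x. diff_field_ext m ring_of_type_algebra D K E h \<and>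
           range x \<subseteq> carrier K \<and>
           (\<forall>p\<in>S. diff_pol_eval m K E h p x = \<zero>\<^bsub>K\<^esub>) \<and>
           (\<forall>q\<in>T. diff_pol_eval m K E h q x \<noteq> \<zero>\<^bsub>K\<^esub>)) \<longrightarrow>
        (\<exists>x. (\<forall>p\<in>S. diff_pol_eval m ring_of_type_algebra D id p x = 0) \<and>
             (\<forall>q\<in>T. diff_pol_eval m ring_of_type_algebra D id q x \<noteq> 0)))"

lemma K_points_alg_closure:
  assumes "G_variety n V"
  shows "K_points n V ring_of_type_algebra to_ac = V"
proof -
  obtain Z where Z: "zariski_closed (2 * n) Z" "V = Z \<inter> G_points n ring_of_type_algebra"
    using assms by (auto simp: G_variety_def)
  obtain S where S: "\<forall>p\<in>S. mpol_vars p \<subseteq> {..<2 * n}"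
    "Z = {v \<in> carrier_vec (2 * n). \<forall>p\<in>S. mpol_eval ring_of_type_algebra to_ac p (\<lambda>i. v $ i) = 0}"
    using Z(1) unfolding zariski_closed_def by blast
  have z: "\<zero>\<^bsub>(ring_of_type_algebra :: 'a alg_closure ring)\<^esub> = 0"
    by (simp add: ring_of_type_algebra_def)
  have SI: "S \<subseteq> vanishing_ideal (2 * n) V"
    using S Z(2) unfolding vanishing_ideal_def by auto
  show ?thesis
  proof
    show "K_points n V ring_of_type_algebra to_ac \<subseteq> V"
      using SI unfolding K_points_def Z(2) z S(2) by (auto simp: G_points_def)
    show "V \<subseteq> K_points n V ring_of_type_algebra to_ac"
      using Z(2) unfolding K_points_def z vanishing_ideal_def by auto
  qed
qed

end

theory Submission
  imports Defs "HOL-Library.Function_Algebras"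
begin

text \<open>
  Write \<open>\<omega>\<^sub>i = dy\<^sub>i/y\<^sub>i - dx\<^sub>i\<close>, so that a derivation \<open>d\<close> makes \<open>(x\<^sub>i, y\<^sub>i)\<close> an exponential pair iff \<open>\<omega>\<^sub>i(d) = 0\<close>.
  Let \<open>(x, y)\<close> be a generic point of \<open>V\<close> in some large field \<open>\<Omega>\<close> over \<open>F\<close>. The theorem comes down to the
  claim that \<open>\<omega>\<^sub>1, \<dots>, \<omega>\<^sub>n\<close> are linearly independent on the space \<open>Der(\<Omega>/F)\<close>
  (\<open>ax_independence\<close>). Given the claim, complete the \<open>\<omega>\<^sub>i\<close> by differentials \<open>dt\<close> of some of the coordinates
  to a basis of the span of all \<open>dx\<^sub>i, dy\<^sub>i\<close>; then each \<open>D\<^sub>s\<close> extends to a derivation \<open>E\<^sub>s\<close> with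
  \<open>\<omega>\<^sub>i(E\<^sub>s) = 0\<close> and \<open>E\<^sub>s t = 0\<close>. The commutator of two such derivations is trivial on \<open>F\<close> and satisfies the
  same equations, hence is zero on the coordinates, and so the \<open>E\<^sub>s\<close> commute where it matters
  (\<open>commuting_exp_derivations\<close>). The dimension of \<open>V\<close> may exceed \<open>n\<close>; the \<open>t\<close> take care of the excess.
  
  The claim is a form of Ax's theorem. Let \<open>\<Delta>\<close> be the space of derivations killed by all \<open>\<omega>\<^sub>i\<close> and \<open>C\<close> its
  field of constants. A linear relation between the restrictions of the \<open>\<omega>\<^sub>i\<close> to \<open>Der(\<Omega>/C)\<close> can be
  differentiated along \<open>\<Delta>\<close>, because the \<open>\<omega>\<^sub>i\<close> are closed; hence the relations are spanned by those with
  coefficients in \<open>C\<close> (\<open>deriv_stable_subspace\<close>). Such a relation has the form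
  \<open>\<Sum> e\<^sub>j dz\<^sub>j/z\<^sub>j = dv\<close> with monomials \<open>z\<^sub>j\<close> in \<open>y\<close> and constants \<open>e\<^sub>j\<close> linearly independent over the
  integers, and comparing residues forces \<open>z\<^sub>j \<in> C\<close> (\<open>residue_independence\<close>). So all relations come from the
  lattice \<open>\<Lambda>\<close> of integer vectors \<open>m\<close> with \<open>y\<^sup>m \<in> C\<close>, equivalently \<open>m \<sqdot> x \<in> C\<close>. If \<open>\<Lambda>\<close> has rank \<open>u\<close>,
  rotundity applied to a basis of \<open>\<Lambda>\<close> says that \<open>C\<close> contains \<open>u\<close> elements algebraically independent over
  \<open>F\<close> (\<open>chain_derivations\<close>, \<open>rotund_transcendence\<close>). Their differentials vanish on \<open>\<Delta>\<close>, so they lie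
  in the span of the \<open>\<omega>\<^sub>i\<close>, and in fact in the span of the \<open>u\<close> forms that belong to \<open>\<Lambda>\<close>. As there are \<open>u\<close> of
  them, those \<open>u\<close> forms are independent on \<open>Der(\<Omega>/F)\<close>, and no relation survives there.
  
  The field \<open>\<Omega>\<close> is the algebraic closure of an ultrapower which is chosen once and for all and contains generic
  points of all irreducible sets (\<open>generic_value\<close>). Since this makes \<open>\<Omega>\<close> larger than \<open>F\<close>, a
  subfield of the cardinality of \<open>F\<close> is cut out and copied to the type of \<open>F\<close>. The statement about
  differentially closed fields follows by writing \<open>(x, y) \<in> V\<close> and the exponential equations as a finite system
  of differential polynomial equations and inequations.
\<close>

section \<open>Subrings, subfields and sections of ring homomorphisms\<close>

definition is_subring :: "'s::comm_ring_1 set \<Rightarrow> bool" where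
  "is_subring G \<longleftrightarrow> 1 \<in> G \<and> (\<forall>x\<in>G. \<forall>y\<in>G. x + y \<in> G \<and> x * y \<in> G) \<and> (\<forall>x\<in>G. - x \<in> G)"

text \<open>
  The ambient ring need not be a field. The main examples are graphs of derivations inside the dual numbers and graphs
  of field homomorphisms inside a product of two fields.
\<close>
definition is_subfield :: "'s::comm_ring_1 set \<Rightarrow> bool" where
  "is_subfield G \<longleftrightarrow> is_subring G \<and> (\<forall>x\<in>G. x \<noteq> 0 \<longrightarrow> (\<exists>y\<in>G. x * y = 1))"

lemma is_subringD:
  assumes "is_subring G"
  shows "0 \<in> G" "1 \<in> G" "\<And>x y. x \<in> G \<Longrightarrow> y \<in> G \<Longrightarrow> x + y \<in> G" "\<And>x y. x \<in> G \<Longrightarrow> y \<in> G \<Longrightarrow> x * y \<in> G"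
    "\<And>x. x \<in> G \<Longrightarrow> - x \<in> G" "\<And>x y. x \<in> G \<Longrightarrow> y \<in> G \<Longrightarrow> x - y \<in> G"
    "\<And>x n. x \<in> G \<Longrightarrow> x ^ n \<in> G"
    "\<And>n. of_nat n \<in> G"
    "\<And>n. of_int n \<in> G"
    "\<And>f A. (\<And>i. i \<in> A \<Longrightarrow> f i \<in> G) \<Longrightarrow> sum f A \<in> G"
    "\<And>f A. (\<And>i. i \<in> A \<Longrightarrow> f i \<in> G) \<Longrightarrow> prod f A \<in> G"
proof -
  note G = assms[unfolded is_subring_def]
  show one: "1 \<in> G" and add: "\<And>x y. x \<in> G \<Longrightarrow> y \<in> G \<Longrightarrow> x + y \<in> G"
    and mult: "\<And>x y. x \<in> G \<Longrightarrow> y \<in> G \<Longrightarrow> x * y \<in> G" and neg: "\<And>x. x \<in> G \<Longrightarrow> - x \<in> G"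
    using G by blast+
  have "1 + - 1 \<in> G" using one neg add by blast
  thus zero: "0 \<in> G" by simp
  show "x - y \<in> G" if "x \<in> G" "y \<in> G" for x y
    using add[OF that(1) neg[OF that(2)]] by simp
  show "x ^ n \<in> G" if "x \<in> G" for x n
    by (induction n) (auto intro: one mult that)
  show nat: "of_nat n \<in> G" for n
    by (induction n) (auto intro: zero one add)
  show "of_int n \<in> G" for n
    by (cases n rule: int_cases2) (auto intro: nat neg)
  show "sum f A \<in> G" if "\<And>i. i \<in> A \<Longrightarrow> f i \<in> G" for f and A :: "'b set"
    using that by (induction A rule: infinite_finite_induct) (auto intro: zero add)
  show "prod f A \<in> G" if "\<And>i. i \<in> A \<Longrightarrow> f i \<in> G" for f and A :: "'c set"
    using that by (induction A rule: infinite_finite_induct) (auto intro: one mult)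
qed

lemma is_subfield_subring: "is_subfield G \<Longrightarrow> is_subring G"
  by (simp add: is_subfield_def)

lemma is_subfield_inverse:
  fixes G :: "'b::field set"
  assumes "is_subfield G" "x \<in> G" shows "inverse x \<in> G"
proof (cases "x = 0")
  case True
  then show ?thesis using assms is_subringD(1) is_subfield_subring by simp
next
  case False
  then obtain y where "y \<in> G" "x * y = 1" using assms unfolding is_subfield_def by blast
  then show ?thesis using inverse_unique by blast
qed

lemma is_subfieldI_inverse:
  fixes G :: "'b::field set"
  assumes "is_subring G" "\<And>x. x \<in> G \<Longrightarrow> inverse x \<in> G"
  shows "is_subfield G"
  using assms unfolding is_subfield_def by (metis right_inverse)

lemma is_subfield_divide:
  fixes G :: "'b::field set"
  assumes "is_subfield G" "x \<in> G" "y \<in> G" shows "x / y \<in> G"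
  using assms is_subfield_inverse is_subringD(4) is_subfield_subring by (metis divide_inverse)

definition polys_over :: "'s::comm_ring_1 set \<Rightarrow> 's poly set" where
  "polys_over G = {p. \<forall>i. coeff p i \<in> G}"

lemma is_subring_polys_over:
  assumes "is_subring G" shows "is_subring (polys_over G)"
  unfolding is_subring_def polys_over_def
proof safe
  note G = is_subringD[OF assms]
  show "coeff 1 i \<in> G" for i using G(1,2) by (cases i) auto
  fix x y :: "'a poly" and i assume xy: "\<forall>i. coeff x i \<in> G" "\<forall>i. coeff y i \<in> G"
  show "coeff (x + y) i \<in> G" using xy G by auto
  show "coeff (x * y) i \<in> G" unfolding coeff_mult using xy by (intro G(10)) (auto intro!: G)
next
  fix x :: "'a poly" and i assume "\<forall>i. coeff x i \<in> G"
  thus "coeff (- x) i \<in> G" using is_subringD[OF assms] by auto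
qed

lemma polys_over_monom: "is_subring G \<Longrightarrow> c \<in> G \<Longrightarrow> monom c n \<in> polys_over G"
  by (auto simp: polys_over_def is_subringD)

lemma polys_over_pderiv: "is_subring G \<Longrightarrow> p \<in> polys_over G \<Longrightarrow> pderiv p \<in> polys_over G"
  unfolding polys_over_def coeff_pderiv mem_Collect_eq using is_subringD(4,8) by blast

lemma polys_over_division:
  fixes p q :: "'s::comm_ring_1 poly"
  assumes G: "is_subfield G" and p: "p \<in> polys_over G" and q: "q \<in> polys_over G" "q \<noteq> 0"
  shows "\<exists>d\<in>polys_over G. \<exists>r\<in>polys_over G. p = q * d + r \<and> (r = 0 \<or> degree r < degree q)"
  using p
proof (induction "degree p" arbitrary: p rule: less_induct)
  case less
  note SR = is_subfield_subring[OF G]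
  note PR = is_subringD[OF is_subring_polys_over[OF SR]]
  show ?case
  proof (cases "p = 0 \<or> degree p < degree q")
    case True
    thus ?thesis using less.prems PR(1) by (intro bexI[of _ 0] bexI[of _ p]) auto
  next
    case False
    obtain c where c: "c \<in> G" "lead_coeff q * c = 1"
      using G q unfolding is_subfield_def polys_over_def by (metis (mono_tags) leading_coeff_0_iff mem_Collect_eq)
    define u where "u = monom (lead_coeff p * c) (degree p - degree q)"
    have u: "u \<in> polys_over G" unfolding u_def
      using less.prems c SR by (intro polys_over_monom is_subringD(4)[OF SR]) (auto simp: polys_over_def)
    define p' where "p' = p - q * u"
    have p': "p' \<in> polys_over G" unfolding p'_def by (intro PR less.prems q u)
    have "degree (q * u) \<le> degree p" unfolding u_def
      using False degree_mult_le[of q u] degree_monom_le[of "lead_coeff p * c" "degree p - degree q"]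
      unfolding u_def by linarith
    hence dle: "degree p' \<le> degree p" unfolding p'_def by (simp add: degree_diff_le)
    have "coeff (q * u) (degree p) = lead_coeff p"
    proof -
      have "coeff (u * q) (degree p) = lead_coeff p * c * coeff q (degree q)"
        unfolding u_def coeff_monom_mult using False by auto
      moreover have "lead_coeff p * c * lead_coeff q = lead_coeff p * (lead_coeff q * c)" by (simp only: ac_simps)
      ultimately show ?thesis using c(2) by (simp only: mult.commute[of q u] mult_1_right)
    qed
    hence cz: "coeff p' (degree p) = 0" unfolding p'_def by simp
    show ?thesis
    proof (cases "degree p' < degree p")
      case True
      then obtain d r where dr: "d \<in> polys_over G" "r \<in> polys_over G" "p' = q * d + r" "r = 0 \<or> degree r < degree q"
        using less.hyps[OF True p'] by blast
      have "p = q * (d + u) + r" using dr(3) unfolding p'_def by (simp add: algebra_simps)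
      thus ?thesis using dr u PR(3) by blast
    next
      case F2: False
      hence "p' = 0" using dle cz by (metis le_antisym leading_coeff_0_iff not_less)
      hence "p = q * u + 0" unfolding p'_def by simp
      thus ?thesis using u PR(1) by blast
    qed
  qed
qed

lemma poly_in_subring:
  assumes "is_subring G" "p \<in> polys_over G" "x \<in> G" shows "poly p x \<in> G"
  unfolding poly_altdef using assms by (intro is_subringD(10)) (auto simp: polys_over_def intro!: is_subringD)

definition adjoin :: "'s::comm_ring_1 set \<Rightarrow> 's \<Rightarrow> 's set" where
  "adjoin G b = (\<lambda>p. poly p b) ` polys_over G"

lemma is_subring_adjoin:
  assumes "is_subring G" shows "is_subring (adjoin G b)"
proof -
  note PR = is_subringD[OF is_subring_polys_over[OF assms]]
  show ?thesis unfolding is_subring_def adjoin_def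
  proof safe
    show "1 \<in> (\<lambda>p. poly p b) ` polys_over G" using PR(2) by (intro image_eqI[of _ _ 1]) auto
    fix p q assume "p \<in> polys_over G" "q \<in> polys_over G"
    hence "p + q \<in> polys_over G" "p * q \<in> polys_over G" using PR(3,4) by auto
    thus "poly p b + poly q b \<in> (\<lambda>p. poly p b) ` polys_over G"
      "poly p b * poly q b \<in> (\<lambda>p. poly p b) ` polys_over G"
      by (metis image_eqI poly_add) (metis \<open>p * q \<in> polys_over G\<close> image_eqI poly_mult)
  next
    fix p assume "p \<in> polys_over G"
    thus "- poly p b \<in> (\<lambda>p. poly p b) ` polys_over G"
      using PR(5) by (auto intro!: image_eqI[of _ _ "-p"])
  qed
qed

lemma subset_adjoin: "is_subring G \<Longrightarrow> G \<subseteq> adjoin G b"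
  unfolding adjoin_def using polys_over_monom[of G _ 0]
  by (auto intro!: image_eqI[of _ _ "monom _ 0"] simp: poly_monom)

lemma in_adjoin: "is_subring G \<Longrightarrow> b \<in> adjoin G b"
  unfolding adjoin_def using polys_over_monom[of G 1 1] is_subringD(2)[of G]
  by (auto intro!: image_eqI[of _ _ "monom 1 1"] simp: poly_monom)

definition fractions :: "'s::comm_ring_1 set \<Rightarrow> 's set" where
  "fractions H = {x. \<exists>a\<in>H. \<exists>c\<in>H. c dvd 1 \<and> x * c = a}"

lemma subset_fractions: "is_subring H \<Longrightarrow> H \<subseteq> fractions H"
  unfolding fractions_def using is_subringD(2)[of H] by (metis (mono_tags, lifting) dvd_refl mem_Collect_eq mult.right_neutral subsetI)

text \<open>
  The numerator of a nonzero fraction is again a unit, so that the fraction can be inverted inside the set.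
\<close>
lemma is_subfield_fractions:
  assumes H: "is_subring H" and U: "\<And>x. x \<in> H \<Longrightarrow> x = 0 \<or> x dvd 1"
  shows "is_subfield (fractions H)"
proof -
  note HR = is_subringD[OF H]
  have sub: "is_subring (fractions H)"
    unfolding is_subring_def
  proof (intro conjI ballI allI)
    show "1 \<in> fractions H" using HR subset_fractions[OF H] by auto
  next
    fix x y assume "x \<in> fractions H" "y \<in> fractions H"
    then obtain a c a' c' where *: "a \<in> H" "c \<in> H" "c dvd 1" "x * c = a" "a' \<in> H" "c' \<in> H" "c' dvd 1" "y * c' = a'"
      unfolding fractions_def by auto
    have cc: "c * c' dvd 1" using *(3,7) by (metis mult_dvd_mono mult_1)
    have "(x + y) * (c * c') = a * c' + a' * c" "(x * y) * (c * c') = a * a'"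
      using *(4,8) by (auto simp: algebra_simps)
    moreover have "a * c' + a' * c \<in> H" "a * a' \<in> H" "c * c' \<in> H" using * by (auto intro!: HR(3,4))
    ultimately show "x + y \<in> fractions H" "x * y \<in> fractions H"
      unfolding fractions_def using cc by blast+
  next
    fix x assume "x \<in> fractions H"
    then obtain a c where *: "a \<in> H" "c \<in> H" "c dvd 1" "x * c = a"
      unfolding fractions_def by auto
    hence "(- x) * c = - a" by simp
    thus "- x \<in> fractions H" unfolding fractions_def using * HR(5)[OF *(1)] by blast
  qed
  moreover have "\<exists>y\<in>fractions H. x * y = 1" if x: "x \<in> fractions H" "x \<noteq> 0" for x
  proof -
    obtain a c where *: "a \<in> H" "c \<in> H" "c dvd 1" "x * c = a"
      using x unfolding fractions_def by auto
    obtain c' where c': "c * c' = 1" using *(3) by (metis dvdE)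
    have "x = a * c'" using *(4) c' by (metis mult.assoc mult.right_neutral)
    hence "a \<noteq> 0" using x by auto
    then obtain a' where a': "a * a' = 1" using U[OF *(1)] by (metis dvdE)
    have "x * (c * a') = 1" using *(4) a' by (metis mult.assoc)
    moreover have "c * a' * a = c" "a dvd 1" using a' by (simp_all add: mult.assoc mult.commute[of a'] dvdI[OF a'[symmetric]])
    hence "c * a' \<in> fractions H" unfolding fractions_def using * by blast
    ultimately show ?thesis by blast
  qed
  ultimately show ?thesis unfolding is_subfield_def by blast
qed

lemma is_subfield_fractions_field:
  fixes H :: "'b::field set"
  shows "is_subring H \<Longrightarrow> is_subfield (fractions H)"
  by (rule is_subfield_fractions) (auto simp: dvd_field_iff)

lemma is_subfield_Union_chain:
  assumes "C \<noteq> {}" "subset.chain UNIV C" "\<And>G. G \<in> C \<Longrightarrow> is_subfield G"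
  shows "is_subfield (\<Union>C)"
proof -
  have two: "\<exists>G\<in>C. x \<in> G \<and> y \<in> G" if xy: "x \<in> \<Union>C" "y \<in> \<Union>C" for x y
  proof -
    obtain A B where AB: "A \<in> C" "x \<in> A" "B \<in> C" "y \<in> B" using xy by blast
    have "A \<subseteq> B \<or> B \<subseteq> A" using assms(2) AB unfolding subset_chain_def by blast
    thus ?thesis using AB by blast
  qed
  show ?thesis unfolding is_subfield_def is_subring_def
  proof (intro conjI ballI impI)
    show "1 \<in> \<Union>C" using assms(1) is_subringD(2)[OF is_subfield_subring[OF assms(3)]] by blast
  next
    fix x y assume "x \<in> \<Union>C" "y \<in> \<Union>C"
    then obtain G where "G \<in> C" "x \<in> G" "y \<in> G" using two by blast
    thus "x + y \<in> \<Union>C" "x * y \<in> \<Union>C"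
      using is_subringD(3,4)[OF is_subfield_subring[OF assms(3)]] by blast+
  next
    fix x assume "x \<in> \<Union>C"
    then obtain G where G: "G \<in> C" "x \<in> G" by blast
    thus "- x \<in> \<Union>C"
      using is_subringD(5)[OF is_subfield_subring[OF assms(3)]] by blast
    assume "x \<noteq> 0"
    then obtain y where "y \<in> G" "x * y = 1" using assms(3)[OF G(1)] G(2) unfolding is_subfield_def by blast
    thus "\<exists>y\<in>\<Union>C. x * y = 1" using G by blast
  qed
qed

definition ring_homo :: "('s::comm_ring_1 \<Rightarrow> 't::comm_ring_1) \<Rightarrow> bool" where
  "ring_homo f \<longleftrightarrow> f 1 = 1 \<and> (\<forall>x y. f (x + y) = f x + f y) \<and> (\<forall>x y. f (x * y) = f x * f y)"

lemma ring_homoD: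
  assumes "ring_homo f"
  shows "f 0 = 0" "f 1 = 1" "f (x + y) = f x + f y" "f (x * y) = f x * f y" "f (- x) = - f x"
    "f (x - y) = f x - f y" "f (x ^ n) = f x ^ n" "f (sum g A) = (\<Sum>i\<in>A. f (g i))" "f (prod g A) = (\<Prod>i\<in>A. f (g i))"
    "f (of_nat n) = of_nat n" "f (of_int k) = of_int k"
proof -
  note F = assms[unfolded ring_homo_def]
  show one: "f 1 = 1" and add: "\<And>x y. f (x + y) = f x + f y" and mult: "\<And>x y. f (x * y) = f x * f y"
    using F by blast+
  have "f 0 + f 0 = f 0" using add[of 0 0] by simp
  thus zero: "f 0 = 0" by simp
  show neg: "f (- x) = - f x" for x
    using add[of x "-x"] zero by (simp add: eq_neg_iff_add_eq_0 add.commute)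
  show "f (x - y) = f x - f y" using add[of x "-y"] neg by simp
  show "f (x ^ n) = f x ^ n" by (induction n) (auto simp: one mult)
  show "f (sum g A) = (\<Sum>i\<in>A. f (g i))" by (induction A rule: infinite_finite_induct) (auto simp: zero add)
  show "f (prod g A) = (\<Prod>i\<in>A. f (g i))" by (induction A rule: infinite_finite_induct) (auto simp: one mult)
  show nat: "f (of_nat n) = of_nat n" for n by (induction n) (auto simp: zero one add)
  show "f (of_int k) = of_int k" by (cases k rule: int_cases2) (auto simp: nat neg)
qed

lemma ring_homo_inverse:
  fixes f :: "'b::field \<Rightarrow> 'c::field"
  assumes "ring_homo f" shows "f (inverse x) = inverse (f x)" "f (x / y) = f x / f y" "f x = 0 \<longleftrightarrow> x = 0"
proof -
  have i: "f (inverse x) = inverse (f x)" for x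
  proof (cases "x = 0")
    case False
    hence "f x * f (inverse x) = 1" using ring_homoD(2,4)[OF assms] by (metis right_inverse)
    thus ?thesis using inverse_unique by metis
  qed (simp add: ring_homoD(1)[OF assms])
  show "f (inverse x) = inverse (f x)" by (rule i)
  show "f (x / y) = f x / f y" by (simp add: divide_inverse i ring_homoD(4)[OF assms])
  show "f x = 0 \<longleftrightarrow> x = 0"
    using ring_homoD(1,2,4)[OF assms] by (metis mult_zero_left right_inverse zero_neq_one)
qed

lemma ring_homo_poly:
  assumes "ring_homo f"
  shows "f (poly p x) = poly (map_poly f p) (f x)"
  by (induction p) (auto simp: map_poly_pCons ring_homoD[OF assms])

lemma maximal_subfield:
  assumes "is_subfield G0"
  obtains G where "is_subfield G" "G0 \<subseteq> G" "\<And>G'. is_subfield G' \<Longrightarrow> G \<subseteq> G' \<Longrightarrow> G' = G"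
proof -
  let ?A = "{G. is_subfield G \<and> G0 \<subseteq> G}"
  have "\<exists>M\<in>?A. \<forall>Y\<in>?A. M \<subseteq> Y \<longrightarrow> Y = M"
  proof (rule subset_Zorn_nonempty)
    show "?A \<noteq> {}" using assms by auto
    fix C assume C: "C \<noteq> {}" "subset.chain ?A C"
    have "subset.chain UNIV C" using C(2) unfolding subset.chain_def by auto
    hence "is_subfield (\<Union>C)" using C by (intro is_subfield_Union_chain) (auto simp: subset.chain_def)
    moreover obtain B where "B \<in> C" using C(1) by blast
    hence "B \<subseteq> \<Union>C" "G0 \<subseteq> B" using C(2) unfolding subset.chain_def by auto
    ultimately show "\<Union>C \<in> ?A" by blast
  qed
  thus thesis using that by auto
qed

text \<open>
  When \<open>\<pi>\<close> is a ring homomorphism, it is injective on every subfield \<open>G\<close> of \<open>S\<close>, so that \<open>G\<close> is the graph of a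
  section of \<open>\<pi>\<close> over the field \<open>\<pi> ` G\<close>. With dual numbers for \<open>S\<close> such sections are derivations, with a product of two fields
  they are field homomorphisms. A maximal subfield exists by Zorn's lemma, and the hypothesis \<open>step\<close> lets one adjoin a
  preimage of any missing element.
\<close>
theorem section_extension:
  fixes \<pi> :: "'s::comm_ring_1 \<Rightarrow> 'b::field"
  assumes G0: "is_subfield G0"
    and step: "\<And>G b. is_subfield G \<Longrightarrow> G0 \<subseteq> G \<Longrightarrow> b \<notin> \<pi> ` G \<Longrightarrow>
        \<exists>b'. \<pi> b' = b \<and> (\<forall>x\<in>adjoin G b'. x = 0 \<or> x dvd 1)"
  obtains G where "is_subfield G" "G0 \<subseteq> G" "\<pi> ` G = UNIV"
proof -
  obtain G where G: "is_subfield G" "G0 \<subseteq> G" and max: "\<And>G'. is_subfield G' \<Longrightarrow> G \<subseteq> G' \<Longrightarrow> G' = G"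
    using maximal_subfield[OF G0] by blast
  have "b \<in> \<pi> ` G" for b
  proof (rule ccontr)
    assume b: "b \<notin> \<pi> ` G"
    obtain b' where b': "\<pi> b' = b" "\<forall>x\<in>adjoin G b'. x = 0 \<or> x dvd 1" using step[OF G b] by blast
    note SR = is_subfield_subring[OF G(1)]
    have "is_subfield (fractions (adjoin G b'))"
      using b'(2) is_subring_adjoin[OF SR] by (intro is_subfield_fractions) auto
    moreover have "adjoin G b' \<subseteq> fractions (adjoin G b')"
      by (intro subset_fractions is_subring_adjoin SR)
    moreover have "G \<subseteq> adjoin G b'" "b' \<in> adjoin G b'" using subset_adjoin[OF SR] in_adjoin[OF SR] by auto
    ultimately have "b' \<in> G" using max by blast
    thus False using b b' by blast
  qed
  thus thesis using that G by blast
qed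

definition algebraic_over :: "'b::field set \<Rightarrow> 'b \<Rightarrow> bool" where
  "algebraic_over L b \<longleftrightarrow> (\<exists>p\<in>polys_over L. p \<noteq> 0 \<and> poly p b = 0)"

text \<open>
  A minimal polynomial of \<open>b\<close> over \<open>\<pi> ` G\<close>, lifted to coefficients in \<open>G\<close>. Working with the lift
  keeps track of a section and of the polynomial at the same time.
\<close>
definition min_poly_section :: "('s::comm_ring_1 \<Rightarrow> 'b::field) \<Rightarrow> 's set \<Rightarrow> 'b \<Rightarrow> 's poly \<Rightarrow> bool" where
  "min_poly_section \<pi> G b p \<longleftrightarrow> p \<in> polys_over G \<and> p \<noteq> 0 \<and> poly (map_poly \<pi> p) b = 0 \<and>
     (\<forall>q\<in>polys_over G. q \<noteq> 0 \<longrightarrow> degree q < degree p \<longrightarrow> poly (map_poly \<pi> q) b \<noteq> 0)"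

lemma section_inj:
  fixes \<pi> :: "'s::comm_ring_1 \<Rightarrow> 'b::field"
  assumes "is_subfield G" "ring_homo \<pi>" "x \<in> G" "\<pi> x = 0" shows "x = 0"
proof (rule ccontr)
  assume "x \<noteq> 0"
  then obtain y where "x * y = 1" using assms unfolding is_subfield_def by blast
  hence "\<pi> x * \<pi> y = 1" using ring_homoD(2,4)[OF assms(2)] by metis
  thus False using assms by simp
qed

lemma map_poly_section_eq_0:
  fixes \<pi> :: "'s::comm_ring_1 \<Rightarrow> 'b::field"
  assumes "is_subfield G" "ring_homo \<pi>" "p \<in> polys_over G" "map_poly \<pi> p = 0" shows "p = 0"
proof (rule poly_eqI)
  fix i
  have "\<pi> (coeff p i) = coeff (map_poly \<pi> p) i" by (simp add: coeff_map_poly ring_homoD(1)[OF assms(2)])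
  thus "coeff p i = coeff 0 i" using section_inj[OF assms(1,2)] assms(3,4) by (auto simp: polys_over_def)
qed

lemma map_poly_section_degree:
  fixes \<pi> :: "'s::comm_ring_1 \<Rightarrow> 'b::field"
  assumes "is_subfield G" "ring_homo \<pi>" "p \<in> polys_over G"
  shows "degree (map_poly \<pi> p) = degree p"
proof (cases "p = 0")
  case False
  have "lead_coeff p \<in> G" using assms(3) by (auto simp: polys_over_def)
  hence "\<pi> (lead_coeff p) \<noteq> 0" using section_inj[OF assms(1,2)] False by (metis leading_coeff_0_iff)
  hence "degree (map_poly \<pi> p) \<ge> degree p" by (intro le_degree) (simp add: coeff_map_poly ring_homoD(1)[OF assms(2)])
  thus ?thesis using map_poly_degree_leq[of \<pi> p] by simp
qed (simp add: ring_homoD(1)[OF assms(2)])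

lemma polys_over_lift:
  fixes \<pi> :: "'s::comm_ring_1 \<Rightarrow> 'b::field"
  assumes "is_subring G" "ring_homo \<pi>" "p \<in> polys_over (\<pi> ` G)"
  obtains q where "q \<in> polys_over G" "map_poly \<pi> q = p"
proof -
  have "\<exists>c. c \<in> G \<and> \<pi> c = coeff p i" for i using assms(3) unfolding polys_over_def by auto (metis image_iff)
  then obtain c where c: "\<And>i. c i \<in> G" "\<And>i. \<pi> (c i) = coeff p i" by metis
  define q where "q = Poly (map c [0..<Suc (degree p)])"
  have cq: "coeff q i = (if i < Suc (degree p) then c i else 0)" for i
    unfolding q_def by (simp add: nth_default_def del: upt_Suc)
  have "q \<in> polys_over G" using c cq is_subringD(1)[OF assms(1)] by (auto simp: polys_over_def)
  moreover have "map_poly \<pi> q = p"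
    by (rule poly_eqI) (auto simp: coeff_map_poly ring_homoD(1)[OF assms(2)] cq c coeff_eq_0)
  ultimately show thesis using that by blast
qed

lemma min_poly_section_exists:
  fixes \<pi> :: "'s::comm_ring_1 \<Rightarrow> 'b::field"
  assumes G: "is_subfield G" and \<pi>: "ring_homo \<pi>" and b: "algebraic_over (\<pi> ` G) b"
  obtains p where "min_poly_section \<pi> G b p"
proof -
  let ?P = "\<lambda>p. p \<in> polys_over G \<and> p \<noteq> 0 \<and> poly (map_poly \<pi> p) b = 0"
  obtain p0 where p0: "p0 \<in> polys_over (\<pi> ` G)" "p0 \<noteq> 0" "poly p0 b = 0" using b unfolding algebraic_over_def by blast
  obtain q0 where "q0 \<in> polys_over G" "map_poly \<pi> q0 = p0"
    using polys_over_lift[OF is_subfield_subring[OF G] \<pi> p0(1)] by blast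
  hence "?P q0" using p0 by (auto simp: map_poly_0)
  then obtain p where "?P p" "\<forall>q. ?P q \<longrightarrow> degree p \<le> degree q"
    using ex_has_least_nat[of ?P q0 degree] by blast
  hence "min_poly_section \<pi> G b p" unfolding min_poly_section_def by (meson not_le)
  thus thesis using that by blast
qed

lemma min_poly_section_degree:
  assumes "is_subfield G" "ring_homo \<pi>" "min_poly_section \<pi> G b p" shows "degree p > 0"
proof (rule ccontr)
  assume "\<not> degree p > 0"
  then obtain c where c: "p = [:c:]" by (metis degree_eq_zeroE gr0I)
  hence "map_poly \<pi> p = [:\<pi> c:]" by (simp add: map_poly_pCons ring_homoD(1)[OF assms(2)])
  hence "map_poly \<pi> p = 0" using assms(3) unfolding min_poly_section_def by simp
  thus False using map_poly_section_eq_0[OF assms(1,2)] assms(3) unfolding min_poly_section_def by blast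
qed

text \<open>
  Euclid's algorithm, run on the lifted polynomials: division with remainder by the minimal polynomial reduces to
  polynomials \<open>s\<close> of smaller degree. Dividing \<open>p\<close> by \<open>s\<close> produces a nonzero remainder of smaller degree than
  \<open>s\<close>, since otherwise \<open>p\<close> would factor and contradict minimality. Hence \<open>s\<close> takes a unit value at the root \<open>b'\<close> by
  induction.
\<close>
lemma adjoin_algebraic_unit:
  fixes \<pi> :: "'s::comm_ring_1 \<Rightarrow> 'b::field"
  assumes G: "is_subfield G" and \<pi>: "ring_homo \<pi>" and p: "min_poly_section \<pi> G b p"
    and root: "poly p b' = 0" and x: "x \<in> adjoin G b'"
  shows "x = 0 \<or> x dvd 1"
proof -
  note SR = is_subfield_subring[OF G]
  have pp: "p \<in> polys_over G" "p \<noteq> 0" and pb: "poly (map_poly \<pi> p) b = 0"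
    and min: "\<And>q. q \<in> polys_over G \<Longrightarrow> q \<noteq> 0 \<Longrightarrow> degree q < degree p \<Longrightarrow> poly (map_poly \<pi> q) b \<noteq> 0"
    using p unfolding min_poly_section_def by auto
  have unit: "poly s b' dvd 1" if "s \<in> polys_over G" "s \<noteq> 0" "degree s < degree p" for s
    using that
  proof (induction "degree s" arbitrary: s rule: less_induct)
    case less
    show ?case
    proof (cases "degree s = 0")
      case True
      then obtain c where c: "s = [:c:]" by (metis degree_eq_zeroE)
      have "coeff s 0 \<in> G" using less.prems(1) unfolding polys_over_def by blast
      hence "c \<in> G" "c \<noteq> 0" using c less.prems(2) by auto
      then obtain d where "c * d = 1" using G unfolding is_subfield_def by blast
      thus ?thesis using c by (auto simp: dvd_def)
    next
      case False
      obtain d r where dr: "d \<in> polys_over G" "r \<in> polys_over G" "p = s * d + r" "r = 0 \<or> degree r < degree s"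
        using polys_over_division[OF G pp(1) less.prems(1,2)] by blast
      have hom: "poly (map_poly \<pi> (s * d)) b = poly (map_poly \<pi> s) b * poly (map_poly \<pi> d) b"
      proof -
        have "map_poly \<pi> (s * d) = map_poly \<pi> s * map_poly \<pi> d"
          by (rule poly_eqI) (simp add: coeff_map_poly coeff_mult ring_homoD[OF \<pi>])
        thus ?thesis by simp
      qed
      have "r \<noteq> 0"
      proof
        assume "r = 0"
        hence psd: "p = s * d" using dr by simp
        hence d0: "d \<noteq> 0" using pp by auto
        have sd: "map_poly \<pi> p = map_poly \<pi> s * map_poly \<pi> d" unfolding psd
          by (rule poly_eqI) (simp add: coeff_map_poly coeff_mult ring_homoD[OF \<pi>])
        have "degree (map_poly \<pi> p) = degree (map_poly \<pi> s) + degree (map_poly \<pi> d)"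
          unfolding sd using map_poly_section_eq_0[OF G \<pi>] less.prems d0 dr(1) by (intro degree_mult_eq) auto
        hence "degree p = degree s + degree d"
          using map_poly_section_degree[OF G \<pi>] pp less.prems(1) dr(1) by simp
        hence "degree d < degree p" using False by simp
        hence "poly (map_poly \<pi> d) b \<noteq> 0" using min dr(1) d0 by blast
        moreover have "poly (map_poly \<pi> s) b \<noteq> 0" using min less.prems by blast
        ultimately show False using pb hom psd by simp
      qed
      hence "degree r < degree s" using dr by auto
      hence u: "poly r b' dvd 1" using less.hyps[OF _ dr(2) \<open>r \<noteq> 0\<close>] less.prems by auto
      have "poly s b' * poly d b' + poly r b' = 0" using root dr(3) by simp
      hence "poly r b' = poly s b' * (- poly d b')" by (simp add: eq_neg_iff_add_eq_0 add.commute)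
      thus ?thesis using u by (metis dvd_trans dvd_triv_left)
    qed
  qed
  obtain q where q: "q \<in> polys_over G" "x = poly q b'" using x unfolding adjoin_def by blast
  obtain d r where dr: "d \<in> polys_over G" "r \<in> polys_over G" "q = p * d + r" "r = 0 \<or> degree r < degree p"
    using polys_over_division[OF G q(1) pp] by blast
  have "x = poly r b'" using q dr root by simp
  thus ?thesis using unit[OF dr(2)] dr(4) by (cases "r = 0") auto
qed

lemma adjoin_transcendental_unit:
  fixes \<pi> :: "'s::comm_ring_1 \<Rightarrow> 'b::field"
  assumes G: "is_subfield G" and \<pi>: "ring_homo \<pi>" and local: "\<And>x. \<pi> x \<noteq> 0 \<Longrightarrow> x dvd 1"
    and b: "\<not> algebraic_over (\<pi> ` G) (\<pi> b')" and x: "x \<in> adjoin G b'"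
  shows "x = 0 \<or> x dvd 1"
proof -
  obtain q where q: "q \<in> polys_over G" "x = poly q b'" using x unfolding adjoin_def by blast
  show ?thesis
  proof (cases "\<pi> x = 0")
    case True
    hence "poly (map_poly \<pi> q) (\<pi> b') = 0" using q ring_homo_poly[OF \<pi>] by metis
    moreover have "map_poly \<pi> q \<in> polys_over (\<pi> ` G)"
      using q(1) by (auto simp: polys_over_def coeff_map_poly ring_homoD(1)[OF \<pi>])
    ultimately have "map_poly \<pi> q = 0" using b unfolding algebraic_over_def by blast
    thus ?thesis using map_poly_section_eq_0[OF G \<pi> q(1)] q(2) by simp
  qed (use local in blast)
qed

section \<open>Derivations and their extension\<close>

definition is_deriv :: "('b::comm_ring_1 \<Rightarrow> 'b) \<Rightarrow> bool" where
  "is_deriv d \<longleftrightarrow> (\<forall>x y. d (x + y) = d x + d y) \<and> (\<forall>x y. d (x * y) = x * d y + y * d x)"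

lemma is_derivD:
  fixes d :: "'b::comm_ring_1 \<Rightarrow> 'b"
  assumes "is_deriv d"
  shows "d (x + y) = d x + d y" "d (x * y) = x * d y + y * d x" "d 0 = 0" "d 1 = 0" "d (- x) = - d x"
    "d (x - y) = d x - d y" "d (sum f A) = (\<Sum>i\<in>A. d (f i))"
    "d (of_nat n) = 0" "d (of_int k) = 0"
proof -
  show add: "d (x + y) = d x + d y" for x y using assms unfolding is_deriv_def by blast
  show mult: "d (x * y) = x * d y + y * d x" for x y using assms unfolding is_deriv_def by blast
  show zero: "d 0 = 0" using add[of 0 0] by simp
  show one: "d 1 = 0" using mult[of 1 1] by simp
  show neg: "d (- x) = - d x" for x using add[of x "-x"] zero by (simp add: eq_neg_iff_add_eq_0 add.commute)
  show "d (x - y) = d x - d y" using add[of x "-y"] neg by simp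
  show "d (sum f A) = (\<Sum>i\<in>A. d (f i))" by (induction A rule: infinite_finite_induct) (auto simp: zero add)
  show nat: "d (of_nat n) = 0" for n by (induction n) (auto simp: zero one add)
  show "d (of_int k) = 0" by (cases k rule: int_cases2) (auto simp: nat neg)
qed

lemma is_deriv_inverse:
  fixes d :: "'b::field \<Rightarrow> 'b"
  assumes "is_deriv d" "x \<noteq> 0" shows "d (inverse x) / inverse x = - (d x / x)"
proof -
  have "d (x * inverse x) = 0" using assms is_derivD(4) by simp
  hence "x * d (inverse x) + inverse x * d x = 0" using is_derivD(2)[OF assms(1)] by simp
  thus ?thesis using assms(2) by (simp add: field_simps eq_neg_iff_add_eq_0)
qed

lemma is_deriv_log_mult:
  fixes d :: "'b::field \<Rightarrow> 'b"
  assumes "is_deriv d" "x \<noteq> 0" "y \<noteq> 0" shows "d (x * y) / (x * y) = d x / x + d y / y"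
  using assms(2,3) by (simp add: is_derivD(2)[OF assms(1)] field_simps)

lemma is_deriv_log_power:
  fixes d :: "'b::field \<Rightarrow> 'b"
  assumes d: "is_deriv d" and x: "x \<noteq> 0" shows "d (x ^ n) / (x ^ n) = of_nat n * (d x / x)"
proof (induction n)
  case (Suc n)
  have "d (x ^ Suc n) / (x ^ Suc n) = d x / x + d (x ^ n) / x ^ n"
    using is_deriv_log_mult[OF d x, of "x ^ n"] x by simp
  thus ?case unfolding Suc by (simp add: ring_distribs add_divide_distrib)
qed (simp add: is_derivD(4)[OF d])

lemma is_deriv_log_powi:
  fixes d :: "'b::field \<Rightarrow> 'b"
  assumes d: "is_deriv d" and x: "x \<noteq> 0" shows "d (x powi k) / (x powi k) = of_int k * (d x / x)"
proof (cases k rule: int_cases2)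
  case (nonneg n)
  thus ?thesis using is_deriv_log_power[OF d x] by simp
next
  case (nonpos n)
  have "d (inverse (x ^ n)) / inverse (x ^ n) = - (of_nat n * (d x / x))"
    using is_deriv_inverse[OF d, of "x ^ n"] is_deriv_log_power[OF d x, of n] x by simp
  thus ?thesis using nonpos by (simp add: power_int_minus)
qed

lemma is_deriv_log_prod:
  fixes d :: "'b::field \<Rightarrow> 'b"
  assumes d: "is_deriv d" and f: "\<And>i. i \<in> A \<Longrightarrow> f i \<noteq> 0"
  shows "d (prod f A) / prod f A = (\<Sum>i\<in>A. d (f i) / f i)"
  using f
proof (induction A rule: infinite_finite_induct)
  case (insert a A)
  have "d (f a * prod f A) / (f a * prod f A) = d (f a) / f a + d (prod f A) / prod f A"
    using insert by (intro is_deriv_log_mult[OF d]) auto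
  thus ?case using insert by simp
qed (simp_all add: is_derivD(4)[OF d])

lemma is_deriv_lincomb:
  assumes "\<And>i. i \<in> A \<Longrightarrow> is_deriv (d i)"
  shows "is_deriv (\<lambda>x. \<Sum>i\<in>A. c i * d i x)"
  using assms unfolding is_deriv_def by (auto simp: ring_distribs sum.distrib sum_distrib_left ac_simps)

lemma is_deriv_add:
  assumes "is_deriv d" "is_deriv e"
  shows "is_deriv (\<lambda>x. d x + e x)"
  using assms unfolding is_deriv_def by (auto simp: algebra_simps)

lemma is_deriv_commutator:
  assumes "is_deriv d" "is_deriv e" shows "is_deriv (\<lambda>x. d (e x) - e (d x))"
  unfolding is_deriv_def by (simp add: is_derivD[OF assms(1)] is_derivD[OF assms(2)] algebra_simps)

definition const_field :: "('b::field \<Rightarrow> 'b) set \<Rightarrow> 'b set" where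
  "const_field \<Delta> = {c. \<forall>d\<in>\<Delta>. d c = 0}"

lemma is_subfield_const_field:
  assumes "\<And>d. d \<in> \<Delta> \<Longrightarrow> is_deriv d" shows "is_subfield (const_field \<Delta>)"
proof (rule is_subfieldI_inverse)
  show "is_subring (const_field \<Delta>)"
    unfolding is_subring_def const_field_def using assms by (auto simp: is_derivD)
  fix x assume x: "x \<in> const_field \<Delta>"
  show "inverse x \<in> const_field \<Delta>"
  proof (cases "x = 0")
    case False
    have "d (inverse x) = 0" if "d \<in> \<Delta>" for d
    proof -
      have "d x = 0" using x that by (simp add: const_field_def)
      hence "d (inverse x) / inverse x = 0" using is_deriv_inverse[OF assms[OF that] False] by simp
      thus ?thesis using False by simp
    qed
    thus ?thesis by (simp add: const_field_def)
  qed (use x in simp)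
qed

lemma is_subring_image:
  assumes "is_subring G" "ring_homo f" shows "is_subring (f ` G)"
  unfolding is_subring_def
proof (intro conjI ballI)
  show "1 \<in> f ` G" using is_subringD(2)[OF assms(1)] ring_homoD(2)[OF assms(2)] by (metis image_eqI)
  fix x assume "x \<in> f ` G"
  then obtain a where a: "a \<in> G" "x = f a" by blast
  thus "- x \<in> f ` G" using is_subringD(5)[OF assms(1)] ring_homoD(5)[OF assms(2)] by (metis image_eqI)
  fix y assume "y \<in> f ` G"
  then obtain b where "b \<in> G" "y = f b" by blast
  thus "x + y \<in> f ` G" "x * y \<in> f ` G" using a is_subringD(3,4)[OF assms(1)] ring_homoD(3,4)[OF assms(2)]
    by (metis image_eqI)+
qed

lemma min_poly_section_separable:
  fixes \<pi> :: "'s::comm_ring_1 \<Rightarrow> 'b::field_char_0"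
  assumes G: "is_subfield G" and \<pi>: "ring_homo \<pi>" and p: "min_poly_section \<pi> G b p"
  shows "poly (pderiv (map_poly \<pi> p)) b \<noteq> 0"
proof -
  note SR = is_subfield_subring[OF G]
  define P where "P = map_poly \<pi> p"
  have pp: "p \<in> polys_over G"
    and min: "\<And>q. q \<in> polys_over G \<Longrightarrow> q \<noteq> 0 \<Longrightarrow> degree q < degree p \<Longrightarrow> poly (map_poly \<pi> q) b \<noteq> 0"
    using p unfolding min_poly_section_def by auto
  have deg: "degree P > 0" "degree P = degree p"
    using min_poly_section_degree[OF G \<pi> p] map_poly_section_degree[OF G \<pi> pp] by (simp_all add: P_def)
  have "P \<in> polys_over (\<pi> ` G)" using pp by (auto simp: P_def polys_over_def coeff_map_poly ring_homoD(1)[OF \<pi>])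
  hence "pderiv P \<in> polys_over (\<pi> ` G)" by (intro polys_over_pderiv is_subring_image SR \<pi>)
  then obtain q where q: "q \<in> polys_over G" "map_poly \<pi> q = pderiv P"
    using polys_over_lift[OF SR \<pi>] by blast
  have "pderiv P \<noteq> 0" using deg by (auto simp: pderiv_eq_0_iff)
  hence "q \<noteq> 0" using q by auto
  moreover have "degree q < degree p"
    using map_poly_section_degree[OF G \<pi> q(1)] q(2) deg by (simp add: degree_pderiv)
  ultimately have "poly (map_poly \<pi> q) b \<noteq> 0" using min[OF q(1)] by blast
  thus ?thesis using q(2) by (simp add: P_def)
qed

text \<open>
  Apply \<open>e\<close> to a minimal equation \<open>p(x) = 0\<close> to get \<open>\<sigma>(p'(x)) e(x) = 0\<close>; the field has characteristic \<open>0\<close>, so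
  \<open>p'(x) \<noteq> 0\<close>. The twist by \<open>\<sigma>\<close> is there to compare \<open>d \<circ> \<sigma>\<close> with \<open>\<sigma> \<circ> d\<close> for a derivation \<open>d\<close>.
\<close>
lemma twisted_deriv_eq_0_algebraic:
  fixes \<sigma> e :: "'b::field_char_0 \<Rightarrow> 'b"
  assumes \<sigma>: "ring_homo \<sigma>" and add: "\<And>x y. e (x + y) = e x + e y"
    and mult: "\<And>x y. e (x * y) = \<sigma> x * e y + \<sigma> y * e x"
    and L: "is_subfield L" "\<And>x. x \<in> L \<Longrightarrow> e x = 0" and x: "algebraic_over L x"
  shows "e x = 0"
proof -
  have id: "ring_homo (\<lambda>x::'b. x)" by (simp add: ring_homo_def)
  have e0: "e 0 = 0" using add[of 0 0] by simp
  have mpi: "map_poly (\<lambda>x. x) q = q" for q :: "'b poly" by (simp add: map_poly_idI)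
  obtain p where p: "min_poly_section (\<lambda>x. x) L x p"
    using min_poly_section_exists[OF L(1) id] x by auto

  have ep: "e (poly q x) = \<sigma> (poly (pderiv q) x) * e x" if "q \<in> polys_over L" for q
    using that
  proof (induction q)
    case 0 thus ?case by (simp add: e0 ring_homoD(1)[OF \<sigma>])
  next
    case (pCons a q)
    have "a \<in> L" "q \<in> polys_over L" using pCons(3) unfolding polys_over_def
      by (auto simp: coeff_pCons split: nat.splits)
    thus ?case using pCons(2) L(2) by (simp add: add mult pderiv_pCons ring_homoD[OF \<sigma>] algebra_simps)
  qed
  have pp: "p \<in> polys_over L" and "poly p x = 0" using p unfolding min_poly_section_def mpi by auto
  have "poly (pderiv p) x \<noteq> 0" using min_poly_section_separable[OF L(1) id p] unfolding mpi .
  hence "\<sigma> (poly (pderiv p) x) \<noteq> 0" using ring_homo_inverse(3)[OF \<sigma>] by blast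
  moreover have "\<sigma> (poly (pderiv p) x) * e x = 0" using ep[OF pp] \<open>poly p x = 0\<close> e0 by simp
  ultimately show ?thesis by simp
qed

lemma deriv_eq_0_algebraic:
  fixes d :: "'b::field_char_0 \<Rightarrow> 'b"
  assumes "is_deriv d" "is_subfield L" "\<And>x. x \<in> L \<Longrightarrow> d x = 0" "algebraic_over L x"
  shows "d x = 0"
  by (rule twisted_deriv_eq_0_algebraic[of "\<lambda>x. x" d L x])
    (use assms is_derivD[OF assms(1)] in \<open>auto simp: ring_homo_def\<close>)

text \<open>
  Dual numbers \<open>a + b \<epsilon>\<close> with \<open>\<epsilon>\<^sup>2 = 0\<close>: a map \<open>d\<close> is a derivation iff \<open>a \<mapsto> a + d(a) \<epsilon>\<close> is multiplicative and additive.
\<close>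
datatype 'b dual = Dual (re: 'b) (ep: 'b)

instantiation dual :: (comm_ring_1) comm_ring_1
begin
definition "0 = Dual 0 0"
definition "1 = Dual 1 0"
definition "x + y = Dual (re x + re y) (ep x + ep y)"
definition "x - y = Dual (re x - re y) (ep x - ep y)"
definition "- x = Dual (- re x) (- ep x)"
definition "x * y = Dual (re x * re y) (re x * ep y + re y * ep x)"
instance
  by standard (auto simp: zero_dual_def one_dual_def plus_dual_def minus_dual_def uminus_dual_def
      times_dual_def algebra_simps intro: dual.expand)
end

lemma dual_sel [simp]:
  "re (0 :: 'b::comm_ring_1 dual) = 0" "re (1 :: 'b dual) = 1" "re (x + y) = re x + re (y :: 'b dual)"
  "re (x * y) = re x * re y" "re (- x) = - re x"
  "ep (0 :: 'b dual) = 0" "ep (1 :: 'b dual) = 0" "ep (x + y) = ep x + ep y"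
  "ep (x * y) = re x * ep y + re y * ep x" "ep (- x) = - ep x"
  by (auto simp: zero_dual_def one_dual_def plus_dual_def minus_dual_def uminus_dual_def times_dual_def)

lemma ring_homo_re: "ring_homo (re :: 'b::comm_ring_1 dual \<Rightarrow> 'b)"
  by (simp add: ring_homo_def)

lemma dual_unit: "re x \<noteq> 0 \<Longrightarrow> (x :: 'b::field dual) dvd 1"
  by (rule dvdI[of _ _ "Dual (inverse (re x)) (- ep x / (re x * re x))"]) (auto intro!: dual.expand simp: field_simps)

lemma poly_dual:
  fixes p :: "'b::field dual poly"
  shows "poly p (Dual b t) = Dual (poly (map_poly re p) b)
    (poly (map_poly ep p) b + t * poly (pderiv (map_poly re p)) b)"
  by (induction p) (auto intro!: dual.expand simp: map_poly_pCons pderiv_pCons algebra_simps)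

text \<open>
  The step of \<open>section_extension\<close>. Over a transcendental element every lift works. For an algebraic element
  \<open>b\<close> with minimal polynomial \<open>p\<close>, the lift \<open>b + t \<epsilon>\<close> has to be a root of the lifted polynomial, which is a linear
  equation for \<open>t\<close> with leading coefficient \<open>p'(b) \<noteq> 0\<close>.
\<close>
theorem dual_section_gives_deriv:
  fixes G0 :: "'b::field_char_0 dual set"
  assumes G0: "is_subfield G0"
  shows "\<exists>d. is_deriv d \<and> (\<forall>x\<in>G0. d (re x) = ep x)"
proof -
  obtain G :: "'b dual set" where G: "is_subfield G" "G0 \<subseteq> G" "re ` G = UNIV"
  proof (rule section_extension[OF G0, where \<pi> = re])
    fix G :: "'b dual set" and b assume G: "is_subfield G" "G0 \<subseteq> G" "b \<notin> re ` G"
    show "\<exists>b'. re b' = b \<and> (\<forall>x\<in>adjoin G b'. x = 0 \<or> x dvd 1)"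
    proof (cases "algebraic_over (re ` G) b")
      case False
      have "x = 0 \<or> x dvd 1" if "x \<in> adjoin G (Dual b 0)" for x
        by (rule adjoin_transcendental_unit[OF G(1) ring_homo_re dual_unit _ that]) (use False in auto)
      thus ?thesis by (intro exI[of _ "Dual b 0"]) auto
    next
      case True
      then obtain p where p: "min_poly_section re G b p" using min_poly_section_exists[OF G(1) ring_homo_re] by blast
      have pb: "poly (map_poly re p) b = 0"
        using p unfolding min_poly_section_def by auto
      have nz: "poly (pderiv (map_poly re p)) b \<noteq> 0" by (rule min_poly_section_separable[OF G(1) ring_homo_re p])
      define t where "t = - poly (map_poly ep p) b / poly (pderiv (map_poly re p)) b"
      have "poly p (Dual b t) = 0" unfolding poly_dual using nz pb by (simp add: t_def zero_dual_def)
      hence "x = 0 \<or> x dvd 1" if "x \<in> adjoin G (Dual b t)" for x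
        using adjoin_algebraic_unit[OF G(1) ring_homo_re p _ that] by blast
      thus ?thesis by (intro exI[of _ "Dual b t"]) auto
    qed
  qed blast
  define s where "s = inv_into G re"
  have s: "s b \<in> G" "re (s b) = b" for b
    using G(3) unfolding s_def by (metis inv_into_into UNIV_I, metis f_inv_into_f UNIV_I)
  note GR = is_subringD[OF is_subfield_subring[OF G(1)]]
  have uniq: "x = s (re x)" if "x \<in> G" for x
  proof -
    have "x - s (re x) = 0"
      by (rule section_inj[OF G(1) ring_homo_re]) (use that s GR in \<open>auto simp: ring_homoD(6)[OF ring_homo_re]\<close>)
    thus ?thesis by simp
  qed
  have "s (x + y) = s x + s y" "s (x * y) = s x * s y" for x y
    using uniq[of "s x + s y"] uniq[of "s x * s y"] s GR by auto
  hence "is_deriv (\<lambda>x. ep (s x))" unfolding is_deriv_def by (simp add: s)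
  moreover have "ep (s (re x)) = ep x" if "x \<in> G0" for x using uniq that G(2) by auto
  ultimately show ?thesis by (intro exI[of _ "\<lambda>x. ep (s x)"]) auto
qed

lemma is_subfield_dual_graph:
  fixes \<delta> :: "'b::field \<Rightarrow> 'b"
  assumes M: "is_subfield M" and add: "\<And>x y. x \<in> M \<Longrightarrow> y \<in> M \<Longrightarrow> \<delta> (x + y) = \<delta> x + \<delta> y"
    and mult: "\<And>x y. x \<in> M \<Longrightarrow> y \<in> M \<Longrightarrow> \<delta> (x * y) = x * \<delta> y + y * \<delta> x"
  shows "is_subfield ((\<lambda>x. Dual x (\<delta> x)) ` M)"
proof -
  note MR = is_subringD[OF is_subfield_subring[OF M]]
  have "\<delta> 0 + \<delta> 0 = \<delta> 0 + 0" using add[OF MR(1) MR(1)] by (simp only: add_0_right)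
  hence d0: "\<delta> 0 = 0" by (simp only: add_left_cancel)
  have "\<delta> 1 + \<delta> 1 = \<delta> 1 + 0" using mult[OF MR(2) MR(2)] by (simp only: add_0_right mult_1)
  hence d1: "\<delta> 1 = 0" by (simp only: add_left_cancel)
  have neg: "\<delta> (- x) = - \<delta> x" if "x \<in> M" for x
    using add[OF that MR(5)[OF that]] d0 by (simp add: eq_neg_iff_add_eq_0 add.commute)
  show ?thesis unfolding is_subfield_def is_subring_def
  proof (intro conjI ballI impI)
    show "1 \<in> (\<lambda>x. Dual x (\<delta> x)) ` M" using MR(2) d1 by (auto intro!: image_eqI[of _ _ 1] simp: one_dual_def)
  next
    fix x y assume "x \<in> (\<lambda>x. Dual x (\<delta> x)) ` M" "y \<in> (\<lambda>x. Dual x (\<delta> x)) ` M"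
    then obtain a b where "a \<in> M" "b \<in> M" "x = Dual a (\<delta> a)" "y = Dual b (\<delta> b)" by blast
    moreover from this have "x + y = Dual (a + b) (\<delta> (a + b))" "x * y = Dual (a * b) (\<delta> (a * b))"
      using add mult by (auto simp: plus_dual_def times_dual_def)
    ultimately show "x + y \<in> (\<lambda>x. Dual x (\<delta> x)) ` M" "x * y \<in> (\<lambda>x. Dual x (\<delta> x)) ` M"
      using MR(3,4) by blast+
  next
    fix x assume "x \<in> (\<lambda>x. Dual x (\<delta> x)) ` M"
    then obtain a where a: "a \<in> M" "x = Dual a (\<delta> a)" by blast
    thus "- x \<in> (\<lambda>x. Dual x (\<delta> x)) ` M" using MR(5) neg
      by (auto intro!: image_eqI[of _ _ "- a"] simp: uminus_dual_def)
    assume "x \<noteq> 0"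
    hence a0: "a \<noteq> 0" using a d0 by (auto simp: zero_dual_def)
    have i: "inverse a \<in> M" using is_subfield_inverse[OF M a(1)] .
    have "\<delta> (a * inverse a) = a * \<delta> (inverse a) + inverse a * \<delta> a" using mult[OF a(1) i] .
    hence "a * \<delta> (inverse a) + inverse a * \<delta> a = 0" using a0 d1 by simp
    hence "x * Dual (inverse a) (\<delta> (inverse a)) = 1" using a a0 by (auto simp: times_dual_def one_dual_def)
    thus "\<exists>y\<in>(\<lambda>x. Dual x (\<delta> x)) ` M. x * y = 1" using i by blast
  qed
qed

theorem deriv_extension:
  fixes \<delta> :: "'b::field_char_0 \<Rightarrow> 'b"
  assumes M: "is_subfield M" and add: "\<And>x y. x \<in> M \<Longrightarrow> y \<in> M \<Longrightarrow> \<delta> (x + y) = \<delta> x + \<delta> y"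
    and mult: "\<And>x y. x \<in> M \<Longrightarrow> y \<in> M \<Longrightarrow> \<delta> (x * y) = x * \<delta> y + y * \<delta> x"
  shows "\<exists>d. is_deriv d \<and> (\<forall>x\<in>M. d x = \<delta> x)"
  using dual_section_gives_deriv[OF is_subfield_dual_graph[OF M add mult]] by auto

lemma clear_denominators:
  fixes A :: "'b::field set"
  assumes A: "is_subring A" and p: "p \<in> polys_over (fractions A)"
  shows "\<exists>c\<in>A. c \<noteq> 0 \<and> smult c p \<in> polys_over A"
proof -
  note AR = is_subringD[OF A]
  have "\<exists>c. c \<in> A \<and> c \<noteq> 0 \<and> coeff p i * c \<in> A" for i
  proof -
    have "coeff p i \<in> fractions A" using p unfolding polys_over_def by blast
    then obtain a c where "a \<in> A" "c \<in> A" "c dvd 1" "coeff p i * c = a" unfolding fractions_def by blast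
    thus ?thesis by (intro exI[of _ c]) auto
  qed
  then obtain c where c: "\<And>i. c i \<in> A" "\<And>i. c i \<noteq> 0" "\<And>i. coeff p i * c i \<in> A" by metis
  define C where "C = (\<Prod>i\<le>degree p. c i)"
  have "C \<in> A" unfolding C_def by (rule AR(11)) (rule c)
  moreover have "C \<noteq> 0" unfolding C_def using c by auto
  moreover have "C * coeff p i \<in> A" for i
  proof (cases "i \<le> degree p")
    case True
    have "C = c i * (\<Prod>j\<in>{..degree p} - {i}. c j)" unfolding C_def using True by (intro prod.remove) auto
    hence "C * coeff p i = (coeff p i * c i) * (\<Prod>j\<in>{..degree p} - {i}. c j)" by (simp add: ac_simps)
    moreover have "(\<Prod>j\<in>{..degree p} - {i}. c j) \<in> A" by (rule AR(11)) (rule c)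
    ultimately show ?thesis using AR(4)[OF c(3)[of i]] by metis
  qed (use AR(1) in \<open>simp add: coeff_eq_0\<close>)
  ultimately show ?thesis by (intro bexI[of _ C]) (auto simp: polys_over_def)
qed

lemma algebraic_over_fractions:
  fixes A :: "'b::field set"
  assumes A: "is_subring A" and z: "algebraic_over (fractions A) z"
  shows "algebraic_over A z"
proof -
  obtain p where p: "p \<in> polys_over (fractions A)" "p \<noteq> 0" "poly p z = 0" using z unfolding algebraic_over_def by blast
  obtain c where "c \<in> A" "c \<noteq> 0" "smult c p \<in> polys_over A" using clear_denominators[OF A p(1)] by blast
  thus ?thesis using p unfolding algebraic_over_def by (intro bexI[of _ "smult c p"]) auto
qed

text \<open>
  The section \<open>a \<mapsto> a\<close> over \<open>A\<close> is first enlarged by the dual number \<open>z + \<epsilon>\<close>.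
\<close>
theorem transcendental_deriv:
  fixes A :: "'b::field_char_0 set"
  assumes A: "is_subring A" and z: "\<not> algebraic_over A z"
  shows "\<exists>d. is_deriv d \<and> (\<forall>a\<in>A. d a = 0) \<and> d z = 1"
proof -
  define M where "M = fractions A"
  have M: "is_subfield M" unfolding M_def by (rule is_subfield_fractions_field[OF A])
  have zM: "\<not> algebraic_over M z" using algebraic_over_fractions[OF A] z unfolding M_def by blast
  define G where "G = (\<lambda>x. Dual x 0) ` M"
  have G: "is_subfield G" unfolding G_def by (rule is_subfield_dual_graph[OF M]) auto
  have reG: "re ` G = M" unfolding G_def by (auto simp: image_image)
  note SR = is_subfield_subring[OF G]
  define H where "H = adjoin G (Dual z 1)"
  have H: "is_subring H" unfolding H_def by (rule is_subring_adjoin[OF SR])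
  have "x = 0 \<or> x dvd 1" if "x \<in> H" for x
    by (rule adjoin_transcendental_unit[OF G ring_homo_re dual_unit _ that[unfolded H_def]]) (use zM reG in auto)
  hence "is_subfield (fractions H)" by (rule is_subfield_fractions[OF H])
  then obtain d where d: "is_deriv d" "\<forall>x\<in>fractions H. d (re x) = ep x" using dual_section_gives_deriv by blast
  have "Dual z 1 \<in> fractions H" using subset_fractions[OF H] in_adjoin[OF SR] H_def by blast
  moreover have "Dual a 0 \<in> fractions H" if "a \<in> A" for a
  proof -
    have "Dual a 0 \<in> G" unfolding G_def M_def using subset_fractions[OF A] that by blast
    thus ?thesis using subset_fractions[OF H] subset_adjoin[OF SR] H_def by blast
  qed
  ultimately show ?thesis using d by (intro exI[of _ d]) fastforce
qed

section \<open>Endomorphisms moving an algebraic element\<close>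

text \<open>
  The product ring of a ring with itself, whose subfields are graphs of partial field homomorphisms.
\<close>
datatype 'b pr = Pr (fst_pr: 'b) (snd_pr: 'b)

instantiation pr :: (comm_ring_1) comm_ring_1
begin
definition "0 = Pr 0 0"
definition "1 = Pr 1 1"
definition "x + y = Pr (fst_pr x + fst_pr y) (snd_pr x + snd_pr y)"
definition "x - y = Pr (fst_pr x - fst_pr y) (snd_pr x - snd_pr y)"
definition "- x = Pr (- fst_pr x) (- snd_pr x)"
definition "x * y = Pr (fst_pr x * fst_pr y) (snd_pr x * snd_pr y)"
instance
  by standard (auto simp: zero_pr_def one_pr_def plus_pr_def minus_pr_def uminus_pr_def
      times_pr_def algebra_simps intro: pr.expand)
end

lemma ring_homo_fst_pr: "ring_homo (fst_pr :: 'b::comm_ring_1 pr \<Rightarrow> 'b)"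
  and ring_homo_snd_pr: "ring_homo (snd_pr :: 'b::comm_ring_1 pr \<Rightarrow> 'b)"
  by (simp_all add: ring_homo_def one_pr_def plus_pr_def times_pr_def)

lemma polys_over_mono: "A \<subseteq> B \<Longrightarrow> polys_over A \<subseteq> polys_over B"
  by (auto simp: polys_over_def)

lemma algebraic_over_mono: "A \<subseteq> B \<Longrightarrow> algebraic_over A x \<Longrightarrow> algebraic_over B x"
  unfolding algebraic_over_def using polys_over_mono by blast

text \<open>
  In characteristic \<open>0\<close> the minimal polynomial of \<open>a\<close> has a root \<open>b \<noteq> a\<close>, and the homomorphism
  \<open>a \<mapsto> b\<close> extends to the whole field, which is algebraically closed and algebraic over \<open>L\<close>.
\<close>
theorem galois_move:
  fixes L :: "'b::{alg_closed_field, field_char_0} set"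
  assumes L: "is_subfield L" and alg: "\<And>x. algebraic_over L x" and a: "a \<notin> L"
  shows "\<exists>\<sigma>. ring_homo \<sigma> \<and> (\<forall>x\<in>L. \<sigma> x = x) \<and> \<sigma> a \<noteq> a"
proof -
  define L' where "L' = (\<lambda>x. Pr x x) ` L"
  note LR = is_subringD[OF is_subfield_subring[OF L]]
  have L': "is_subfield L'"
    unfolding is_subfield_def is_subring_def
  proof (intro conjI ballI impI)
    show "1 \<in> L'" unfolding L'_def using LR(2) by (auto simp: one_pr_def)
  next
    fix x y assume "x \<in> L'" "y \<in> L'"
    thus "x + y \<in> L'" "x * y \<in> L'" unfolding L'_def using LR(3,4) by (auto simp: plus_pr_def times_pr_def)
  next
    fix x assume x: "x \<in> L'"
    thus "- x \<in> L'" unfolding L'_def using LR(5) by (auto simp: uminus_pr_def)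
    assume "x \<noteq> 0"
    then obtain u where u: "u \<in> L" "u \<noteq> 0" "x = Pr u u" using x unfolding L'_def by (auto simp: zero_pr_def)
    thus "\<exists>y\<in>L'. x * y = 1" using is_subfield_inverse[OF L] unfolding L'_def
      by (intro bexI[of _ "Pr (inverse u) (inverse u)"]) (auto simp: times_pr_def one_pr_def)
  qed
  have p1L': "fst_pr ` L' = L" unfolding L'_def by (auto simp: image_image)
  obtain p where p: "min_poly_section fst_pr L' a p"
    using min_poly_section_exists[OF L' ring_homo_fst_pr] alg p1L' by metis
  note SR = is_subfield_subring[OF L']
  have pp: "p \<in> polys_over L'" "p \<noteq> 0" and pa: "poly (map_poly fst_pr p) a = 0"
    using p unfolding min_poly_section_def by auto
  have deg: "degree p > 0" by (rule min_poly_section_degree[OF L' ring_homo_fst_pr p])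
  define P where "P = map_poly fst_pr p"
  have degP: "degree P = degree p" unfolding P_def by (rule map_poly_section_degree[OF L' ring_homo_fst_pr pp(1)])
  have P2: "map_poly snd_pr p = P" unfolding P_def
  proof (rule poly_eqI)
    fix i have "coeff p i \<in> L'" using pp(1) unfolding polys_over_def by blast
    thus "coeff (map_poly snd_pr p) i = coeff (map_poly fst_pr p) i"
      unfolding L'_def by (auto simp: coeff_map_poly ring_homoD(1)[OF ring_homo_fst_pr] ring_homoD(1)[OF ring_homo_snd_pr])
  qed
  have PL: "coeff P i \<in> L" for i
    using pp(1) unfolding polys_over_def P_def p1L'[symmetric] by (auto simp: coeff_map_poly ring_homoD(1)[OF ring_homo_fst_pr])
  obtain Q where Q: "P = [:- a, 1:] * Q" using pa unfolding P_def[symmetric] poly_eq_0_iff_dvd by (auto elim: dvdE)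
  have P0: "P \<noteq> 0" using degP deg by auto
  hence Q0: "Q \<noteq> 0" using Q by auto
  have "degree P = Suc (degree Q)" unfolding Q using Q0 by (subst degree_mult_eq) auto
  moreover have "degree P \<noteq> 1"
  proof
    assume "degree P = 1"
    hence "degree Q = 0" using calculation by simp
    then obtain c where c: "Q = [:c:]" by (metis degree_eq_zeroE)
    hence "coeff P 0 = - a * c" "coeff P 1 = c" "c \<noteq> 0" using Q Q0 by auto
    hence "a = - coeff P 0 / coeff P 1" by simp
    thus False using a PL is_subfield_divide[OF L] LR(5) by metis
  qed
  ultimately have "degree Q > 0" by simp
  then obtain b where b: "poly Q b = 0" using alg_closed_imp_poly_has_root by blast
  have "b \<noteq> a"
  proof
    assume "b = a"
    hence "poly (pderiv P) a = 0" unfolding Q using b by (simp add: pderiv_mult pderiv_pCons del: mult_pCons_left)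
    thus False using min_poly_section_separable[OF L' ring_homo_fst_pr p] P_def by simp
  qed
  have Pb: "poly P b = 0" using Q b by simp
  have pr0: "poly q (Pr u w) = Pr (poly (map_poly fst_pr q) u) (poly (map_poly snd_pr q) w)" for q :: "'b pr poly" and u w
    using ring_homo_poly[OF ring_homo_fst_pr, of q "Pr u w"] ring_homo_poly[OF ring_homo_snd_pr, of q "Pr u w"]
    by (intro pr.expand) auto
  have root: "poly p (Pr a b) = 0" unfolding pr0 using pa Pb P2 by (simp add: zero_pr_def)
  define H where "H = adjoin L' (Pr a b)"
  have H: "is_subring H" unfolding H_def by (rule is_subring_adjoin[OF SR])
  have "x = 0 \<or> x dvd 1" if "x \<in> H" for x
    by (rule adjoin_algebraic_unit[OF L' ring_homo_fst_pr p root that[unfolded H_def]])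
  hence FH: "is_subfield (fractions H)" by (rule is_subfield_fractions[OF H])
  have abH: "Pr a b \<in> fractions H" using subset_fractions[OF H] in_adjoin[OF SR] H_def by blast
  have LH: "Pr x x \<in> fractions H" if "x \<in> L" for x
    using subset_fractions[OF H] subset_adjoin[OF SR] H_def L'_def that by blast
  obtain G :: "'b pr set" where G: "is_subfield G" "fractions H \<subseteq> G" "fst_pr ` G = UNIV"
  proof (rule section_extension[OF FH, where \<pi> = fst_pr])
    fix G :: "'b pr set" and c assume G: "is_subfield G" "fractions H \<subseteq> G" "c \<notin> fst_pr ` G"
    have "L \<subseteq> fst_pr ` G" using LH G(2) by (metis (no_types, lifting) image_eqI pr.sel(1) subset_iff)
    hence "algebraic_over (fst_pr ` G) c" using algebraic_over_mono alg by blast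
    then obtain q where q: "min_poly_section fst_pr G c q" using min_poly_section_exists[OF G(1) ring_homo_fst_pr] by blast
    have qq: "q \<in> polys_over G" "poly (map_poly fst_pr q) c = 0" using q unfolding min_poly_section_def by auto
    have "degree (map_poly snd_pr q) > 0"
      using map_poly_section_degree[OF G(1) ring_homo_snd_pr qq(1)] min_poly_section_degree[OF G(1) ring_homo_fst_pr q] by simp
    then obtain c' where "poly (map_poly snd_pr q) c' = 0" using alg_closed_imp_poly_has_root by blast
    hence "poly q (Pr c c') = 0" unfolding pr0 using qq by (simp add: zero_pr_def)
    hence "x = 0 \<or> x dvd 1" if "x \<in> adjoin G (Pr c c')" for x
      using adjoin_algebraic_unit[OF G(1) ring_homo_fst_pr q _ that] by blast
    thus "\<exists>b'. fst_pr b' = c \<and> (\<forall>x\<in>adjoin G b'. x = 0 \<or> x dvd 1)" by (intro exI[of _ "Pr c c'"]) auto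
  qed blast
  define s where "s = inv_into G fst_pr"
  have s: "s b \<in> G" "fst_pr (s b) = b" for b
    using G(3) unfolding s_def by (metis inv_into_into UNIV_I, metis f_inv_into_f UNIV_I)
  note GR = is_subringD[OF is_subfield_subring[OF G(1)]]
  have uniq: "x = s (fst_pr x)" if "x \<in> G" for x
  proof -
    have "x - s (fst_pr x) = 0"
      by (rule section_inj[OF G(1) ring_homo_fst_pr]) (use that s GR in \<open>auto simp: ring_homoD(6)[OF ring_homo_fst_pr]\<close>)
    thus ?thesis by simp
  qed
  have "s (x + y) = s x + s y" "s (x * y) = s x * s y" "s 1 = 1" for x y
    using uniq[OF GR(3)[OF s(1)[of x] s(1)[of y]]] uniq[OF GR(4)[OF s(1)[of x] s(1)[of y]]] uniq[OF GR(2)]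
    by (simp_all add: s ring_homoD[OF ring_homo_fst_pr])
  hence "ring_homo (\<lambda>x. snd_pr (s x))" unfolding ring_homo_def by (simp add: plus_pr_def times_pr_def one_pr_def)
  moreover have "snd_pr (s x) = x" if "x \<in> L" for x
  proof -
    have "Pr x x = s x" using uniq[of "Pr x x"] LH[OF that] G(2) by auto
    thus ?thesis by (metis pr.sel(2))
  qed
  moreover have "snd_pr (s a) = b"
  proof -
    have "Pr a b = s a" using uniq[of "Pr a b"] abH G(2) by auto
    thus ?thesis by (metis pr.sel(2))
  qed
  ultimately show ?thesis using \<open>b \<noteq> a\<close> by (intro exI[of _ "\<lambda>x. snd_pr (s x)"]) auto
qed

section \<open>Residues of logarithmic derivatives\<close>
lemma fractions_adjoin_least:
  fixes S :: "'b::field set"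
  assumes S: "is_subfield S" and C: "C \<subseteq> S" and z: "z \<in> S"
  shows "fractions (adjoin C z) \<subseteq> S"
proof
  fix x assume "x \<in> fractions (adjoin C z)"
  then obtain a c where ac: "a \<in> adjoin C z" "c \<in> adjoin C z" "c dvd 1" "x * c = a" unfolding fractions_def by blast
  have "adjoin C z \<subseteq> S"
    unfolding adjoin_def using poly_in_subring[OF is_subfield_subring[OF S] _ z] polys_over_mono[OF C] by blast
  hence "a / c \<in> S" using ac is_subfield_divide[OF S] by blast
  moreover have "x = a / c" using ac by (auto simp: field_simps)
  ultimately show "x \<in> S" by simp
qed

lemma algebraic_over_self:
  fixes x :: "'b::field"
  assumes "is_subring A" "x \<in> A" shows "algebraic_over A x"
proof -
  have "[:- x, 1:] \<in> polys_over A"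
    using is_subringD[OF assms(1)] assms(2) by (auto simp: polys_over_def coeff_pCons split: nat.splits)
  thus ?thesis unfolding algebraic_over_def by (intro bexI[of _ "[:- x, 1:]"]) auto
qed

text \<open>
  A polynomial equation for \<open>z\<close> with coefficients in \<open>C[x]\<close> is read as an equation for \<open>x\<close> with coefficients in
  \<open>C[z]\<close>. It stays nontrivial because \<open>z\<close> is transcendental over \<open>C\<close>.
\<close>
lemma algebraic_exchange:
  fixes C :: "'b::field set"
  assumes C: "is_subring C" and z: "\<not> algebraic_over C z" and zx: "algebraic_over (adjoin C x) z"
  shows "algebraic_over (adjoin C z) x"
proof -
  note CR = is_subringD[OF C]
  note PR = is_subringD[OF is_subring_polys_over[OF C]]
  obtain p where p: "p \<in> polys_over (adjoin C x)" "p \<noteq> 0" "poly p z = 0" using zx unfolding algebraic_over_def by blast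
  have "\<exists>a. a \<in> polys_over C \<and> coeff p i = poly a x" for i
  proof -
    have "coeff p i \<in> adjoin C x" using p(1) unfolding polys_over_def by blast
    thus ?thesis unfolding adjoin_def by blast
  qed
  then obtain a where a: "\<And>i. a i \<in> polys_over C" "\<And>i. coeff p i = poly (a i) x" by metis
  define q where "q = (\<Sum>i\<le>degree p. smult (z ^ i) (a i))"
  define r where "r j = (\<Sum>i\<le>degree p. monom (coeff (a i) j) i)" for j
  have rC: "r j \<in> polys_over C" for j unfolding r_def
    using a(1) by (intro PR(10) polys_over_monom[OF C]) (auto simp: polys_over_def)
  have cq: "coeff q j = poly (r j) z" for j
    unfolding q_def r_def by (simp add: coeff_sum poly_sum poly_monom mult.commute)
  have "poly q x = poly p z"
    unfolding q_def poly_altdef[of p] by (simp add: poly_sum a(2) mult.commute)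
  hence "poly q x = 0" using p by simp
  moreover have "q \<in> polys_over (adjoin C z)"
  proof -
    have "coeff q j \<in> adjoin C z" for j unfolding cq adjoin_def using rC by (rule imageI)
    thus ?thesis unfolding polys_over_def by blast
  qed
  moreover have "q \<noteq> 0"
  proof
    assume "q = 0"
    hence r0: "r j = 0" for j using cq[of j] rC[of j] z unfolding algebraic_over_def by auto
    have "coeff (a i) j = 0" if "i \<le> degree p" for i j
    proof -
      have "coeff (r j) i = coeff (a i) j"
        unfolding r_def coeff_sum using that by (simp add: if_distrib cong: if_cong)
      thus ?thesis using r0 by simp
    qed
    hence "a (degree p) = 0" by (intro poly_eqI) auto
    hence "lead_coeff p = 0" using a(2)[of "degree p"] by simp
    thus False using p(2) by simp
  qed
  ultimately show ?thesis unfolding algebraic_over_def by blast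
qed

text \<open>
  This reduces residue computations to one variable: take \<open>C'\<close> maximal among the subfields containing \<open>C\<close> over
  which \<open>z\<close> is transcendental. Adjoining any further element makes \<open>z\<close> algebraic, and the exchange property
  turns this around.
\<close>
lemma maximal_transcendental_base:
  fixes C :: "'b::field set"
  assumes C: "is_subfield C" and z: "\<not> algebraic_over C z"
  obtains C' where "is_subfield C'" "C \<subseteq> C'" "\<not> algebraic_over C' z"
    "\<And>x. algebraic_over (fractions (adjoin C' z)) x"
proof -
  let ?A = "{G. is_subfield G \<and> C \<subseteq> G \<and> \<not> algebraic_over G z}"
  have "\<exists>M\<in>?A. \<forall>Y\<in>?A. M \<subseteq> Y \<longrightarrow> Y = M"
  proof (rule subset_Zorn_nonempty)
    show "?A \<noteq> {}" using assms by auto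
    fix F assume F: "F \<noteq> {}" "subset.chain ?A F"
    have ch: "subset.chain UNIV F" using F(2) unfolding subset.chain_def by auto
    have "is_subfield (\<Union>F)" using F ch by (intro is_subfield_Union_chain) (auto simp: subset.chain_def)
    moreover obtain B where "B \<in> F" using F(1) by blast
    hence "B \<subseteq> \<Union>F" "C \<subseteq> B" using F(2) unfolding subset.chain_def by auto
    moreover have "\<not> algebraic_over (\<Union>F) z"
    proof
      assume "algebraic_over (\<Union>F) z"
      then obtain p where p: "p \<in> polys_over (\<Union>F)" "p \<noteq> 0" "poly p z = 0" unfolding algebraic_over_def by blast
      have "coeff p ` {..degree p} \<subseteq> \<Union>F" using p(1) unfolding polys_over_def by auto
      then obtain B where B: "B \<in> F" "coeff p ` {..degree p} \<subseteq> B"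
        using finite_subset_Union_chain[OF _ _ F(1) ch, of "coeff p ` {..degree p}"] by auto
      have BA: "is_subfield B" "\<not> algebraic_over B z" using B(1) F(2) unfolding subset.chain_def by auto
      have "coeff p i \<in> B" for i
        using B(2) is_subringD(1)[OF is_subfield_subring[OF BA(1)]] by (cases "i \<le> degree p") (auto simp: coeff_eq_0)
      thus False using BA(2) p unfolding algebraic_over_def polys_over_def by blast
    qed
    ultimately show "\<Union>F \<in> ?A" by blast
  qed
  then obtain C' where C'A: "C' \<in> ?A" and maxA: "\<forall>Y\<in>?A. C' \<subseteq> Y \<longrightarrow> Y = C'" by (elim bexE)
  hence C': "is_subfield C'" "C \<subseteq> C'" "\<not> algebraic_over C' z" by simp_all
  have max: "Y = C'" if "is_subfield Y" "C \<subseteq> Y" "\<not> algebraic_over Y z" "C' \<subseteq> Y" for Y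
    using maxA that by simp
  note SR = is_subfield_subring[OF C'(1)]
  have sub: "adjoin C' y \<subseteq> fractions (adjoin C' y)" "C' \<subseteq> adjoin C' y" "y \<in> adjoin C' y" for y
    using subset_fractions[OF is_subring_adjoin[OF SR]] subset_adjoin[OF SR] in_adjoin[OF SR] by auto
  have "algebraic_over (fractions (adjoin C' z)) x" for x
  proof (cases "x \<in> C'")
    case True
    hence "x \<in> fractions (adjoin C' z)" using sub[of z] by blast
    thus ?thesis using is_subfield_fractions_field[OF is_subring_adjoin[OF SR]]
      by (intro algebraic_over_self is_subfield_subring)
  next
    case False
    have "algebraic_over (fractions (adjoin C' x)) z"
    proof (rule ccontr)
      assume "\<not> ?thesis"
      hence "fractions (adjoin C' x) = C'"
        using sub[of x] C'(2) by (intro max is_subfield_fractions_field is_subring_adjoin SR) auto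
      thus False using sub[of x] False by blast
    qed
    hence "algebraic_over (adjoin C' x) z" by (rule algebraic_over_fractions[OF is_subring_adjoin[OF SR]])
    hence "algebraic_over (adjoin C' z) x" by (rule algebraic_exchange[OF SR C'(3)])
    thus ?thesis using algebraic_over_mono sub(1) by blast
  qed
  thus thesis using that C' by blast
qed

lemma poly_split_X_power:
  assumes A: "is_subring A" and "p \<in> polys_over A" "p \<noteq> 0"
  shows "\<exists>k. \<exists>q\<in>polys_over A. coeff q 0 \<noteq> 0 \<and> p = monom 1 k * q"
  using assms(2,3)
proof (induction p)
  case (pCons a p)
  have ap: "a \<in> A" "p \<in> polys_over A" using pCons(3) unfolding polys_over_def
    by (auto simp: coeff_pCons split: nat.splits)
  show ?case
  proof (cases "a = 0")
    case True
    hence "p \<noteq> 0" using pCons by auto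
    then obtain k q where "q \<in> polys_over A" "coeff q 0 \<noteq> 0" "p = monom 1 k * q" using pCons.IH ap by blast
    moreover from this have "pCons a p = monom 1 (Suc k) * q" using True by (simp add: monom_Suc)
    ultimately show ?thesis by blast
  next
    case False
    thus ?thesis using pCons(3) by (intro exI[of _ 0] bexI[of _ "pCons a p"]) auto
  qed
qed simp

text \<open>
  The comparison of residues at \<open>z = 0\<close> in the rational function field \<open>C(z)\<close>. Every \<open>w\<^sub>j\<close> is
  \<open>z powi k\<^sub>j\<close> times a unit of the local ring at \<open>0\<close>, so the left-hand side has residue
  \<open>\<kappa> = \<Sum> k\<^sub>j e\<^sub>j\<close> and at most a simple pole, whereas the derivative of \<open>v\<close> never has a pole of order one.
\<close>
lemma rational_residue:
  fixes C :: "'b::field_char_0 set" and w :: "nat \<Rightarrow> 'b"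
  assumes C: "is_subfield C" and z: "\<not> algebraic_over C z"
    and d: "is_deriv d" "\<And>c. c \<in> C \<Longrightarrow> d c = 0" "d z = 1"
    and w: "\<And>j. j < r \<Longrightarrow> w j \<in> fractions (adjoin C z) \<and> w j \<noteq> 0" and v: "v \<in> fractions (adjoin C z)"
    and e: "\<And>j. j < r \<Longrightarrow> e j \<in> C" and eq: "(\<Sum>j<r. e j * (d (w j) / w j)) = d v"
    and j0: "j0 < r" "w j0 = z ^ N"
  shows "\<exists>k :: nat \<Rightarrow> int. (\<Sum>j<r. of_int (k j) * e j) = 0 \<and> k j0 = int N"
proof -
  note CS = is_subfield_subring[OF C]
  note CR = is_subringD[OF CS]
  note PR = is_subringD[OF is_subring_polys_over[OF CS]]
  have inj: "p = q" if "p \<in> polys_over C" "q \<in> polys_over C" "poly p z = poly q z" for p q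
  proof -
    have "p - q \<in> polys_over C" "poly (p - q) z = 0" using that PR(6) by auto
    thus ?thesis using z unfolding algebraic_over_def by auto
  qed
  have inj0: "poly p z \<noteq> 0" if "p \<in> polys_over C" "p \<noteq> 0" for p using inj[OF that(1) PR(1)] that by auto
  have inj1: "poly p z \<noteq> 0" if "p \<in> polys_over C" "coeff p 0 \<noteq> 0" for p using inj0[OF that(1)] that(2) by (metis coeff_0)
  have z0: "z \<noteq> 0" using z algebraic_over_self[OF CS CR(1)] by auto
  have dp: "d (poly p z) = poly (pderiv p) z" if "p \<in> polys_over C" for p
    using that
  proof (induction p)
    case (pCons a p)
    have "a \<in> C" "p \<in> polys_over C" using pCons(3) unfolding polys_over_def
      by (auto simp: coeff_pCons split: nat.splits)
    thus ?case using pCons(2) d by (simp add: is_derivD[OF d(1)] pderiv_pCons algebra_simps)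
  qed (simp add: is_derivD[OF d(1)])
  \<comment> \<open>\<open>reg\<close> is membership in the local ring of \<open>C(z)\<close> at \<open>z = 0\<close>, and \<open>unit\<close> being a unit of it.\<close>
  define reg where "reg x \<longleftrightarrow> (\<exists>p\<in>polys_over C. \<exists>q\<in>polys_over C. coeff q 0 \<noteq> 0 \<and> x * poly q z = poly p z)" for x
  define unit where "unit x \<longleftrightarrow> (\<exists>p\<in>polys_over C. \<exists>q\<in>polys_over C. coeff p 0 \<noteq> 0 \<and> coeff q 0 \<noteq> 0 \<and> x = poly p z / poly q z)" for x
  have reg_add: "reg (x + y)" and reg_mult: "reg (x * y)" if xy: "reg x" "reg y" for x y
  proof -
    obtain p q where pq: "p \<in> polys_over C" "q \<in> polys_over C" "coeff q 0 \<noteq> 0" "x * poly q z = poly p z"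
      using xy(1) unfolding reg_def by blast
    obtain p' q' where pq': "p' \<in> polys_over C" "q' \<in> polys_over C" "coeff q' 0 \<noteq> 0" "y * poly q' z = poly p' z"
      using xy(2) unfolding reg_def by blast
    have 1: "q * q' \<in> polys_over C" "p * p' \<in> polys_over C" "p * q' + p' * q \<in> polys_over C"
      using pq pq' by (auto intro!: PR(3,4))
    have 2: "coeff (q * q') 0 \<noteq> 0" using pq pq' by (simp add: coeff_mult)
    have "(x * y) * poly (q * q') z = (x * poly q z) * (y * poly q' z)" by (simp add: algebra_simps)
    hence 3: "(x * y) * poly (q * q') z = poly (p * p') z" unfolding pq pq' by simp
    have "(x + y) * poly (q * q') z = (x * poly q z) * poly q' z + (y * poly q' z) * poly q z" by (simp add: algebra_simps)
    hence 4: "(x + y) * poly (q * q') z = poly (p * q' + p' * q) z" unfolding pq pq' by simp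
    show "reg (x + y)" unfolding reg_def using 1(1,3) 2 4 by blast
    show "reg (x * y)" unfolding reg_def using 1(1,2) 2 3 by blast
  qed
  have reg_C: "reg c" if "c \<in> C" for c
    unfolding reg_def using that CR by (intro bexI[of _ "[:c:]"] bexI[of _ "[:1:]"])
      (auto simp: polys_over_def coeff_pCons split: nat.splits)
  have reg_z: "reg z"
    unfolding reg_def using CR by (intro bexI[of _ "[:0,1:]"] bexI[of _ "[:1:]"])
      (auto simp: polys_over_def coeff_pCons split: nat.splits)
  have reg_zpow: "reg (z ^ k)" for k by (induction k) (auto intro: reg_mult reg_z reg_C CR)
  have reg_sum: "reg (\<Sum>j\<in>J. f j)" if "\<And>j. j \<in> J \<Longrightarrow> reg (f j)" for J :: "nat set" and f
    using that by (induction J rule: infinite_finite_induct) (auto intro: reg_add reg_C CR)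
  have unit_reg: "reg x" if "unit x" for x
  proof -
    obtain p q where pq: "p \<in> polys_over C" "q \<in> polys_over C" "coeff q 0 \<noteq> 0" "x = poly p z / poly q z"
      using \<open>unit x\<close> unfolding unit_def by blast
    have "poly q z \<noteq> 0" using pq inj1[of q] by blast
    thus ?thesis unfolding reg_def using pq by (intro bexI[of _ p] bexI[of _ q]) auto
  qed
  have unit_nonzero: "x \<noteq> 0" if "unit x" for x
  proof -
    obtain p q where pq: "p \<in> polys_over C" "q \<in> polys_over C" "coeff p 0 \<noteq> 0" "coeff q 0 \<noteq> 0" "x = poly p z / poly q z"
      using \<open>unit x\<close> unfolding unit_def by blast
    thus ?thesis using inj1[of p] inj1[of q] by auto
  qed
  have unit_log: "reg (d u / u)" if u: "unit u" for u
  proof -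
    obtain p q where pq: "p \<in> polys_over C" "q \<in> polys_over C" "coeff p 0 \<noteq> 0" "coeff q 0 \<noteq> 0" "u = poly p z / poly q z"
      using u unfolding unit_def by blast
    have nz: "poly p z \<noteq> 0" "poly q z \<noteq> 0" using pq inj1[of q] inj1[of p] by blast+
    have "d u / u = d (poly p z) / poly p z + d (inverse (poly q z)) / inverse (poly q z)"
      unfolding pq(5) divide_inverse[of "poly p z"] using nz by (intro is_deriv_log_mult[OF d(1)]) auto
    also have "\<dots> = poly (pderiv p) z / poly p z - poly (pderiv q) z / poly q z"
      using is_deriv_inverse[OF d(1) nz(2)] dp pq by simp
    finally have "d u / u * poly (p * q) z = poly (pderiv p * q - pderiv q * p) z"
      using nz by (simp add: field_simps)
    moreover have "pderiv p * q - pderiv q * p \<in> polys_over C" "p * q \<in> polys_over C"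
      using pq by (auto intro!: PR polys_over_pderiv[OF CS])
    moreover have "coeff (p * q) 0 \<noteq> 0" using pq by (simp add: coeff_mult)
    ultimately show ?thesis unfolding reg_def by blast
  qed
  have unit_not: False if x: "unit x" and s: "reg s" and xs: "x = z * s" for x s
  proof -
    obtain p q where pq: "p \<in> polys_over C" "q \<in> polys_over C" "coeff p 0 \<noteq> 0" "coeff q 0 \<noteq> 0" "x = poly p z / poly q z"
      using x unfolding unit_def by blast
    obtain P Q where PQ: "P \<in> polys_over C" "Q \<in> polys_over C" "coeff Q 0 \<noteq> 0" "s * poly Q z = poly P z"
      using s unfolding reg_def by blast
    have nz: "poly q z \<noteq> 0" using pq inj1[of q] by blast
    have "poly p z * poly Q z = (x * poly q z) * poly Q z" using pq nz by simp
    also have "\<dots> = z * (s * poly Q z) * poly q z" using xs by simp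
    also have "\<dots> = poly (pCons 0 1 * P * q) z" using PQ by simp
    finally have "poly (p * Q) z = poly (pCons 0 1 * P * q) z" by simp
    moreover have "pCons 0 1 \<in> polys_over C" using CR by (auto simp: polys_over_def coeff_pCons split: nat.splits)
    ultimately have "p * Q = pCons 0 1 * P * q" using pq PQ by (intro inj PR(4))
    hence "coeff (p * Q) 0 = 0" by (simp add: coeff_mult)
    thus False using pq PQ by (simp add: coeff_mult)
  qed
  have unit_C: "unit c" if "c \<in> C" "c \<noteq> 0" for c
    unfolding unit_def using that CR by (intro bexI[of _ "[:c:]"] bexI[of _ "[:1:]"])
      (auto simp: polys_over_def coeff_pCons split: nat.splits)
  have unit_C_mult: "unit (c * x)" if cx: "c \<in> C" "c \<noteq> 0" "unit x" for c x
  proof -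
    obtain p q where pq: "p \<in> polys_over C" "q \<in> polys_over C" "coeff p 0 \<noteq> 0" "coeff q 0 \<noteq> 0" "x = poly p z / poly q z"
      using \<open>unit x\<close> unfolding unit_def by blast
    have "smult c p \<in> polys_over C" using cx pq CR by (auto simp: polys_over_def)
    moreover have "coeff (smult c p) 0 \<noteq> 0" "c * x = poly (smult c p) z / poly q z" using pq cx by auto
    ultimately show ?thesis using pq unfolding unit_def by blast
  qed
  have split: "\<exists>k u. x = z powi k * u \<and> unit u" if x: "x \<in> fractions (adjoin C z)" "x \<noteq> 0" for x
  proof -
    obtain a c where ac: "a \<in> adjoin C z" "c \<in> adjoin C z" "c dvd 1" "x * c = a" using x unfolding fractions_def by blast
    obtain p q where pq: "p \<in> polys_over C" "q \<in> polys_over C" "a = poly p z" "c = poly q z" using ac unfolding adjoin_def by blast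
    have "p \<noteq> 0" "q \<noteq> 0" using pq ac x by auto
    then obtain k p' l q' where *: "p' \<in> polys_over C" "coeff p' 0 \<noteq> 0" "p = monom 1 k * p'"
      "q' \<in> polys_over C" "coeff q' 0 \<noteq> 0" "q = monom 1 l * q'"
      using poly_split_X_power[OF CS pq(1)] poly_split_X_power[OF CS pq(2)] by blast
    have "x = a / c" using ac by (auto simp: field_simps)
    also have "\<dots> = (z ^ k / z ^ l) * (poly p' z / poly q' z)" using pq * by (simp add: poly_monom)
    also have "z ^ k / z ^ l = z powi (int k - int l)" using z0 by (simp add: power_int_diff)
    finally show ?thesis using * unfolding unit_def by blast
  qed
  have "\<exists>k u. w j = z powi k * u \<and> unit u \<and> (j = j0 \<longrightarrow> k = int N)" if "j < r" for j
  proof (cases "j = j0")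
    case True
    thus ?thesis using j0 unit_C[OF CR(2)] by (intro exI[of _ "int N"] exI[of _ 1]) auto
  next
    case False thus ?thesis using split w[OF that] by blast
  qed
  then obtain k u where ku: "\<And>j. j < r \<Longrightarrow> w j = z powi (k j) * u j" "\<And>j. j < r \<Longrightarrow> unit (u j)" "k j0 = int N"
    using j0(1) by metis
  define \<kappa> where "\<kappa> = (\<Sum>j<r. of_int (k j) * e j)"
  define S where "S = (\<Sum>j<r. e j * (d (u j) / u j))"
  have S: "reg S" unfolding S_def using e ku(2) by (intro reg_sum reg_mult reg_C unit_log) auto
  have \<kappa>C: "\<kappa> \<in> C" unfolding \<kappa>_def using e by (intro CR(10) CR(4) CR(9)) auto
  have "d (w j) / w j = of_int (k j) / z + d (u j) / u j" if "j < r" for j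
    unfolding ku(1)[OF that] using is_deriv_log_mult[OF d(1), of "z powi k j" "u j"] is_deriv_log_powi[OF d(1) z0, of "k j"]
      unit_nonzero[OF ku(2)[OF that]] z0 d(3) by simp
  hence "d v = (\<Sum>j<r. e j * (of_int (k j) / z + d (u j) / u j))" unfolding eq[symmetric] by simp
  also have "\<dots> = \<kappa> / z + S" unfolding \<kappa>_def S_def
    by (simp add: ring_distribs sum.distrib sum_divide_distrib mult.commute)
  finally have dv: "z * d v = \<kappa> + z * S" using z0 by (simp add: field_simps)
  have rn: "reg (- 1)" by (rule reg_C[OF CR(5)[OF CR(2)]])
  have "\<kappa> = 0"
  proof (rule ccontr)
    assume \<kappa>0: "\<kappa> \<noteq> 0"
    \<comment> \<open>A regular derivative is excluded by the simple pole with residue \<open>\<kappa>\<close>. It remains to treat a pole of \<open>v\<close>.\<close>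
    have no: False if "reg (d v)"
    proof -
      have "reg (d v + (-1) * S)" by (rule reg_add[OF that reg_mult[OF rn S]])
      moreover have "\<kappa> = z * (d v + (-1) * S)" using dv by (simp add: algebra_simps)
      ultimately show False using unit_not unit_C \<kappa>C \<kappa>0 by blast
    qed
    show False
    proof (cases "v = 0")
      case True thus False using no reg_C[OF CR(1)] is_derivD(3)[OF d(1)] by simp
    next
      case False
      then obtain l x where x: "v = z powi l * x" "unit x" using split[OF v] by blast
      have x0: "x \<noteq> 0" using unit_nonzero x by blast
      have "d v / v = of_int l / z + d x / x"
        unfolding x(1) using is_deriv_log_mult[OF d(1), of "z powi l" x] is_deriv_log_powi[OF d(1) z0, of l] x0 z0 d(3) by simp
      hence dvl: "d v = z powi l * (of_int l / z * x + d x)" using False x0 unfolding x(1) by (simp add: field_simps)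
      have rdx: "reg (d x)"
      proof -
        have "reg (d x / x * x)" using x(2) by (intro reg_mult unit_log unit_reg)
        thus ?thesis using x0 by simp
      qed
      show False
      proof (cases "l \<ge> 0")
        case True
        then obtain n where n: "l = int n" by (metis nonneg_int_cases)
        show False
        proof (cases n)
          case 0
          hence "d v = d x" using dvl n by simp
          thus False using no rdx by simp
        next
          case (Suc m)
          hence "z powi l = z ^ m * z" using n by (simp only: power_int_of_nat power_Suc2)
          hence "d v = z ^ m * (z * (of_int l / z * x + d x))" using dvl by (simp only: mult.assoc)
          hence "d v = z ^ m * (of_int l * x + z * d x)" using z0 by (simp add: ring_distribs)
          moreover have "reg (z ^ m * (of_int l * x + z * d x))"
            by (rule reg_mult[OF reg_zpow reg_add[OF reg_mult[OF reg_C[OF CR(9)] unit_reg[OF x(2)]] reg_mult[OF reg_z rdx]]])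
          ultimately show False using no by simp
        qed
      next
        case l: False
        define K where "K = nat (- l)"
        have K: "K > 0" "l = - int K" using l unfolding K_def by auto
        then obtain K' where K': "K = Suc K'" by (cases K) auto
        have zl: "z ^ K * z powi l = 1" using z0 K by (simp add: power_int_minus)
        have "z ^ K * (\<kappa> + z * S) = z ^ K * (z * d v)" using dv by simp
        also have "\<dots> = (z ^ K * z powi l) * (of_int l * x + z * d x)" unfolding dvl using z0 by (simp add: ring_distribs mult.left_commute mult.assoc)
        also have "\<dots> = of_int l * x + z * d x" using zl by simp
        finally have "of_int l * x = z * (z ^ K' * (\<kappa> + z * S) + (-1) * d x)" unfolding K' by (simp add: algebra_simps)
        moreover have "reg (z ^ K' * (\<kappa> + z * S) + (-1) * d x)"
          by (rule reg_add[OF reg_mult[OF reg_zpow reg_add[OF reg_C[OF \<kappa>C] reg_mult[OF reg_z S]]] reg_mult[OF rn rdx]])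
        moreover have "unit (of_int l * x)" using l x(2) CR(9) by (intro unit_C_mult) auto
        ultimately show False using unit_not by blast
      qed
    qed
  qed
  thus ?thesis using ku(3) unfolding \<kappa>_def by blast
qed


text \<open>
  Injective endomorphisms suffice: on a finite orbit they act as permutations.
\<close>
definition galois :: "'b::field set \<Rightarrow> ('b \<Rightarrow> 'b) set" where
  "galois L = {\<sigma>. ring_homo \<sigma> \<and> (\<forall>x\<in>L. \<sigma> x = x)}"

text \<open>
  The orbit of a whole tuple, which is represented as an infinite sequence padded with \<open>0\<close>.
\<close>
definition orbit :: "'b::field set \<Rightarrow> (nat \<Rightarrow> 'b) \<Rightarrow> (nat \<Rightarrow> 'b) set" where
  "orbit L a = (\<lambda>\<sigma>. \<sigma> \<circ> a) ` galois L"

lemma finite_orbit: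
  fixes L :: "'b::field set"
  assumes alg: "\<And>x. algebraic_over L x" and a: "\<And>i. i > r \<Longrightarrow> a i = 0"
  shows "finite (orbit L a)"
proof -
  have "\<exists>p. p \<in> polys_over L \<and> p \<noteq> 0 \<and> poly p (a i) = 0" for i
    using alg[of "a i"] unfolding algebraic_over_def by blast
  then obtain p where p: "\<And>i. p i \<in> polys_over L \<and> p i \<noteq> 0 \<and> poly (p i) (a i) = 0"
    by metis
  define B where "B = (\<Union>i\<le>r. {x. poly (p i) x = 0})"
  have B: "finite B" unfolding B_def using p by (intro finite_UN_I) (auto intro: poly_roots_finite)
  have "orbit L a \<subseteq> {b. \<forall>i. (i \<in> {..r} \<longrightarrow> b i \<in> B) \<and> (i \<notin> {..r} \<longrightarrow> b i = 0)}"
  proof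
    fix b assume "b \<in> orbit L a"
    then obtain \<sigma> where \<sigma>: "ring_homo \<sigma>" "\<And>x. x \<in> L \<Longrightarrow> \<sigma> x = x" "b = \<sigma> \<circ> a" unfolding orbit_def galois_def by blast
    have "poly (p i) (\<sigma> (a i)) = 0" for i
    proof -
      have "map_poly \<sigma> (p i) = p i"
        using p[of i] \<sigma>(2) by (intro poly_eqI) (auto simp: coeff_map_poly ring_homoD(1)[OF \<sigma>(1)] polys_over_def)
      thus ?thesis using ring_homo_poly[OF \<sigma>(1), of "p i" "a i"] p[of i] ring_homoD(1)[OF \<sigma>(1)] by simp
    qed
    thus "b \<in> {b. \<forall>i. (i \<in> {..r} \<longrightarrow> b i \<in> B) \<and> (i \<notin> {..r} \<longrightarrow> b i = 0)}"
      unfolding B_def \<sigma>(3) using a ring_homoD(1)[OF \<sigma>(1)] by auto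
  qed
  thus ?thesis using finite_set_of_finite_funs[OF _ B, of "{..r}" 0] finite_subset by blast
qed

lemma orbit_permute:
  assumes fin: "finite (orbit L a)" and \<tau>: "\<tau> \<in> galois L"
  shows "bij_betw (\<lambda>b. \<tau> \<circ> b) (orbit L a) (orbit L a)"
proof -
  have \<tau>': "ring_homo \<tau>" "\<And>x. x \<in> L \<Longrightarrow> \<tau> x = x" using \<tau> unfolding galois_def by auto
  have "inj \<tau>"
  proof (rule injI)
    fix x y assume "\<tau> x = \<tau> y"
    hence "\<tau> (x - y) = 0" using ring_homoD(6)[OF \<tau>'(1)] by simp
    thus "x = y" using ring_homo_inverse(3)[OF \<tau>'(1)] by simp
  qed
  hence inj: "inj_on (\<lambda>b. \<tau> \<circ> b) (orbit L a)" by (auto simp: inj_on_def fun_eq_iff dest: injD)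
  have "(\<lambda>b. \<tau> \<circ> b) ` orbit L a \<subseteq> orbit L a"
  proof
    fix b assume "b \<in> (\<lambda>b. \<tau> \<circ> b) ` orbit L a"
    then obtain \<sigma> where \<sigma>: "\<sigma> \<in> galois L" "b = (\<tau> \<circ> \<sigma>) \<circ> a" unfolding orbit_def by (auto simp: o_assoc)
    have "\<tau> \<circ> \<sigma> \<in> galois L" using \<sigma>(1) \<tau>' unfolding galois_def by (auto simp: ring_homo_def)
    thus "b \<in> orbit L a" using \<sigma>(2) unfolding orbit_def by blast
  qed
  thus ?thesis using inj fin endo_inj_surj[OF fin _ inj] by (auto simp: bij_betw_def)
qed

text \<open>
  Suppose some \<open>z\<^sub>j\<close>, called \<open>z\<close> here, is transcendental over \<open>C\<close>. Enlarge \<open>C\<close> so that \<open>\<Omega>\<close> becomes algebraic over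
  \<open>L = C'(z)\<close> and take the derivation \<open>d/dz\<close>. It commutes with every endomorphism of \<open>\<Omega>\<close> over \<open>L\<close>, so
  summing the relation over the finite orbit of the tuple \<open>(z\<^sub>1, \<dots>, z\<^sub>r, v)\<close> replaces \<open>z\<^sub>j\<close> by a norm and \<open>v\<close> by a
  trace, all of which are fixed by the endomorphisms and hence lie in \<open>L\<close>. As \<open>z\<close> itself is replaced by a
  positive power of \<open>z\<close>, \<open>rational_residue\<close> contradicts the independence of the \<open>e\<^sub>j\<close>.
\<close>
theorem residue_independence:
  fixes C :: "'b::{alg_closed_field, field_char_0} set"
  assumes C: "is_subfield C" and e: "\<And>j. j < r \<Longrightarrow> e j \<in> C"
    and ind: "\<And>k :: nat \<Rightarrow> int. (\<Sum>j<r. of_int (k j) * e j) = 0 \<Longrightarrow> \<forall>j<r. k j = 0"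
    and z: "\<And>j. j < r \<Longrightarrow> z j \<noteq> 0"
    and eq: "\<And>d. is_deriv d \<Longrightarrow> (\<And>c. c \<in> C \<Longrightarrow> d c = 0) \<Longrightarrow> (\<Sum>j<r. e j * (d (z j) / z j)) = d v"
    and j0: "j0 < r"
  shows "algebraic_over C (z j0)"
proof (rule ccontr)
  assume "\<not> algebraic_over C (z j0)"
  then obtain C' where C': "is_subfield C'" "C \<subseteq> C'" "\<not> algebraic_over C' (z j0)"
    and alg: "\<And>x. algebraic_over (fractions (adjoin C' (z j0))) x"
    using maximal_transcendental_base[OF C] by metis
  note SR = is_subfield_subring[OF C'(1)]
  define L where "L = fractions (adjoin C' (z j0))"
  have L: "is_subfield L" unfolding L_def by (intro is_subfield_fractions_field is_subring_adjoin SR)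
  have C'L: "C' \<subseteq> L" "z j0 \<in> L"
    using subset_fractions[OF is_subring_adjoin[OF SR]] subset_adjoin[OF SR] in_adjoin[OF SR] unfolding L_def by blast+
  obtain d where d: "is_deriv d" "\<And>c. c \<in> C' \<Longrightarrow> d c = 0" "d (z j0) = 1"
    using transcendental_deriv[OF SR C'(3)] by blast
  \<comment> \<open>The relation involves \<open>v\<close> as well, so it is stored in position \<open>r\<close> of the tuple.\<close>
  define a where "a i = (if i < r then z i else if i = r then v else 0)" for i
  define Orb where "Orb = orbit L a"
  have fin: "finite Orb" unfolding Orb_def by (rule finite_orbit[of L r]) (use alg in \<open>auto simp: L_def a_def\<close>)
  have idG: "id \<in> galois L" by (simp add: galois_def ring_homo_def)
  have "id \<circ> a \<in> Orb" unfolding Orb_def orbit_def using idG by (rule imageI)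
  hence ne: "card Orb > 0" using fin by (auto simp: card_gt_0_iff)
  have commute: "d (\<sigma> x) = \<sigma> (d x)" if \<sigma>: "\<sigma> \<in> galois L" for \<sigma> x
  proof -
    have \<sigma>h: "ring_homo \<sigma>" and \<sigma>L: "\<And>x. x \<in> L \<Longrightarrow> \<sigma> x = x" using \<sigma> unfolding galois_def by auto
    note hom = ring_homoD[OF \<sigma>h]
    define S where "S = {x. d (\<sigma> x) = \<sigma> (d x)}"
    have S: "is_subfield S"
    proof (rule is_subfieldI_inverse)
      show "is_subring S" unfolding is_subring_def S_def by (auto simp: hom is_derivD[OF d(1)])
      fix x assume x: "x \<in> S"
      show "inverse x \<in> S"
      proof (cases "x = 0")
        case False
        hence nz: "\<sigma> x \<noteq> 0" using ring_homo_inverse(3)[OF \<sigma>h] by blast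
        have 1: "d (inverse y) = - (d y / (y * y))" if "y \<noteq> 0" for y
          using is_deriv_inverse[OF d(1) that] that by (simp add: field_simps)
        have "d (\<sigma> (inverse x)) = - (d (\<sigma> x) / (\<sigma> x * \<sigma> x))"
          using 1[OF nz] ring_homo_inverse(1)[OF \<sigma>h] by simp
        also have "\<dots> = \<sigma> (- (d x / (x * x)))" using x unfolding S_def by (simp add: hom ring_homo_inverse[OF \<sigma>h])
        also have "\<dots> = \<sigma> (d (inverse x))" using 1[OF False] by simp
        finally show ?thesis unfolding S_def by simp
      qed (use x in simp)
    qed
    have "C' \<subseteq> S" unfolding S_def using d(2) \<sigma>L C'L hom(1) by auto
    moreover have "z j0 \<in> S" unfolding S_def using d(3) \<sigma>L C'L hom(2) by auto
    ultimately have LS: "L \<subseteq> S" unfolding L_def by (rule fractions_adjoin_least[OF S])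
    have "d (\<sigma> x) - \<sigma> (d x) = 0"
      by (rule twisted_deriv_eq_0_algebraic[OF \<sigma>h, of "\<lambda>x. d (\<sigma> x) - \<sigma> (d x)" L])
        (use L LS alg in \<open>auto simp: hom is_derivD[OF d(1)] algebra_simps S_def L_def[symmetric]\<close>)
    thus ?thesis by simp
  qed
  have fixed: "x \<in> L" if "\<And>\<tau>. \<tau> \<in> galois L \<Longrightarrow> \<tau> x = x" for x
    using galois_move[OF L] alg that unfolding galois_def L_def[symmetric] by blast
  define w where "w j = (\<Prod>b\<in>Orb. b j)" for j
  define V where "V = (\<Sum>b\<in>Orb. b r)"
  have wL: "w j \<in> L" for j
  proof (rule fixed)
    fix \<tau> assume \<tau>: "\<tau> \<in> galois L"
    hence "ring_homo \<tau>" unfolding galois_def by blast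
    hence "\<tau> (w j) = (\<Prod>b\<in>Orb. (\<tau> \<circ> b) j)" unfolding w_def by (simp add: ring_homoD(9))
    also have "\<dots> = w j" unfolding w_def
      using prod.reindex_bij_betw[OF orbit_permute[OF fin[unfolded Orb_def] \<tau>], of "\<lambda>b. b j"] unfolding Orb_def by simp
    finally show "\<tau> (w j) = w j" .
  qed
  have VL: "V \<in> L"
  proof (rule fixed)
    fix \<tau> assume \<tau>: "\<tau> \<in> galois L"
    hence "ring_homo \<tau>" unfolding galois_def by blast
    hence "\<tau> V = (\<Sum>b\<in>Orb. (\<tau> \<circ> b) r)" unfolding V_def by (simp add: ring_homoD(8))
    also have "\<dots> = V" unfolding V_def
      using sum.reindex_bij_betw[OF orbit_permute[OF fin[unfolded Orb_def] \<tau>], of "\<lambda>b. b r"] unfolding Orb_def by simp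
    finally show "\<tau> V = V" .
  qed
  have bnz: "b j \<noteq> 0" if "b \<in> Orb" "j < r" for b j
    using that z[OF that(2)] unfolding Orb_def orbit_def galois_def a_def by (auto simp: ring_homo_inverse(3))
  have beq: "(\<Sum>j<r. e j * (d (b j) / b j)) = d (b r)" if b: "b \<in> Orb" for b
  proof -
    obtain \<sigma> where \<sigma>: "\<sigma> \<in> galois L" "b = \<sigma> \<circ> a" using b unfolding Orb_def orbit_def by blast
    have \<sigma>h: "ring_homo \<sigma>" and \<sigma>L: "\<And>x. x \<in> L \<Longrightarrow> \<sigma> x = x" using \<sigma> unfolding galois_def by auto
    have "(\<Sum>j<r. e j * (d (b j) / b j)) = \<sigma> (\<Sum>j<r. e j * (d (z j) / z j))"
      unfolding ring_homoD(8)[OF \<sigma>h]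
    proof (rule sum.cong)
      fix j assume "j \<in> {..<r}"
      hence "e j \<in> L" "b j = \<sigma> (z j)" using e C'(2) C'L \<sigma>(2) by (auto simp: a_def)
      thus "e j * (d (b j) / b j) = \<sigma> (e j * (d (z j) / z j))"
        using commute[OF \<sigma>(1)] \<sigma>L by (simp add: ring_homoD[OF \<sigma>h] ring_homo_inverse[OF \<sigma>h])
    qed simp
    also have "(\<Sum>j<r. e j * (d (z j) / z j)) = d v" using eq[OF d(1)] d(2) C'(2) by blast
    also have "\<sigma> (d v) = d (b r)" using commute[OF \<sigma>(1)] \<sigma>(2) by (simp add: a_def)
    finally show ?thesis .
  qed
  have "(\<Sum>j<r. e j * (d (w j) / w j)) = (\<Sum>j<r. \<Sum>b\<in>Orb. e j * (d (b j) / b j))"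
    unfolding w_def by (intro sum.cong refl) (subst is_deriv_log_prod[OF d(1)], use bnz in \<open>auto simp: sum_distrib_left\<close>)
  also have "\<dots> = (\<Sum>b\<in>Orb. \<Sum>j<r. e j * (d (b j) / b j))" by (rule sum.swap)
  also have "\<dots> = (\<Sum>b\<in>Orb. d (b r))" using beq by (intro sum.cong) auto
  also have "\<dots> = d V" unfolding V_def by (rule is_derivD(7)[OF d(1), symmetric])
  finally have main: "(\<Sum>j<r. e j * (d (w j) / w j)) = d V" .
  have wj0: "w j0 = z j0 ^ card Orb"
  proof -
    have "b j0 = z j0" if "b \<in> Orb" for b
      using that C'L(2) j0 unfolding Orb_def orbit_def galois_def a_def by auto
    hence "(\<Prod>b\<in>Orb. b j0) = (\<Prod>b\<in>Orb. z j0)" by (rule prod.cong[OF refl])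
    thus ?thesis unfolding w_def by simp
  qed
  have "w j \<noteq> 0" if "j < r" for j unfolding w_def using fin bnz that by simp
  hence "\<exists>k :: nat \<Rightarrow> int. (\<Sum>j<r. of_int (k j) * e j) = 0 \<and> k j0 = int (card Orb)"
    using rational_residue[OF C'(1) C'(3) d, of r w V e j0 "card Orb"] wL VL e C'(2) main j0 wj0
    unfolding L_def by blast
  thus False using ind j0 ne by force
qed

section \<open>Linear algebra for functionals on derivations\<close>
definition linset :: "('b::field \<Rightarrow> 'b) set \<Rightarrow> bool" where
  "linset \<D> \<longleftrightarrow> (\<lambda>x. 0) \<in> \<D> \<and> (\<forall>d\<in>\<D>. \<forall>e\<in>\<D>. (\<lambda>x. d x + e x) \<in> \<D>) \<and> (\<forall>d\<in>\<D>. \<forall>c. (\<lambda>x. c * d x) \<in> \<D>)"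

definition linfun :: "(('b::field \<Rightarrow> 'b) \<Rightarrow> 'b) \<Rightarrow> bool" where
  "linfun \<phi> \<longleftrightarrow> (\<forall>d e. \<phi> (\<lambda>x. d x + e x) = \<phi> d + \<phi> e) \<and> (\<forall>d c. \<phi> (\<lambda>x. c * d x) = c * \<phi> d)"

lemma linsetD:
  assumes "linset \<D>"
  shows "(\<lambda>x. 0) \<in> \<D>" "\<And>d e. d \<in> \<D> \<Longrightarrow> e \<in> \<D> \<Longrightarrow> (\<lambda>x. d x + e x) \<in> \<D>"
    "\<And>d c. d \<in> \<D> \<Longrightarrow> (\<lambda>x. c * d x) \<in> \<D>"
  using assms unfolding linset_def by blast+

lemma linfunD:
  assumes "linfun \<phi>"
  shows "\<And>d e. \<phi> (\<lambda>x. d x + e x) = \<phi> d + \<phi> e" "\<And>d c. \<phi> (\<lambda>x. c * d x) = c * \<phi> d"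
  using assms unfolding linfun_def by blast+

text \<open>
  A functional that vanishes on the common kernel of finitely many functionals is a combination of them; the space
  itself may be infinite-dimensional. By induction on the number of functionals, with the kernel of the last one as the new
  space.
\<close>
lemma functional_in_span:
  fixes \<phi> :: "nat \<Rightarrow> ('b::field \<Rightarrow> 'b) \<Rightarrow> 'b"
  assumes "linset \<D>" "\<And>i. i < n \<Longrightarrow> linfun (\<phi> i)" "linfun \<psi>"
    and "\<And>d. d \<in> \<D> \<Longrightarrow> (\<And>i. i < n \<Longrightarrow> \<phi> i d = 0) \<Longrightarrow> \<psi> d = 0"
  shows "\<exists>a. \<forall>d\<in>\<D>. \<psi> d = (\<Sum>i<n. a i * \<phi> i d)"
  using assms
proof (induction n arbitrary: \<D>)
  case 0
  thus ?case by auto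
next
  case (Suc n)
  note lin = Suc.prems(2)[of n, simplified, unfolded linfun_def] Suc.prems(3)[unfolded linfun_def]
  define \<D>' where "\<D>' = {d \<in> \<D>. \<phi> n d = 0}"
  have z: "\<phi> n (\<lambda>x. 0) = 0"
  proof -
    have "\<phi> n (\<lambda>x. c * d x) = c * \<phi> n d" for c d using lin(1) by blast
    from this[of 0 "\<lambda>x. 0"] show ?thesis by simp
  qed
  have lD: "linset \<D>'" using Suc.prems(1) lin z unfolding linset_def \<D>'_def by auto
  obtain a where a: "\<And>d. d \<in> \<D>' \<Longrightarrow> \<psi> d = (\<Sum>i<n. a i * \<phi> i d)"
  proof -
    have "\<exists>a. \<forall>d\<in>\<D>'. \<psi> d = (\<Sum>i<n. a i * \<phi> i d)"
    proof (rule Suc.IH[OF lD _ Suc.prems(3)])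
      show "linfun (\<phi> i)" if "i < n" for i using Suc.prems(2) that by simp
      show "\<psi> d = 0" if d: "d \<in> \<D>'" "\<And>i. i < n \<Longrightarrow> \<phi> i d = 0" for d
      proof (rule Suc.prems(4))
        show "d \<in> \<D>" using d(1) unfolding \<D>'_def by blast
        show "\<phi> i d = 0" if "i < Suc n" for i
          using that d unfolding \<D>'_def by (cases "i = n") auto
      qed
    qed
    thus ?thesis using that by blast
  qed
  show ?case
  proof (cases "\<exists>d0\<in>\<D>. \<phi> n d0 \<noteq> 0")
    case False
    hence "\<D>' = \<D>" unfolding \<D>'_def by blast
    hence "\<forall>d\<in>\<D>. \<psi> d = (\<Sum>i<Suc n. a i * \<phi> i d)" using a False by simp
    thus ?thesis by blast
  next
    case True
    then obtain d0 where d0: "d0 \<in> \<D>" "\<phi> n d0 \<noteq> 0" by blast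
    define b where "b = (\<psi> d0 - (\<Sum>i<n. a i * \<phi> i d0)) / \<phi> n d0"
    have "\<psi> d = (\<Sum>i<Suc n. (if i = n then b else a i) * \<phi> i d)" if d: "d \<in> \<D>" for d
    proof -
      define t where "t = - (\<phi> n d / \<phi> n d0)"
      define d' where "d' = (\<lambda>x. d x + t * d0 x)"
      have ex: "\<xi> d' = \<xi> d + t * \<xi> d0" if "linfun \<xi>" for \<xi>
        using that unfolding linfun_def d'_def by simp
      have "d' \<in> \<D>" unfolding d'_def
        by (rule linsetD(2)[OF Suc.prems(1) d linsetD(3)[OF Suc.prems(1) d0(1)]])
      moreover have "\<phi> n d' = 0" using ex[OF Suc.prems(2)[of n]] d0(2) by (simp add: t_def)
      ultimately have "\<psi> d' = (\<Sum>i<n. a i * \<phi> i d')" using a unfolding \<D>'_def by blast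
      also have "\<dots> = (\<Sum>i<n. a i * \<phi> i d) + t * (\<Sum>i<n. a i * \<phi> i d0)"
        using ex[OF Suc.prems(2)] by (simp add: sum.distrib sum_distrib_left algebra_simps)
      finally have "\<psi> d = (\<Sum>i<n. a i * \<phi> i d) - t * (\<psi> d0 - (\<Sum>i<n. a i * \<phi> i d0))"
        using ex[OF Suc.prems(3)] by (simp add: algebra_simps)
      also have "t * (\<psi> d0 - (\<Sum>i<n. a i * \<phi> i d0)) = - (b * \<phi> n d)" using d0(2) by (simp add: t_def b_def)
      finally show ?thesis by simp
    qed
    thus ?thesis by (intro exI[of _ "\<lambda>i. if i = n then b else a i"]) blast
  qed
qed

lemma dual_vectors:
  fixes \<phi> :: "nat \<Rightarrow> ('b::field \<Rightarrow> 'b) \<Rightarrow> 'b"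
  assumes D: "linset \<D>" and \<phi>: "\<And>i. i < n \<Longrightarrow> linfun (\<phi> i)"
    and ind: "\<And>a. (\<And>d. d \<in> \<D> \<Longrightarrow> (\<Sum>i<n. a i * \<phi> i d) = 0) \<Longrightarrow> \<forall>i<n. a i = 0"
  shows "\<exists>d. \<forall>l<n. d l \<in> \<D> \<and> (\<forall>i<n. \<phi> i (d l) = (if i = l then 1 else 0))"
proof -
  have "\<exists>d. d \<in> \<D> \<and> (\<forall>i<n. \<phi> i d = (if i = l then 1 else 0))" if l: "l < n" for l
  proof (rule ccontr)
    assume no: "\<not> ?thesis"
    define \<phi>' where "\<phi>' i = (if i = l then (\<lambda>d. 0) else \<phi> i)" for i
    have "\<phi> l d = 0" if d: "d \<in> \<D>" "\<And>i. i < n \<Longrightarrow> \<phi>' i d = 0" for d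
    proof (rule ccontr)
      assume nz: "\<phi> l d \<noteq> 0"
      define d' where "d' = (\<lambda>x. inverse (\<phi> l d) * d x)"
      have d': "\<phi> i d' = inverse (\<phi> l d) * \<phi> i d" if "i < n" for i
        unfolding d'_def by (rule linfunD(2)[OF \<phi>[OF that]])
      have "d' \<in> \<D>" unfolding d'_def by (rule linsetD(3)[OF D d(1)])
      moreover have "\<phi> i d' = (if i = l then 1 else 0)" if "i < n" for i
        using d'[OF that] d(2)[OF that] nz unfolding \<phi>'_def by auto
      ultimately show False using no by blast
    qed
    moreover have "linfun (\<phi>' i)" if "i < n" for i using \<phi>[OF that] unfolding \<phi>'_def by (auto simp: linfun_def)
    ultimately obtain a where a: "\<And>d. d \<in> \<D> \<Longrightarrow> \<phi> l d = (\<Sum>i<n. a i * \<phi>' i d)"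
      using functional_in_span[OF D, of n \<phi>' "\<phi> l"] \<phi>[OF l] by blast
    have "(\<Sum>i<n. (if i = l then -1 else a i) * \<phi> i d) = 0" if "d \<in> \<D>" for d
    proof -
      have "(\<Sum>i<n. (if i = l then -1 else a i) * \<phi> i d) = - \<phi> l d + (\<Sum>i\<in>{..<n} - {l}. a i * \<phi> i d)"
        using l by (subst sum.remove[of _ l]) auto
      moreover have "(\<Sum>i<n. a i * \<phi>' i d) = (\<Sum>i\<in>{..<n} - {l}. a i * \<phi> i d)"
        using l unfolding \<phi>'_def by (subst sum.remove[of _ l]) auto
      ultimately show ?thesis using a[OF that] by simp
    qed
    hence "\<forall>i<n. (if i = l then -1 else a i) = 0" by (rule ind)
    thus False using l by auto
  qed
  thus ?thesis by metis
qed

lemma right_inverse_imp_left_inverse: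
  fixes G H :: "nat \<Rightarrow> nat \<Rightarrow> 'b::field"
  assumes "\<And>i j. i < u \<Longrightarrow> j < u \<Longrightarrow> (\<Sum>l<u. G i l * H l j) = (if i = j then 1 else 0)" and "i < u" "j < u"
  shows "(\<Sum>l<u. H i l * G l j) = (if i = j then 1 else 0)"
proof -
  define A where "A = mat u u (\<lambda>(i, j). G i j)"
  define B where "B = mat u u (\<lambda>(i, j). H i j)"
  have AB: "A \<in> carrier_mat u u" "B \<in> carrier_mat u u" by (auto simp: A_def B_def)
  have "A * B = 1\<^sub>m u"
  proof (rule eq_matI)
    fix i j assume "i < dim_row (1\<^sub>m u :: 'b mat)" "j < dim_col (1\<^sub>m u :: 'b mat)"
    hence ij: "i < u" "j < u" by auto
    hence "(A * B) $$ (i, j) = (\<Sum>l<u. G i l * H l j)"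
      by (simp add: A_def B_def scalar_prod_def atLeast0LessThan)
    thus "(A * B) $$ (i, j) = 1\<^sub>m u $$ (i, j)" using ij assms(1) by simp
  qed (simp_all add: A_def B_def)
  hence "B * A = 1\<^sub>m u" using mat_mult_left_right_inverse AB by blast
  hence "(B * A) $$ (i, j) = (if i = j then 1 else 0)" using assms(2,3) by simp
  moreover have "(B * A) $$ (i, j) = (\<Sum>l<u. H i l * G l j)"
    using assms(2,3) by (simp add: A_def B_def scalar_prod_def atLeast0LessThan)
  ultimately show ?thesis by simp
qed

text \<open>
  A subspace of \<open>\<Omega>\<^sup>n\<close> stable under the derivations in \<open>\<Delta>\<close> is spanned by its vectors with constant
  coordinates. Indeed, normalise a nonzero vector of minimal support so that one coordinate is \<open>1\<close>; its derivatives
  have smaller support, so they vanish and the vector is constant. Subtracting a multiple of it shortens any other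
  vector that contains its support.
\<close>
lemma deriv_stable_subspace:
  fixes R T :: "(nat \<Rightarrow> 'b::field) set"
  assumes R_add: "\<And>f g. f \<in> R \<Longrightarrow> g \<in> R \<Longrightarrow> (\<lambda>i. f i + g i) \<in> R"
    and R_scale: "\<And>f c. f \<in> R \<Longrightarrow> (\<lambda>i. c * f i) \<in> R"
    and R_supp: "\<And>f i. f \<in> R \<Longrightarrow> i \<ge> n \<Longrightarrow> f i = 0"
    and \<Delta>: "\<And>d. d \<in> \<Delta> \<Longrightarrow> is_deriv d"
    and stable: "\<And>d f. d \<in> \<Delta> \<Longrightarrow> f \<in> R \<Longrightarrow> (\<lambda>i. d (f i)) \<in> R"
    and T_add: "\<And>f g. f \<in> T \<Longrightarrow> g \<in> T \<Longrightarrow> (\<lambda>i. f i + g i) \<in> T"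
    and T_scale: "\<And>f c. f \<in> T \<Longrightarrow> (\<lambda>i. c * f i) \<in> T"
    and const: "\<And>f. f \<in> R \<Longrightarrow> (\<And>i. f i \<in> const_field \<Delta>) \<Longrightarrow> f \<in> T"
  shows "R \<subseteq> T"
proof
  define supp where "supp f = {i. f i \<noteq> 0}" for f :: "nat \<Rightarrow> 'b"
  have fin: "finite (supp f)" if "f \<in> R" for f
  proof -
    have "supp f \<subseteq> {..<n}" using R_supp[OF that] unfolding supp_def by (auto simp: not_less) (meson not_le)
    thus ?thesis using finite_subset by blast
  qed
  fix f assume "f \<in> R"
  thus "f \<in> T"
  proof (induction "card (supp f)" arbitrary: f rule: less_induct)
    case less
    show ?case
    proof (cases "supp f = {}")
      case True
      hence "f i = 0" for i unfolding supp_def by blast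
      thus ?thesis using less.prems is_derivD(3)[OF \<Delta>] by (intro const) (auto simp: const_field_def)
    next
      case False
      let ?P = "\<lambda>g. g \<in> R \<and> supp g \<noteq> {} \<and> supp g \<subseteq> supp f"
      obtain g where g: "?P g" and min: "\<And>h. ?P h \<Longrightarrow> card (supp g) \<le> card (supp h)"
        using ex_has_least_nat[of ?P f "\<lambda>g. card (supp g)"] less.prems False by blast
      then obtain i0 where i0: "g i0 \<noteq> 0" unfolding supp_def by blast
      define h where "h = (\<lambda>i. inverse (g i0) * g i)"
      have hR: "h \<in> R" unfolding h_def using R_scale g by blast
      have h1: "h i0 = 1" using i0 by (simp add: h_def)
      have hs: "supp h = supp g" unfolding supp_def h_def using i0 by auto
      have "d (h i) = 0" if d: "d \<in> \<Delta>" for d i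
      proof (rule ccontr)
        assume nz: "d (h i) \<noteq> 0"
        define h' where "h' = (\<lambda>i. d (h i))"
        have h'R: "h' \<in> R" unfolding h'_def by (rule stable[OF d hR])
        have "supp h' \<subseteq> supp g - {i0}"
          unfolding hs[symmetric] unfolding supp_def h'_def using h1 is_derivD(3,4)[OF \<Delta>[OF d]] by auto
        moreover have "i0 \<in> supp g" unfolding supp_def using i0 by blast
        ultimately have "card (supp h') < card (supp g)" "supp h' \<subseteq> supp f"
          using fin[of g] g by (auto intro!: psubset_card_mono)
        moreover have "supp h' \<noteq> {}" using nz unfolding supp_def h'_def by blast
        ultimately show False using min[of h'] h'R by simp
      qed
      hence hT: "h \<in> T" using hR by (intro const) (auto simp: const_field_def)
      define f' where "f' = (\<lambda>i. f i + - f i0 * h i)"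
      have f'R: "f' \<in> R" unfolding f'_def by (intro R_add R_scale less.prems hR)
      have "supp f' \<subseteq> supp f - {i0}"
        using g unfolding hs[symmetric] unfolding f'_def supp_def using h1 by auto
      moreover have "i0 \<in> supp f" using g i0 unfolding supp_def by blast
      ultimately have "card (supp f') < card (supp f)"
        using fin[OF less.prems] by (intro psubset_card_mono) auto
      hence "f' \<in> T" using less.hyps f'R by blast
      hence "(\<lambda>i. f' i + f i0 * h i) \<in> T" by (intro T_add T_scale hT)
      thus ?thesis by (simp add: f'_def)
    qed
  qed
qed

text \<open>
  The \<open>e\<^sub>j\<close> form a basis of the rational span of the \<open>c\<^sub>i\<close>, chosen so that the coordinates are integers: when \<open>c\<^sub>n\<close> depends on the
  previous basis elements with denominator \<open>N\<close>, all of these are divided by \<open>N\<close>.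
\<close>
lemma int_basis:
  fixes c :: "nat \<Rightarrow> 'b::field_char_0"
  assumes C: "is_subfield C" and c: "\<And>i. i < n \<Longrightarrow> c i \<in> C"
  shows "\<exists>(r::nat) (e :: nat \<Rightarrow> 'b) (q :: nat \<Rightarrow> nat \<Rightarrow> int). (\<forall>j<r. e j \<in> C) \<and> (\<forall>i<n. c i = (\<Sum>j<r. of_int (q i j) * e j)) \<and>
    (\<forall>k :: nat \<Rightarrow> int. (\<Sum>j<r. of_int (k j) * e j) = 0 \<longrightarrow> (\<forall>j<r. k j = 0))"
  using c
proof (induction n)
  case 0
  show ?case by (intro exI[of _ 0]) auto
next
  case (Suc n)
  from Suc.IH[OF Suc.prems[OF less_SucI]]
  obtain r :: nat and e :: "nat \<Rightarrow> 'b" and q :: "nat \<Rightarrow> nat \<Rightarrow> int" where e: "\<And>j. j < r \<Longrightarrow> e j \<in> C"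
    and q: "\<And>i. i < n \<Longrightarrow> c i = (\<Sum>j<r. of_int (q i j) * e j)"
    and ind: "\<And>k :: nat \<Rightarrow> int. (\<Sum>j<r. of_int (k j) * e j) = 0 \<Longrightarrow> \<forall>j<r. k j = 0"
    by blast
  note CR = is_subringD[OF is_subfield_subring[OF C]]
  show ?case
  proof (cases "\<exists>N k. N \<noteq> 0 \<and> of_int N * c n = (\<Sum>j<r. of_int (k j) * e j)")
    case True
    then obtain N :: int and k :: "nat \<Rightarrow> int" where N: "N \<noteq> 0" "of_int N * c n = (\<Sum>j<r. of_int (k j) * e j)" by blast
    define e' where "e' j = e j / of_int N" for j
    define q' where "q' i j = (if i = n then k j else N * q i j)" for i j
    have "e' j \<in> C" if "j < r" for j unfolding e'_def using e[OF that] CR(9) by (intro is_subfield_divide[OF C])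
    moreover have "c i = (\<Sum>j<r. of_int (q' i j) * e' j)" if "i < Suc n" for i
    proof (cases "i = n")
      case True
      have "c n = (\<Sum>j<r. of_int (k j) * e j) / of_int N" using N by (simp add: field_simps)
      thus ?thesis using True by (simp add: q'_def e'_def sum_divide_distrib)
    next
      case False
      thus ?thesis using q[of i] that N(1) by (simp add: q'_def e'_def mult.assoc)
    qed
    moreover have "\<forall>j<r. k' j = 0" if "(\<Sum>j<r. of_int (k' j) * e' j) = 0" for k' :: "nat \<Rightarrow> int"
    proof (rule ind)
      have "(\<Sum>j<r. of_int (k' j) * e' j) = (\<Sum>j<r. of_int (k' j) * e j) / of_int N"
        by (simp add: e'_def sum_divide_distrib)
      thus "(\<Sum>j<r. of_int (k' j) * e j) = 0" using that N(1) by simp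
    qed
    ultimately show ?thesis by (intro exI[of _ r] exI[of _ e'] exI[of _ q']) blast
  next
    case False
    define e' where "e' j = (if j = r then c n else e j)" for j
    define q' where "q' i j = (if i = n then (if j = r then 1 else 0) else if j = r then 0 else q i j)" for i j
    have split: "(\<Sum>j<Suc r. of_int (k j) * e' j) = (\<Sum>j<r. of_int (k j) * e j) + of_int (k r) * c n" for k :: "nat \<Rightarrow> int"
      unfolding e'_def by simp
    have "e' j \<in> C" if "j < Suc r" for j using e[of j] Suc.prems[of n] that unfolding e'_def by auto
    moreover have "c i = (\<Sum>j<Suc r. of_int (q' i j) * e' j)" if "i < Suc n" for i
    proof (cases "i = n")
      case True
      thus ?thesis unfolding split by (simp add: q'_def)
    next
      case False
      thus ?thesis unfolding split using q[of i] that by (simp add: q'_def)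
    qed
    moreover have "\<forall>j<Suc r. k j = 0" if k: "(\<Sum>j<Suc r. of_int (k j) * e' j) = 0" for k :: "nat \<Rightarrow> int"
    proof -
      have s: "(\<Sum>j<r. of_int (k j) * e j) + of_int (k r) * c n = 0" using k unfolding split .
      have kr: "k r = 0"
      proof (rule ccontr)
        assume nz: "k r \<noteq> 0"
        have "of_int (k r) * c n = (\<Sum>j<r. of_int (- k j) * e j)"
          using s by (simp add: sum_negf eq_neg_iff_add_eq_0 add.commute)
        hence "k r \<noteq> 0 \<and> of_int (k r) * c n = (\<Sum>j<r. of_int ((\<lambda>j. - k j) j) * e j)" using nz by simp
        hence "\<exists>N k. N \<noteq> 0 \<and> of_int N * c n = (\<Sum>j<r. of_int (k j) * e j)" by (intro exI)
        thus False using False by simp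
      qed
      hence "\<forall>j<r. k j = 0" using s by (intro ind) simp
      thus ?thesis using kr by (auto simp: less_Suc_eq)
    qed
    ultimately show ?thesis by (intro exI[of _ "Suc r"] exI[of _ e'] exI[of _ q']) blast
  qed
qed

text \<open>
  Integer vectors \<open>\<mu> 0, \<dots>, \<mu> (u - 1)\<close> in reduced echelon form with pivots \<open>\<pi>\<close>, except that pivot entries may be any
  nonzero integers. Independence over every field of characteristic \<open>0\<close> and the rank can be read off.
\<close>
definition diag_family :: "nat \<Rightarrow> nat \<Rightarrow> (nat \<Rightarrow> nat \<Rightarrow> int) \<Rightarrow> (nat \<Rightarrow> nat) \<Rightarrow> bool" where
  "diag_family n u \<mu> \<pi> \<longleftrightarrow> (\<forall>j<u. \<pi> j < n \<and> \<mu> j (\<pi> j) \<noteq> 0 \<and> (\<forall>l<u. l \<noteq> j \<longrightarrow> \<mu> j (\<pi> l) = 0))"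

lemma diag_family_bound:
  assumes "diag_family n u \<mu> \<pi>" shows "u \<le> n"
proof -
  have "inj_on \<pi> {..<u}" using assms unfolding diag_family_def inj_on_def by (metis lessThan_iff)
  moreover have "\<pi> ` {..<u} \<subseteq> {..<n}" using assms unfolding diag_family_def by auto
  ultimately show ?thesis using card_inj_on_le[of \<pi> "{..<u}" "{..<n}"] by simp
qed

text \<open>
  A diagonal family in \<open>\<Lambda>\<close> of maximal length spans \<open>\<Lambda>\<close> over the rationals. If \<open>m\<close> were not in the span,
  cancelling its pivot entries would leave some entry \<open>p\<close> nonzero, and \<open>p\<close> could serve as an additional pivot.
\<close>
lemma diag_family_spans:
  fixes \<Lambda> :: "(nat \<Rightarrow> int) set"
  assumes add: "\<And>f g. f \<in> \<Lambda> \<Longrightarrow> g \<in> \<Lambda> \<Longrightarrow> (\<lambda>i. f i + g i) \<in> \<Lambda>"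
    and scale: "\<And>f c. f \<in> \<Lambda> \<Longrightarrow> (\<lambda>i. c * f i) \<in> \<Lambda>"
    and zero: "(\<lambda>i. 0) \<in> \<Lambda>"
    and supp: "\<And>f i. f \<in> \<Lambda> \<Longrightarrow> i \<ge> n \<Longrightarrow> f i = 0"
  obtains u \<mu> \<pi> where "diag_family n u \<mu> \<pi>" "\<And>j. j < u \<Longrightarrow> \<mu> j \<in> \<Lambda>"
    "\<And>m. m \<in> \<Lambda> \<Longrightarrow> \<exists>N k. N \<noteq> 0 \<and> (\<forall>i. N * m i = (\<Sum>j<u. k j * \<mu> j i))"
proof -
  let ?P = "\<lambda>u. \<exists>\<mu> \<pi>. diag_family n u \<mu> \<pi> \<and> (\<forall>j<u. \<mu> j \<in> \<Lambda>)"
  have "?P 0" by (auto simp: diag_family_def)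
  moreover have "\<forall>u. ?P u \<longrightarrow> u \<le> n" using diag_family_bound by blast
  ultimately obtain u where u: "?P u" and max: "\<And>v. ?P v \<Longrightarrow> v \<le> u"
    using Nat.ex_has_greatest_nat[of ?P 0 n] by blast
  then obtain \<mu> \<pi> where dg: "diag_family n u \<mu> \<pi>" and \<mu>: "\<And>j. j < u \<Longrightarrow> \<mu> j \<in> \<Lambda>" by blast
  have sum\<Lambda>: "(\<lambda>i. \<Sum>j\<in>J. k j * f j i) \<in> \<Lambda>" if "finite J" "\<And>j. j \<in> J \<Longrightarrow> f j \<in> \<Lambda>" for J k and f :: "nat \<Rightarrow> nat \<Rightarrow> int"
    using that by (induction J rule: finite_induct) (auto intro!: zero add scale)
  have "\<exists>N k. N \<noteq> 0 \<and> (\<forall>i. N * m i = (\<Sum>j<u. k j * \<mu> j i))" if m: "m \<in> \<Lambda>" for m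
  proof (rule ccontr)
    assume no: "\<not> ?thesis"
    define N where "N = (\<Prod>j<u. \<mu> j (\<pi> j))"
    define k where "k j = (\<Prod>l\<in>{..<u}-{j}. \<mu> l (\<pi> l)) * m (\<pi> j)" for j
    define m' where "m' = (\<lambda>i. N * m i + (-1) * (\<Sum>j<u. k j * \<mu> j i))"
    have N0: "N \<noteq> 0" unfolding N_def using dg unfolding diag_family_def by auto
    have m'\<Lambda>: "m' \<in> \<Lambda>" unfolding m'_def by (intro add scale m sum\<Lambda>) (use \<mu> in auto)
    have m'\<pi>: "m' (\<pi> l) = 0" if l: "l < u" for l
    proof -
      have "(\<Sum>j<u. k j * \<mu> j (\<pi> l)) = (\<Sum>j<u. if j = l then k l * \<mu> l (\<pi> l) else 0)"
        using dg l unfolding diag_family_def by (intro sum.cong) auto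
      also have "\<dots> = k l * \<mu> l (\<pi> l)" using l by simp
      also have "\<dots> = N * m (\<pi> l)" unfolding k_def N_def using l by (subst prod.remove[of "{..<u}" l]) auto
      finally show ?thesis unfolding m'_def by simp
    qed
    have "\<exists>p. m' p \<noteq> 0"
    proof (rule ccontr)
      assume "\<not> ?thesis"
      hence "\<forall>i. N * m i = (\<Sum>j<u. k j * \<mu> j i)" unfolding m'_def by simp
      thus False using no N0 by blast
    qed
    then obtain p where p: "m' p \<noteq> 0" by blast
    have pn: "p < n" using supp[OF m'\<Lambda>] p by (meson not_less)
    define \<mu>' where "\<mu>' j = (if j = u then m' else (\<lambda>i. m' p * \<mu> j i + (- \<mu> j p) * m' i))" for j
    define \<pi>' where "\<pi>' j = (if j = u then p else \<pi> j)" for j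
    have "diag_family n (Suc u) \<mu>' \<pi>'"
      unfolding diag_family_def \<mu>'_def \<pi>'_def using dg[unfolded diag_family_def] p pn m'\<pi>
      by (auto simp: less_Suc_eq)
    moreover have "\<forall>j<Suc u. \<mu>' j \<in> \<Lambda>" 
    proof (intro allI impI)
      fix j assume j: "j < Suc u"
      show "\<mu>' j \<in> \<Lambda>"
      proof (cases "j = u")
        case False
        hence "\<mu> j \<in> \<Lambda>" using j \<mu> by simp
        hence "(\<lambda>i. m' p * \<mu> j i + (- \<mu> j p) * m' i) \<in> \<Lambda>" by (intro add scale m'\<Lambda>)
        thus ?thesis using False unfolding \<mu>'_def by simp
      qed (use m'\<Lambda> in \<open>simp add: \<mu>'_def\<close>)
    qed
    ultimately have "?P (Suc u)" by blast
    thus False using max[of "Suc u"] by simp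
  qed
  thus thesis using that dg \<mu> by blast
qed

section \<open>Independence of the exponential forms\<close>
definition der_over :: "'b::field set \<Rightarrow> ('b \<Rightarrow> 'b) set" where
  "der_over k = {d. is_deriv d \<and> (\<forall>c\<in>k. d c = 0)}"

lemma linset_der_over: "linset (der_over k)"
  unfolding linset_def der_over_def is_deriv_def by (auto simp: algebra_simps)

text \<open>
  The differential form \<open>dy\<^sub>i/y\<^sub>i - dx\<^sub>i\<close>, evaluated at a derivation.
\<close>
definition exp_form :: "(nat \<Rightarrow> 'b::field) \<Rightarrow> (nat \<Rightarrow> 'b) \<Rightarrow> nat \<Rightarrow> ('b \<Rightarrow> 'b) \<Rightarrow> 'b" where
  "exp_form x y i d = d (y i) / y i - d (x i)"

lemma linfun_exp_form: "linfun (exp_form x y i)"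
  unfolding linfun_def exp_form_def by (simp add: add_divide_distrib algebra_simps)

lemma linfun_apply: "linfun (\<lambda>d. d a)"
  unfolding linfun_def by simp

text \<open>
  The hypothesis \<open>rot\<close> is what rotundity provides: for each family of \<open>u\<close> independent integer vectors, there are
  \<open>u\<close> elements algebraic over the field generated by \<open>k\<close> and the coordinates of \<open>[\<mu>](x, y)\<close>, whose differentials over \<open>k\<close> are independent, as
  witnessed by the dual derivations \<open>\<delta>\<close>.
\<close>
theorem ax_independence:
  fixes x y :: "nat \<Rightarrow> 'b::{alg_closed_field, field_char_0}" and k :: "'b set"
  assumes y: "\<And>i. i < n \<Longrightarrow> y i \<noteq> 0"
    and rot: "\<And>u \<mu> \<pi>. u \<ge> 1 \<Longrightarrow> diag_family n u \<mu> \<pi> \<Longrightarrow> \<exists>c \<delta>.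
      (\<forall>d\<in>der_over k. (\<forall>j<u. d (\<Sum>i<n. of_int (\<mu> j i) * x i) = 0 \<and> d (\<Prod>i<n. y i powi \<mu> j i) = 0) \<longrightarrow>
          (\<forall>j<u. d (c j) = 0)) \<and>
      (\<forall>l<u. \<delta> l \<in> der_over k \<and> (\<forall>j<u. \<delta> l (c j) = (if j = l then 1 else 0)))"
    and f: "\<And>d. d \<in> der_over k \<Longrightarrow> (\<Sum>i<n. f i * exp_form x y i d) = 0"
  shows "\<forall>i<n. f i = 0"
proof -
  let ?\<omega> = "exp_form x y"
  define \<Delta> where "\<Delta> = {d \<in> der_over k. \<forall>i<n. ?\<omega> i d = 0}"
  have \<Delta>d: "is_deriv d" if "d \<in> \<Delta>" for d using that unfolding \<Delta>_def der_over_def by blast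
  define C where "C = const_field \<Delta>"
  have C: "is_subfield C" unfolding C_def by (rule is_subfield_const_field[OF \<Delta>d])
  note CR = is_subringD[OF is_subfield_subring[OF C]]
  have kC: "k \<subseteq> C" unfolding C_def const_field_def \<Delta>_def der_over_def by auto
  define \<Gamma> where "\<Gamma> = der_over C"
  have \<Gamma>k: "\<Gamma> \<subseteq> der_over k" unfolding \<Gamma>_def der_over_def using kC by auto
  have \<Gamma>d: "is_deriv d" if "d \<in> \<Gamma>" for d using that unfolding \<Gamma>_def der_over_def by blast
  have \<Gamma>C: "d c = 0" if "d \<in> \<Gamma>" "c \<in> C" for d c using that unfolding \<Gamma>_def der_over_def by blast
  have Dy: "d (y i) = y i * d (x i)" if "d \<in> \<Delta>" "i < n" for d i
    using that y[OF that(2)] unfolding \<Delta>_def exp_form_def by (auto simp: field_simps)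
  have logform: "d (\<Prod>i<n. y i powi m i) / (\<Prod>i<n. y i powi m i) - d (\<Sum>i<n. of_int (m i) * x i) = (\<Sum>i<n. of_int (m i) * ?\<omega> i d)"
    if d: "is_deriv d" for d and m :: "nat \<Rightarrow> int"
  proof -
    have "d (\<Prod>i<n. y i powi m i) / (\<Prod>i<n. y i powi m i) = (\<Sum>i<n. of_int (m i) * (d (y i) / y i))"
      by (subst is_deriv_log_prod[OF d]) (use y in \<open>auto simp: is_deriv_log_powi[OF d] simp del: times_divide_eq_right\<close>)
    moreover have "d (\<Sum>i<n. of_int (m i) * x i) = (\<Sum>i<n. of_int (m i) * d (x i))"
      by (simp add: is_derivD[OF d])
    ultimately show ?thesis unfolding exp_form_def by (simp add: right_diff_distrib sum_subtractf)
  qed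
  \<comment> \<open>\<open>R\<close> consists of the relations between the forms on \<open>Der(\<Omega>/C)\<close>. On \<open>\<Delta>\<close> one has \<open>dy\<^sub>i/y\<^sub>i = dx\<^sub>i\<close>,
    so the condition in \<open>\<Lambda>\<close> says equally that \<open>y\<^sup>m\<close> is a constant, and it is visibly linear in \<open>m\<close>.\<close>
  define R where "R = {f. (\<forall>i\<ge>n. f i = 0) \<and> (\<forall>d\<in>\<Gamma>. (\<Sum>i<n. f i * ?\<omega> i d) = 0)}"
  define \<Lambda> where "\<Lambda> = {m :: nat \<Rightarrow> int. (\<forall>i\<ge>n. m i = 0) \<and> (\<forall>d\<in>\<Delta>. (\<Sum>i<n. of_int (m i) * d (x i)) = 0)}"
  obtain u \<mu> \<pi> where dg: "diag_family n u \<mu> \<pi>" and \<mu>\<Lambda>: "\<And>j. j < u \<Longrightarrow> \<mu> j \<in> \<Lambda>"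
    and span: "\<And>m. m \<in> \<Lambda> \<Longrightarrow> \<exists>N k. N \<noteq> 0 \<and> (\<forall>i. N * m i = (\<Sum>j<u. k j * \<mu> j i))"
  proof (rule diag_family_spans[of \<Lambda> n])
    show "(\<lambda>i. f i + g i) \<in> \<Lambda>" if "f \<in> \<Lambda>" "g \<in> \<Lambda>" for f g
      using that unfolding \<Lambda>_def by (auto simp: distrib_right sum.distrib)
    show "(\<lambda>i. c * f i) \<in> \<Lambda>" if "f \<in> \<Lambda>" for f c
      using that unfolding \<Lambda>_def by (auto simp: mult.assoc sum_distrib_left[symmetric])
    show "(\<lambda>i. 0) \<in> \<Lambda>" unfolding \<Lambda>_def by simp
    show "f i = 0" if "f \<in> \<Lambda>" "i \<ge> n" for f i using that unfolding \<Lambda>_def by blast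
  qed blast
  have \<Lambda>C: "(\<Sum>i<n. of_int (m i) * x i) \<in> C" "(\<Prod>i<n. y i powi m i) \<in> C" if m: "m \<in> \<Lambda>" for m
  proof -
    have "d (\<Sum>i<n. of_int (m i) * x i) = 0 \<and> d (\<Prod>i<n. y i powi m i) = 0" if d: "d \<in> \<Delta>" for d
    proof -
      have 1: "d (\<Sum>i<n. of_int (m i) * x i) = 0"
        using m d by (simp add: is_derivD[OF \<Delta>d[OF d]] \<Lambda>_def)
      have "(\<Sum>i<n. of_int (m i) * ?\<omega> i d) = 0" using d unfolding \<Delta>_def by simp
      hence "d (\<Prod>i<n. y i powi m i) / (\<Prod>i<n. y i powi m i) = 0" using logform[OF \<Delta>d[OF d], of m] 1 by simp
      moreover have "(\<Prod>i<n. y i powi m i) \<noteq> 0" using y by simp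
      ultimately show ?thesis using 1 by simp
    qed
    thus "(\<Sum>i<n. of_int (m i) * x i) \<in> C" "(\<Prod>i<n. y i powi m i) \<in> C" unfolding C_def const_field_def by auto
  qed
  define T where "T = {f :: nat \<Rightarrow> 'b. \<exists>g. \<forall>i. f i = (\<Sum>j<u. g j * of_int (\<mu> j i))}"
  have T_add: "(\<lambda>i. f i + g i) \<in> T" if fg: "f \<in> T" "g \<in> T" for f g
  proof -
    obtain a b where "\<forall>i. f i = (\<Sum>j<u. a j * of_int (\<mu> j i))" "\<forall>i. g i = (\<Sum>j<u. b j * of_int (\<mu> j i))"
      using fg unfolding T_def by blast
    hence "\<forall>i. f i + g i = (\<Sum>j<u. (a j + b j) * of_int (\<mu> j i))" by (simp add: distrib_right sum.distrib)
    thus ?thesis unfolding T_def mem_Collect_eq by (intro exI[of _ "\<lambda>j. a j + b j"])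
  qed
  have T_scale: "(\<lambda>i. c * f i) \<in> T" if f: "f \<in> T" for f c
  proof -
    obtain a where "\<forall>i. f i = (\<Sum>j<u. a j * of_int (\<mu> j i))" using f unfolding T_def by blast
    hence "\<forall>i. c * f i = (\<Sum>j<u. (c * a j) * of_int (\<mu> j i))" by (simp add: sum_distrib_left mult.assoc)
    thus ?thesis unfolding T_def mem_Collect_eq by (intro exI[of _ "\<lambda>j. c * a j"])
  qed
  have T_zero: "(\<lambda>i. 0) \<in> T" unfolding T_def mem_Collect_eq by (intro exI[of _ "\<lambda>j. 0"]) simp
  have T_sum: "(\<lambda>i. \<Sum>j\<in>J. g j i) \<in> T" if "finite J" "\<And>j. j \<in> J \<Longrightarrow> g j \<in> T" for J :: "nat set" and g
    using that by (induction J rule: finite_induct) (auto intro!: T_zero T_add)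
  have \<Lambda>T: "(\<lambda>i. of_int (m i)) \<in> T" if m: "m \<in> \<Lambda>" for m
  proof -
    obtain N a where Na: "N \<noteq> 0" "\<And>i. N * m i = (\<Sum>j<u. a j * \<mu> j i)" using span[OF m] by blast
    have "of_int (m i) = (\<Sum>j<u. (of_int (a j) / of_int N) * of_int (\<mu> j i) :: 'b)" for i
    proof -
      have "of_int N * of_int (m i) = (of_int (\<Sum>j<u. a j * \<mu> j i) :: 'b)" using Na(2)[of i] by (metis of_int_mult)
      hence "of_int (m i) = (\<Sum>j<u. of_int (a j) * of_int (\<mu> j i) :: 'b) / of_int N"
        using Na(1) by (simp add: field_simps)
      thus ?thesis by (simp add: sum_divide_distrib)
    qed
    thus ?thesis unfolding T_def mem_Collect_eq by (intro exI[of _ "\<lambda>j. of_int (a j) / of_int N"] allI)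
  qed
  have RT: "R \<subseteq> T"
  proof (rule deriv_stable_subspace[where n = n and \<Delta> = \<Delta>])
    show "(\<lambda>i. f i + g i) \<in> R" if "f \<in> R" "g \<in> R" for f g
      using that unfolding R_def by (auto simp: distrib_right sum.distrib)
    show "(\<lambda>i. c * f i) \<in> R" if "f \<in> R" for f c
      using that unfolding R_def by (auto simp: mult.assoc sum_distrib_left[symmetric])
    show "f i = 0" if "f \<in> R" "n \<le> i" for f i using that unfolding R_def by blast
    show "is_deriv d" if "d \<in> \<Delta>" for d by (rule \<Delta>d[OF that])
    show "(\<lambda>i. f i + g i) \<in> T" if "f \<in> T" "g \<in> T" for f g by (rule T_add[OF that])
    show "(\<lambda>i. c * f i) \<in> T" if "f \<in> T" for f c by (rule T_scale[OF that])
  next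
    fix d f assume d: "d \<in> \<Delta>" and f: "f \<in> R"
    note dD = is_derivD[OF \<Delta>d[OF d]]
    have "(\<Sum>i<n. d (f i) * ?\<omega> i g) = 0" if g: "g \<in> \<Gamma>" for g
    proof -
      \<comment> \<open>The commutator of \<open>d\<close> and \<open>g\<close> enters because the forms are closed: \<open>\<omega>\<^sub>i [d, g] = d (\<omega>\<^sub>i g)\<close> when \<open>\<omega>\<^sub>i d = 0\<close>.\<close>
      define b where "b = (\<lambda>a. d (g a) - g (d a))"
      have b: "b \<in> \<Gamma>" unfolding \<Gamma>_def der_over_def mem_Collect_eq
      proof (intro conjI ballI)
        show "is_deriv b" unfolding b_def by (rule is_deriv_commutator[OF \<Delta>d[OF d] \<Gamma>d[OF g]])
        fix c assume c: "c \<in> C"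
        hence "d c = 0" using d unfolding C_def const_field_def by blast
        thus "b c = 0" unfolding b_def using \<Gamma>C[OF g c] dD(3) is_derivD(3)[OF \<Gamma>d[OF g]] by simp
      qed
      have wb: "?\<omega> i b = d (?\<omega> i g)" if i: "i < n" for i
      proof -
        note gD = is_derivD[OF \<Gamma>d[OF g]]
        have yi: "y i \<noteq> 0" using y[OF i] .
        have gq: "g (y i) = y i * (g (y i) / y i)" using yi by simp
        have "d (g (y i)) = d (y i * (g (y i) / y i))" using gq by simp
        also have "\<dots> = y i * d (g (y i) / y i) + (g (y i) / y i) * (y i * d (x i))"
          unfolding dD(2) Dy[OF d i] ..
        finally have 1: "d (g (y i)) = y i * d (g (y i) / y i) + g (y i) * d (x i)" using yi by simp
        have 2: "g (d (y i)) = y i * g (d (x i)) + d (x i) * g (y i)" unfolding Dy[OF d i] gD(2) ..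
        have "b (y i) = y i * (d (g (y i) / y i) - g (d (x i)))" unfolding b_def 1 2 by (simp add: algebra_simps)
        hence "?\<omega> i b = d (g (y i) / y i) - g (d (x i)) - b (x i)" unfolding exp_form_def using yi by simp
        also have "\<dots> = d (g (y i) / y i) - d (g (x i))" unfolding b_def by simp
        finally show ?thesis unfolding exp_form_def by (simp add: dD(6))
      qed
      have "0 = d (\<Sum>i<n. f i * ?\<omega> i g)" using f g dD(3) unfolding R_def by simp
      also have "\<dots> = (\<Sum>i<n. f i * ?\<omega> i b) + (\<Sum>i<n. d (f i) * ?\<omega> i g)"
        by (simp add: dD(7) dD(2) wb sum.distrib mult.commute)
      also have "(\<Sum>i<n. f i * ?\<omega> i b) = 0" using f b unfolding R_def by blast
      finally show ?thesis by simp
    qed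
    moreover have "d (f i) = 0" if "i \<ge> n" for i using f that dD(3) unfolding R_def by simp
    ultimately show "(\<lambda>i. d (f i)) \<in> R" unfolding R_def by blast
  next
    fix f assume f: "f \<in> R" and fC: "\<And>i. f i \<in> const_field \<Delta>"
    hence fC': "f i \<in> C" for i unfolding C_def by blast
    obtain r :: nat and e :: "nat \<Rightarrow> 'b" and q :: "nat \<Rightarrow> nat \<Rightarrow> int" where
      e: "\<forall>j<r. e j \<in> C" and fq: "\<forall>i<n. f i = (\<Sum>j<r. of_int (q i j) * e j)"
      and ind: "\<forall>k :: nat \<Rightarrow> int. (\<Sum>j<r. of_int (k j) * e j) = 0 \<longrightarrow> (\<forall>j<r. k j = 0)"
      using int_basis[OF C, of n f] fC' by blast
    define z where "z j = (\<Prod>i<n. y i powi q i j)" for j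
    define v where "v = (\<Sum>i<n. f i * x i)"
    have z0: "z j \<noteq> 0" for j unfolding z_def using y by simp
    have eq: "(\<Sum>j<r. e j * (d (z j) / z j)) = d v" if "is_deriv d" "\<And>c. c \<in> C \<Longrightarrow> d c = 0" for d
    proof -
      have d\<Gamma>: "d \<in> \<Gamma>" using that unfolding \<Gamma>_def der_over_def by blast
      have zl: "d (z j) / z j = (\<Sum>i<n. of_int (q i j) * (d (y i) / y i))" for j
        unfolding z_def by (subst is_deriv_log_prod[OF that(1)])
          (use y in \<open>auto simp: is_deriv_log_powi[OF that(1)] simp del: times_divide_eq_right\<close>)
      have "(\<Sum>j<r. e j * (d (z j) / z j)) = (\<Sum>i<n. \<Sum>j<r. e j * (of_int (q i j) * (d (y i) / y i)))"
        unfolding zl sum_distrib_left by (rule sum.swap)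
      also have "\<dots> = (\<Sum>i<n. f i * (d (y i) / y i))"
        using fq by (intro sum.cong) (auto simp: sum_distrib_left sum_distrib_right mult_ac)
      also have "\<dots> = (\<Sum>i<n. f i * ?\<omega> i d) + (\<Sum>i<n. f i * d (x i))"
        unfolding exp_form_def by (simp add: algebra_simps sum_subtractf)
      also have "(\<Sum>i<n. f i * ?\<omega> i d) = 0" using f d\<Gamma> unfolding R_def by blast
      also have "(\<Sum>i<n. f i * d (x i)) = d v"
        unfolding v_def by (simp add: is_derivD(2,7)[OF that(1)] that(2)[OF fC'])
      finally show ?thesis by simp
    qed
    have zC: "z j \<in> C" if j: "j < r" for j
    proof -
      have "algebraic_over C (z j)"
        by (rule residue_independence[OF C, of r e z v]) (use e ind z0 eq j in auto)
      hence "d (z j) = 0" if "d \<in> \<Delta>" for d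
        by (rule deriv_eq_0_algebraic[OF \<Delta>d[OF that] C, rotated]) (use that in \<open>auto simp: C_def const_field_def\<close>)
      thus ?thesis unfolding C_def const_field_def by blast
    qed
    define m where "m j = (\<lambda>i. if i < n then q i j else 0)" for j
    have "m j \<in> \<Lambda>" if j: "j < r" for j
    proof -
      have "(\<Sum>i<n. of_int (m j i) * d (x i)) = 0" if d: "d \<in> \<Delta>" for d
      proof -
        have zm: "z j = (\<Prod>i<n. y i powi m j i)" unfolding z_def m_def by simp
        have "d (z j) = 0" using zC[OF j] d unfolding C_def const_field_def by blast
        moreover have "(\<Sum>i<n. of_int (m j i) * ?\<omega> i d) = 0" using d unfolding \<Delta>_def by simp
        ultimately have "d (\<Sum>i<n. of_int (m j i) * x i) = 0"
          using logform[OF \<Delta>d[OF d], of "m j"] unfolding zm[symmetric] by simp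
        thus ?thesis by (simp add: is_derivD[OF \<Delta>d[OF d]])
      qed
      thus ?thesis unfolding \<Lambda>_def m_def by auto
    qed
    hence "(\<lambda>i. \<Sum>j<r. e j * of_int (m j i)) \<in> T" by (intro T_sum T_scale \<Lambda>T) auto
    moreover have "(\<lambda>i. \<Sum>j<r. e j * of_int (m j i)) = f"
    proof
      fix i show "(\<Sum>j<r. e j * of_int (m j i)) = f i"
        using fq f unfolding m_def R_def by (cases "i < n") (auto simp: mult.commute)
    qed
    ultimately show "f \<in> T" by simp
  qed
  define f0 where "f0 = (\<lambda>i. if i < n then f i else 0)"
  have f0R: "f0 \<in> R" unfolding R_def f0_def using f \<Gamma>k by auto
  then obtain g where g: "\<And>i. f0 i = (\<Sum>j<u. g j * of_int (\<mu> j i))" using RT unfolding T_def by blast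
  have "f0 i = 0" for i
  proof (cases "u \<ge> 1")
    case False
    hence "u = 0" by simp
    thus ?thesis using g by simp
  next
    case True
    obtain c \<delta> where c: "\<forall>d\<in>der_over k. (\<forall>j<u. d (\<Sum>i<n. of_int (\<mu> j i) * x i) = 0 \<and> d (\<Prod>i<n. y i powi \<mu> j i) = 0) \<longrightarrow>
          (\<forall>j<u. d (c j) = 0)"
      and \<delta>: "\<forall>l<u. \<delta> l \<in> der_over k \<and> (\<forall>j<u. \<delta> l (c j) = (if j = l then 1 else 0))"
      using rot[OF True dg] by blast
    have c0: "d (c j) = 0" if d: "d \<in> der_over k" "\<And>a. a \<in> C \<Longrightarrow> d a = 0" and j: "j < u" for d j
      using c d j \<Lambda>C[OF \<mu>\<Lambda>] by blast
    \<comment> \<open>The differential of a constant \<open>c\<^sub>j\<close> of \<open>\<Delta>\<close> is a combination of the forms. As it vanishes on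
      \<open>Der(\<Omega>/C)\<close>, the coefficient vector belongs to \<open>R\<close> and hence to the span of \<open>\<mu>\<close>.\<close>
    have "\<exists>G. \<forall>d\<in>der_over k. d (c j) = (\<Sum>l<u. G l * (\<Sum>i<n. of_int (\<mu> l i) * ?\<omega> i d))" if j: "j < u" for j
    proof -
      have "\<exists>a. \<forall>d\<in>der_over k. d (c j) = (\<Sum>i<n. a i * ?\<omega> i d)"
      proof (rule functional_in_span[OF linset_der_over linfun_exp_form linfun_apply])
        fix d assume d: "d \<in> der_over k" "\<And>i. i < n \<Longrightarrow> ?\<omega> i d = 0"
        hence "d \<in> \<Delta>" unfolding \<Delta>_def by blast
        hence "d a = 0" if "a \<in> C" for a using that unfolding C_def const_field_def by blast
        thus "d (c j) = 0" using c0 d(1) j by blast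
      qed
      then obtain a where a: "\<And>d. d \<in> der_over k \<Longrightarrow> d (c j) = (\<Sum>i<n. a i * ?\<omega> i d)" by blast
      define a0 where "a0 = (\<lambda>i. if i < n then a i else 0)"
      have "(\<Sum>i<n. a0 i * ?\<omega> i d) = 0" if d: "d \<in> \<Gamma>" for d
      proof -
        have "(\<Sum>i<n. a0 i * ?\<omega> i d) = d (c j)" unfolding a0_def using a[of d] d \<Gamma>k by auto
        also have "\<dots> = 0" using c0 d \<Gamma>k \<Gamma>C j by blast
        finally show ?thesis .
      qed
      hence "a0 \<in> R" unfolding R_def a0_def by auto
      then obtain G where G: "\<And>i. a0 i = (\<Sum>l<u. G l * of_int (\<mu> l i))" using RT unfolding T_def by blast
      have "d (c j) = (\<Sum>l<u. G l * (\<Sum>i<n. of_int (\<mu> l i) * ?\<omega> i d))" if d: "d \<in> der_over k" for d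
      proof -
        have "d (c j) = (\<Sum>i<n. a0 i * ?\<omega> i d)" unfolding a0_def using a[OF d] by simp
        also have "\<dots> = (\<Sum>i<n. \<Sum>l<u. G l * (of_int (\<mu> l i) * ?\<omega> i d))"
          unfolding G by (simp add: sum_distrib_right mult.assoc)
        also have "\<dots> = (\<Sum>l<u. G l * (\<Sum>i<n. of_int (\<mu> l i) * ?\<omega> i d))"
          unfolding sum_distrib_left by (rule sum.swap)
        finally show ?thesis .
      qed
      thus ?thesis by (intro exI[of _ G]) blast
    qed
    hence "\<forall>j\<in>{..<u}. \<exists>G. \<forall>d\<in>der_over k. d (c j) = (\<Sum>l<u. G l * (\<Sum>i<n. of_int (\<mu> l i) * ?\<omega> i d))"
      by simp
    from bchoice[OF this] obtain G where "\<forall>j\<in>{..<u}. \<forall>d\<in>der_over k.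
        d (c j) = (\<Sum>l<u. G j l * (\<Sum>i<n. of_int (\<mu> l i) * ?\<omega> i d))" by (elim exE)
    hence G: "d (c j) = (\<Sum>l<u. G j l * (\<Sum>i<n. of_int (\<mu> l i) * ?\<omega> i d))" if "j < u" "d \<in> der_over k" for j d
      using that by simp
    \<comment> \<open>The square matrices satisfy \<open>G H = 1\<close>, so \<open>H G = 1\<close> as well, and \<open>g H = 0\<close> gives \<open>g = 0\<close>.\<close>
    define H where "H l s = (\<Sum>i<n. of_int (\<mu> l i) * ?\<omega> i (\<delta> s))" for l s
    have GH: "(\<Sum>l<u. G j l * H l s) = (if j = s then 1 else 0)" if "j < u" "s < u" for j s
      using G[OF that(1), of "\<delta> s"] \<delta> that unfolding H_def by auto
    have gH: "(\<Sum>l<u. g l * H l s) = 0" if s: "s < u" for s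
    proof -
      have "(\<Sum>l<u. g l * H l s) = (\<Sum>i<n. \<Sum>l<u. g l * (of_int (\<mu> l i) * ?\<omega> i (\<delta> s)))"
        unfolding H_def sum_distrib_left by (rule sum.swap)
      also have "\<dots> = (\<Sum>i<n. f0 i * ?\<omega> i (\<delta> s))" unfolding g by (simp add: sum_distrib_right mult.assoc)
      also have "\<dots> = 0" using f[of "\<delta> s"] \<delta> s unfolding f0_def by simp
      finally show ?thesis .
    qed
    have "g j = 0" if j: "j < u" for j
    proof -
      have "g j = (\<Sum>l<u. g l * (if l = j then 1 else 0))" using j by (simp add: if_distrib cong: if_cong)
      also have "\<dots> = (\<Sum>l<u. g l * (\<Sum>s<u. H l s * G s j))"
        using right_inverse_imp_left_inverse[of u G H, OF GH] j by (intro sum.cong) auto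
      also have "\<dots> = (\<Sum>l<u. \<Sum>s<u. (g l * H l s) * G s j)" by (simp add: sum_distrib_left mult.assoc)
      also have "\<dots> = (\<Sum>s<u. \<Sum>l<u. (g l * H l s) * G s j)" by (rule sum.swap)
      also have "\<dots> = (\<Sum>s<u. (\<Sum>l<u. g l * H l s) * G s j)" by (simp add: sum_distrib_right)
      also have "\<dots> = 0" using gH by simp
      finally show ?thesis .
    qed
    thus ?thesis using g by simp
  qed
  thus ?thesis unfolding f0_def by metis
qed


section \<open>Commuting derivations that satisfy the exponential equations\<close>

text \<open>
  The functionals \<open>\<phi>\<close> consist of the forms \<open>\<omega>\<^sub>i\<close> and of the differentials of certain coordinates \<open>w (\<rho> j)\<close>, in a maximal
  independent system; so a derivation over \<open>k\<close> killed by all of them kills all coordinates. Correcting the given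
  derivations by dual vectors makes them vanish under all \<open>\<phi>\<close>. Commutators of the corrected derivations \<open>E\<^sub>s\<close> with each
  other, and with derivations over \<open>k(w)\<close>, are again killed by all \<open>\<phi>\<close> and therefore kill the coordinates. Hence the
  \<open>E\<^sub>s\<close> commute on the common constants \<open>M\<close> of \<open>Der(\<Omega>/k(w))\<close>, and they map \<open>M\<close> to itself.
\<close>
theorem commuting_exp_derivations:
  fixes x y :: "nat \<Rightarrow> 'b::field_char_0" and k :: "'b set" and D :: "nat \<Rightarrow> 'b \<Rightarrow> 'b"
  assumes y: "\<And>i. i < n \<Longrightarrow> y i \<noteq> 0"
    and ind: "\<And>f. (\<And>d. d \<in> der_over k \<Longrightarrow> (\<Sum>i<n. f i * exp_form x y i d) = 0) \<Longrightarrow> \<forall>i<n. f i = 0"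
    and D: "\<And>s. s < m \<Longrightarrow> is_deriv (D s)"
    and Dk: "\<And>s c. s < m \<Longrightarrow> c \<in> k \<Longrightarrow> D s c \<in> k"
    and comm: "\<And>s t c. s < m \<Longrightarrow> t < m \<Longrightarrow> c \<in> k \<Longrightarrow> D s (D t c) = D t (D s c)"
  obtains E M where "is_subfield M" "k \<subseteq> M" "\<And>i. i < n \<Longrightarrow> x i \<in> M \<and> y i \<in> M"
    "\<And>s. s < m \<Longrightarrow> is_deriv (E s)" "\<And>s c. s < m \<Longrightarrow> c \<in> k \<Longrightarrow> E s c = D s c"
    "\<And>s i. s < m \<Longrightarrow> i < n \<Longrightarrow> E s (y i) = y i * E s (x i)"
    "\<And>s a. s < m \<Longrightarrow> a \<in> M \<Longrightarrow> E s a \<in> M"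
    "\<And>s t a. s < m \<Longrightarrow> t < m \<Longrightarrow> a \<in> M \<Longrightarrow> E s (E t a) = E t (E s a)"
proof -
  let ?\<omega> = "exp_form x y"
  define w where "w l = (if l < n then x l else y (l - n))" for l
  define \<phi> where "\<phi> \<rho> i = (if i < n then ?\<omega> i else (\<lambda>d. d (w (\<rho> (i - n)))))" for \<rho> :: "nat \<Rightarrow> nat" and i
  have lin\<phi>: "linfun (\<phi> \<rho> i)" for \<rho> i unfolding \<phi>_def by (simp add: linfun_exp_form linfun_apply)
  define P where "P u \<rho> \<longleftrightarrow> (\<forall>j<u. \<rho> j < 2 * n) \<and>
      (\<forall>a. (\<forall>d\<in>der_over k. (\<Sum>i<n + u. a i * \<phi> \<rho> i d) = 0) \<longrightarrow> (\<forall>i<n + u. a i = 0))" for u and \<rho> :: "nat \<Rightarrow> nat"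
  have P0: "P 0 \<rho>" for \<rho>
  proof -
    have "\<forall>i<n. a i = 0" if "\<forall>d\<in>der_over k. (\<Sum>i<n. a i * \<phi> \<rho> i d) = 0" for a
      using that by (intro ind) (simp add: \<phi>_def)
    thus ?thesis unfolding P_def by simp
  qed
  have bound: "u \<le> 2 * n" if P: "P u \<rho>" for u \<rho>
  proof -
    have "inj_on \<rho> {..<u}"
    proof (rule inj_onI, rule ccontr)
      fix j l assume jl: "j \<in> {..<u}" "l \<in> {..<u}" "\<rho> j = \<rho> l" "j \<noteq> l"
      define a :: "nat \<Rightarrow> 'b" where "a i = (if i = n + j then 1 else if i = n + l then - 1 else 0)" for i
      have "(\<Sum>i<n + u. a i * \<phi> \<rho> i d) = 0" for d
      proof -
        have "(\<Sum>i<n + u. a i * \<phi> \<rho> i d) = (\<Sum>i\<in>{n + j, n + l}. a i * \<phi> \<rho> i d)"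
          using jl by (intro sum.mono_neutral_right) (auto simp: a_def)
        also have "\<dots> = 0" using jl by (simp add: a_def \<phi>_def)
        finally show ?thesis .
      qed
      hence "\<forall>i<n + u. a i = 0" using P unfolding P_def by blast
      hence "a (n + j) = 0" using jl by simp
      thus False by (simp add: a_def)
    qed
    moreover have "\<rho> ` {..<u} \<subseteq> {..<2 * n}" using P unfolding P_def by auto
    ultimately show ?thesis using card_inj_on_le[of \<rho> "{..<u}" "{..<2 * n}"] by simp
  qed
  have "\<exists>\<rho>. P 0 \<rho>" using P0 by blast
  moreover have "\<forall>u. (\<exists>\<rho>. P u \<rho>) \<longrightarrow> u \<le> 2 * n" using bound by blast
  ultimately obtain u where u: "\<exists>\<rho>. P u \<rho>" and max: "\<And>v. \<exists>\<rho>. P v \<rho> \<Longrightarrow> v \<le> u"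
    using Nat.ex_has_greatest_nat[of "\<lambda>u. \<exists>\<rho>. P u \<rho>" 0 "2 * n"] by blast
  then obtain \<rho> where P: "P u \<rho>" by blast
  define N where "N = n + u"
  let ?\<phi> = "\<phi> \<rho>"
  have indN: "\<forall>i<N. a i = 0" if "\<And>d. d \<in> der_over k \<Longrightarrow> (\<Sum>i<N. a i * ?\<phi> i d) = 0" for a
    using P that unfolding P_def N_def by blast
  have uniq: "d (w l) = 0" if d: "d \<in> der_over k" "\<And>i. i < N \<Longrightarrow> ?\<phi> i d = 0" and l: "l < 2 * n" for d l
  proof (rule ccontr)
    assume nz: "d (w l) \<noteq> 0"
    define \<rho>' where "\<rho>' = \<rho>(u := l)"
    have old: "\<phi> \<rho>' i = ?\<phi> i" if "i < N" for i using that unfolding \<phi>_def \<rho>'_def N_def by auto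
    have new: "\<phi> \<rho>' N e = e (w l)" for e unfolding \<phi>_def \<rho>'_def N_def by simp
    have "\<forall>i<n + Suc u. a i = 0" if a: "\<forall>d\<in>der_over k. (\<Sum>i<n + Suc u. a i * \<phi> \<rho>' i d) = 0" for a
    proof -
      have s: "(\<Sum>i<N. a i * ?\<phi> i e) + a N * e (w l) = 0" if "e \<in> der_over k" for e
        using a that old new by (simp add: N_def[symmetric])
      have "a N = 0" using s[OF d(1)] d(2) nz by simp
      moreover from this have "\<forall>i<N. a i = 0" using s by (intro indN) simp
      ultimately show ?thesis unfolding N_def by (auto simp: less_Suc_eq)
    qed
    moreover have "\<forall>j<Suc u. \<rho>' j < 2 * n" using P l unfolding P_def \<rho>'_def by (auto simp: less_Suc_eq)
    ultimately have "P (Suc u) \<rho>'" unfolding P_def by blast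
    hence "\<exists>\<rho>. P (Suc u) \<rho>" by (intro exI[of _ \<rho>'])
    thus False using max[of "Suc u"] by simp
  qed
  have "\<exists>\<delta>. \<forall>l<N. \<delta> l \<in> der_over k \<and> (\<forall>i<N. ?\<phi> i (\<delta> l) = (if i = l then 1 else 0))"
    by (rule dual_vectors[OF linset_der_over lin\<phi> indN])
  then obtain \<delta> where "\<forall>l<N. \<delta> l \<in> der_over k \<and> (\<forall>i<N. ?\<phi> i (\<delta> l) = (if i = l then 1 else 0))"
    by (elim exE)
  hence \<delta>: "\<And>l. l < N \<Longrightarrow> \<delta> l \<in> der_over k"
    "\<And>l i. l < N \<Longrightarrow> i < N \<Longrightarrow> ?\<phi> i (\<delta> l) = (if i = l then 1 else 0)" by blast+
  define E where "E s = (\<lambda>a. D s a + (\<Sum>l<N. - ?\<phi> l (D s) * \<delta> l a))" for s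
  have \<delta>d: "is_deriv (\<delta> l)" "\<And>c. c \<in> k \<Longrightarrow> \<delta> l c = 0" if "l < N" for l
    using \<delta>(1)[OF that] unfolding der_over_def by auto
  have Ed: "is_deriv (E s)" if "s < m" for s
    unfolding E_def using D[OF that] \<delta>d(1) by (intro is_deriv_add is_deriv_lincomb) auto
  have Ek: "E s c = D s c" if "c \<in> k" for s c unfolding E_def using \<delta>d(2) that by simp
  have E\<phi>: "?\<phi> i (E s) = 0" if i: "i < N" for i s
  proof -
    have ls: "?\<phi> i (\<lambda>a. \<Sum>l\<in>J. c l * \<delta> l a) = (\<Sum>l\<in>J. c l * ?\<phi> i (\<delta> l))" if "finite J" for J c
      using that
    proof (induction J rule: finite_induct)
      case empty
      have "?\<phi> i (\<lambda>a. 0 * (\<delta> 0) a) = 0 * ?\<phi> i (\<delta> 0)" by (rule linfunD(2)[OF lin\<phi>])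
      thus ?case by simp
    next
      case (insert l J)
      have "?\<phi> i (\<lambda>a. c l * \<delta> l a + (\<Sum>l\<in>J. c l * \<delta> l a)) = ?\<phi> i (\<lambda>a. c l * \<delta> l a) + ?\<phi> i (\<lambda>a. \<Sum>l\<in>J. c l * \<delta> l a)"
        by (rule linfunD(1)[OF lin\<phi>])
      also have "?\<phi> i (\<lambda>a. c l * \<delta> l a) = c l * ?\<phi> i (\<delta> l)" by (rule linfunD(2)[OF lin\<phi>])
      finally show ?case using insert by simp
    qed
    have 1: "?\<phi> i (\<lambda>a. \<Sum>l<N. - ?\<phi> l (D s) * \<delta> l a) = (\<Sum>l<N. - ?\<phi> l (D s) * ?\<phi> i (\<delta> l))"
      using ls[OF finite_lessThan, of "\<lambda>l. - ?\<phi> l (D s)" N] .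
    have "?\<phi> i (E s) = ?\<phi> i (D s) + ?\<phi> i (\<lambda>a. \<Sum>l<N. - ?\<phi> l (D s) * \<delta> l a)"
      unfolding E_def by (rule linfunD(1)[OF lin\<phi>])
    also have "\<dots> = ?\<phi> i (D s) + (\<Sum>l<N. if l = i then - ?\<phi> i (D s) else 0)"
      unfolding 1 using \<delta>(2)[OF _ i] by (intro arg_cong2[of _ _ _ _ "(+)"] sum.cong) auto
    also have "\<dots> = 0" using i by simp
    finally show ?thesis .
  qed
  have Ey: "E s (y i) = y i * E s (x i)" if "i < n" for s i
  proof -
    have "?\<omega> i (E s) = 0" using E\<phi>[of i s] that unfolding \<phi>_def N_def by simp
    thus ?thesis using y[OF that] unfolding exp_form_def by (simp add: field_simps)
  qed
  have Et: "E s (w (\<rho> j)) = 0" if "j < u" for s j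
    using E\<phi>[of "n + j" s] that unfolding \<phi>_def N_def by simp
  have zero_w: "d \<in> der_over (k \<union> w ` {..<2 * n})" if d: "is_deriv d" "\<And>c. c \<in> k \<Longrightarrow> d c = 0"
      "\<And>i. i < n \<Longrightarrow> d (y i) = y i * d (x i)" "\<And>j. j < u \<Longrightarrow> d (w (\<rho> j)) = 0" for d
  proof -
    have dk: "d \<in> der_over k" using d unfolding der_over_def by blast
    have "?\<phi> i d = 0" if "i < N" for i
      using d(3)[of i] d(4)[of "i - n"] that y[of i] unfolding \<phi>_def N_def exp_form_def by auto
    hence "d (w l) = 0" if "l < 2 * n" for l using uniq[OF dk] that by blast
    thus ?thesis using dk unfolding der_over_def by auto
  qed
  define M where "M = const_field (der_over (k \<union> w ` {..<2 * n}))"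
  have M: "is_subfield M" unfolding M_def by (rule is_subfield_const_field) (simp add: der_over_def)
  have kM: "k \<subseteq> M" "w ` {..<2 * n} \<subseteq> M" unfolding M_def const_field_def der_over_def by auto
  have wx: "w i = x i" "w (n + i) = y i" if "i < n" for i using that unfolding w_def by auto
  have xyM: "x i \<in> M \<and> y i \<in> M" if "i < n" for i
  proof -
    have "w i \<in> M" "w (n + i) \<in> M" using kM(2) that by auto
    thus ?thesis using wx[OF that] by simp
  qed
  have EM: "E s a \<in> M" if s: "s < m" and a: "a \<in> M" for s a
  proof -
    have "d (E s a) = 0" if d: "d \<in> der_over (k \<union> w ` {..<2 * n})" for d
    proof -
      have dd: "is_deriv d" and dk: "\<And>c. c \<in> k \<Longrightarrow> d c = 0" and dw: "\<And>l. l < 2 * n \<Longrightarrow> d (w l) = 0"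
        using d unfolding der_over_def by auto
      have dxy: "d (x i) = 0" "d (y i) = 0" if "i < n" for i
        using dw[of i] dw[of "n + i"] wx[OF that] that by auto
      note E0 = is_derivD(3)[OF Ed[OF s]]
      define b where "b = (\<lambda>a. d (E s a) - E s (d a))"
      have "b \<in> der_over (k \<union> w ` {..<2 * n})"
      proof (rule zero_w)
        show "is_deriv b" unfolding b_def by (rule is_deriv_commutator[OF dd Ed[OF s]])
        show "b c = 0" if "c \<in> k" for c unfolding b_def using Ek[OF that] dk Dk[OF s that] that E0 by simp
        show "b (y i) = y i * b (x i)" if "i < n" for i
          unfolding b_def Ey[OF that] using dxy[OF that] E0 by (simp add: is_derivD(2)[OF dd])
        show "b (w (\<rho> j)) = 0" if "j < u" for j
          unfolding b_def Et[OF that] using dw[of "\<rho> j"] P that E0 is_derivD(3)[OF dd] unfolding P_def by simp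
      qed
      hence "b a = 0" using a unfolding M_def const_field_def by blast
      moreover have "d a = 0" using a d unfolding M_def const_field_def by blast
      ultimately show ?thesis unfolding b_def using E0 by simp
    qed
    thus ?thesis unfolding M_def const_field_def by blast
  qed
  have comM: "E s (E t a) = E t (E s a)" if st: "s < m" "t < m" and a: "a \<in> M" for s t a
  proof -
    define b where "b = (\<lambda>a. E s (E t a) - E t (E s a))"
    note Es = is_derivD[OF Ed[OF st(1)]] and Et' = is_derivD[OF Ed[OF st(2)]]
    have "b \<in> der_over (k \<union> w ` {..<2 * n})"
    proof (rule zero_w)
      show "is_deriv b" unfolding b_def by (rule is_deriv_commutator[OF Ed[OF st(1)] Ed[OF st(2)]])
      show "b c = 0" if "c \<in> k" for c
        unfolding b_def using Ek[OF that] Ek[OF Dk[OF st(1) that]] Ek[OF Dk[OF st(2) that]] comm[OF st that] by simp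
      show "b (y i) = y i * b (x i)" if "i < n" for i
        unfolding b_def Ey[OF that] Es(2) Et'(2) by (simp add: Ey[OF that] algebra_simps)
      show "b (w (\<rho> j)) = 0" if "j < u" for j
        unfolding b_def Et[OF that] using Es(3) Et'(3) by simp
    qed
    hence "b a = 0" using a unfolding M_def const_field_def by blast
    thus ?thesis unfolding b_def by simp
  qed
  show thesis using that[OF M kM(1) xyM Ed Ek Ey EM comM] by blast
qed

section \<open>Evaluation of multivariate polynomials\<close>

definition mono_val :: "('v \<Rightarrow>\<^sub>0 nat) \<Rightarrow> ('v \<Rightarrow> 'k::comm_ring_1) \<Rightarrow> 'k" where
  "mono_val t a = (\<Prod>v\<in>Poly_Mapping.keys t. a v ^ Poly_Mapping.lookup t v)"

definition ev :: "('a::zero \<Rightarrow> 'k::comm_ring_1) \<Rightarrow> ('v, 'a) mpol \<Rightarrow> ('v \<Rightarrow> 'k) \<Rightarrow> 'k" where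
  "ev h p a = (\<Sum>t\<in>Poly_Mapping.keys p. h (Poly_Mapping.lookup p t) * mono_val t a)"

lemma finsum_type_algebra:
  fixes f :: "'i \<Rightarrow> 'k::comm_ring_1"
  shows "finsum (ring_of_type_algebra :: 'k ring) f A = sum f A"
proof -
  interpret cring "ring_of_type_algebra :: 'k ring" by (rule cring_from_type_algebra)
  have c: "f \<in> A \<rightarrow> carrier ring_of_type_algebra" for f :: "'i \<Rightarrow> 'k" and A by (simp add: ring_of_type_algebra_def)
  show ?thesis
  proof (induction A rule: infinite_finite_induct)
    case (infinite A)
    thus ?case by (simp add: finsum_infinite) (simp add: ring_of_type_algebra_def)
  next
    case empty
    thus ?case by simp (simp add: ring_of_type_algebra_def)
  next
    case (insert x A)
    have "f x \<in> carrier ring_of_type_algebra" by (simp add: ring_of_type_algebra_def)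
    hence "finsum ring_of_type_algebra f (insert x A) = f x \<oplus>\<^bsub>ring_of_type_algebra\<^esub> finsum ring_of_type_algebra f A"
      by (rule finsum_insert[OF insert(1,2) c])
    thus ?case using insert by (simp add: ring_of_type_algebra_def)
  qed
qed

lemma finprod_type_algebra:
  fixes f :: "'i \<Rightarrow> 'k::comm_ring_1"
  shows "finprod (ring_of_type_algebra :: 'k ring) f A = prod f A"
proof -
  interpret cring "ring_of_type_algebra :: 'k ring" by (rule cring_from_type_algebra)
  have c: "f \<in> A \<rightarrow> carrier ring_of_type_algebra" for f :: "'i \<Rightarrow> 'k" and A by (simp add: ring_of_type_algebra_def)
  show ?thesis
  proof (induction A rule: infinite_finite_induct)
    case (infinite A)
    thus ?case by (simp add: finprod_infinite) (simp add: ring_of_type_algebra_def)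
  next
    case empty
    thus ?case by simp (simp add: ring_of_type_algebra_def)
  next
    case (insert x A)
    have "f x \<in> carrier ring_of_type_algebra" by (simp add: ring_of_type_algebra_def)
    hence "finprod ring_of_type_algebra f (insert x A) = f x \<otimes>\<^bsub>ring_of_type_algebra\<^esub> finprod ring_of_type_algebra f A"
      by (rule finprod_insert[OF insert(1,2) c])
    thus ?case using insert by (simp add: ring_of_type_algebra_def)
  qed
qed

lemma nat_pow_type_algebra:
  "x [^]\<^bsub>(ring_of_type_algebra :: 'k::comm_ring_1 ring)\<^esub> (n::nat) = x ^ n"
proof -
  interpret cring "ring_of_type_algebra :: 'k ring" by (rule cring_from_type_algebra)
  show ?thesis
    by (induction n) (simp_all add: nat_pow_0 nat_pow_Suc, simp_all add: ring_of_type_algebra_def mult.commute)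
qed

lemma mpol_eval_type_algebra: "mpol_eval ring_of_type_algebra h p a = ev h p a"
  unfolding mpol_eval_def ev_def mono_val_def finsum_type_algebra finprod_type_algebra nat_pow_type_algebra
  by (simp add: ring_of_type_algebra_def)

lemma mono_val_superset:
  assumes "finite A" "Poly_Mapping.keys t \<subseteq> A"
  shows "mono_val t a = (\<Prod>v\<in>A. a v ^ Poly_Mapping.lookup t v)"
  unfolding mono_val_def using assms by (intro prod.mono_neutral_left) (auto simp: in_keys_iff)

lemma mono_val_add: "mono_val (s + t) a = mono_val s a * mono_val t a"
proof -
  let ?A = "Poly_Mapping.keys s \<union> Poly_Mapping.keys t"
  have "mono_val (s + t) a = (\<Prod>v\<in>?A. a v ^ Poly_Mapping.lookup (s + t) v)"
    using Poly_Mapping.keys_add[of s t] by (intro mono_val_superset) auto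
  also have "\<dots> = (\<Prod>v\<in>?A. a v ^ Poly_Mapping.lookup s v) * (\<Prod>v\<in>?A. a v ^ Poly_Mapping.lookup t v)"
    by (simp add: lookup_add power_add prod.distrib)
  also have "\<dots> = mono_val s a * mono_val t a"
    by (subst (1 2) mono_val_superset[symmetric]) auto
  finally show ?thesis .
qed

lemma ev_superset:
  assumes "ring_homo h" "finite A" "Poly_Mapping.keys p \<subseteq> A"
  shows "ev h p a = (\<Sum>t\<in>A. h (Poly_Mapping.lookup p t) * mono_val t a)"
  unfolding ev_def using assms(2,3)
  by (intro sum.mono_neutral_left) (auto simp: in_keys_iff ring_homoD(1)[OF assms(1)])

lemma ev_add:
  assumes h: "ring_homo h" shows "ev h (p + q) a = ev h p a + ev h q a"
proof -
  let ?A = "Poly_Mapping.keys p \<union> Poly_Mapping.keys q"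
  have "ev h (p + q) a = (\<Sum>t\<in>?A. h (Poly_Mapping.lookup (p + q) t) * mono_val t a)"
    using Poly_Mapping.keys_add[of p q] by (intro ev_superset[OF h]) auto
  also have "\<dots> = (\<Sum>t\<in>?A. h (Poly_Mapping.lookup p t) * mono_val t a) + (\<Sum>t\<in>?A. h (Poly_Mapping.lookup q t) * mono_val t a)"
    by (simp add: lookup_add ring_homoD[OF h] distrib_right sum.distrib)
  also have "\<dots> = ev h p a + ev h q a"
    by (subst (1 2) ev_superset[OF h, symmetric]) auto
  finally show ?thesis .
qed

lemma ev_0 [simp]: "ev h 0 a = 0"
  by (simp add: ev_def)

lemma ev_sum:
  assumes h: "ring_homo h" shows "ev h (\<Sum>i\<in>I. f i) a = (\<Sum>i\<in>I. ev h (f i) a)"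
  by (induction I rule: infinite_finite_induct) (auto simp: ev_add[OF h])

lemma ev_single:
  assumes h: "ring_homo h" shows "ev h (Poly_Mapping.single t c) a = h c * mono_val t a"
  by (cases "c = 0") (auto simp: ev_def ring_homoD(1)[OF h] mono_val_def)

lemma mpol_sum_singles:
  "p = (\<Sum>t\<in>Poly_Mapping.keys p. Poly_Mapping.single t (Poly_Mapping.lookup p t))"
proof (rule poly_mapping_eqI)
  fix k
  have "Poly_Mapping.lookup (\<Sum>t\<in>Poly_Mapping.keys p. Poly_Mapping.single t (Poly_Mapping.lookup p t)) k
      = (\<Sum>t\<in>Poly_Mapping.keys p. if t = k then Poly_Mapping.lookup p k else 0)"
    by (simp add: lookup_sum lookup_single when_def)
  also have "\<dots> = Poly_Mapping.lookup p k" by (simp add: in_keys_iff)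
  finally show "Poly_Mapping.lookup p k = Poly_Mapping.lookup (\<Sum>t\<in>Poly_Mapping.keys p. Poly_Mapping.single t (Poly_Mapping.lookup p t)) k" by simp
qed

lemma ev_mult:
  fixes p q :: "('v, 'a::comm_ring_1) mpol"
  assumes h: "ring_homo h" shows "ev h (p * q) a = ev h p a * ev h q a"
proof -
  let ?s = "\<lambda>p t. Poly_Mapping.single t (Poly_Mapping.lookup p t)"
  have "p * q = (\<Sum>t\<in>Poly_Mapping.keys p. ?s p t) * (\<Sum>t\<in>Poly_Mapping.keys q. ?s q t)"
    using mpol_sum_singles[of p] mpol_sum_singles[of q] by simp
  also have "\<dots> = (\<Sum>s\<in>Poly_Mapping.keys p. \<Sum>t\<in>Poly_Mapping.keys q. ?s p s * ?s q t)" by (rule sum_product)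
  finally have "ev h (p * q) a = (\<Sum>s\<in>Poly_Mapping.keys p. \<Sum>t\<in>Poly_Mapping.keys q. ev h (?s p s * ?s q t) a)"
    by (simp only: ev_sum[OF h])
  also have "\<dots> = (\<Sum>s\<in>Poly_Mapping.keys p. \<Sum>t\<in>Poly_Mapping.keys q.
      (h (Poly_Mapping.lookup p s) * mono_val s a) * (h (Poly_Mapping.lookup q t) * mono_val t a))"
    by (simp add: mult_single ev_single[OF h] ring_homoD(4)[OF h] mono_val_add mult_ac)
  also have "\<dots> = ev h p a * ev h q a" unfolding ev_def by (rule sum_product[symmetric])
  finally show ?thesis .
qed

lemma mono_val_hom: "ring_homo g \<Longrightarrow> g (mono_val t a) = mono_val t (\<lambda>v. g (a v))"
  unfolding mono_val_def by (simp add: ring_homoD)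

lemma ev_hom: "ring_homo g \<Longrightarrow> g (ev h p a) = ev (\<lambda>c. g (h c)) p (\<lambda>v. g (a v))"
  unfolding ev_def by (simp add: ring_homoD mono_val_hom)

lemma ev_cong: "(\<And>v. v \<in> mpol_vars p \<Longrightarrow> a v = b v) \<Longrightarrow> ev h p a = ev h p b"
  unfolding ev_def mono_val_def mpol_vars_def
  by (intro sum.cong arg_cong2[of _ _ _ _ "(*)"] prod.cong arg_cong2[of _ _ _ _ "(^)"]) auto

section \<open>Polynomial functions and the Zariski topology\<close>

text \<open>
  Polynomial functions instead of polynomials: they form a subring of the ring of all functions, so the results on
  subrings apply to them.
\<close>
inductive_set poly_fun :: "nat \<Rightarrow> ('a::field_char_0 alg_closure vec \<Rightarrow> 'a alg_closure) set" for N where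
  const: "(\<lambda>v. to_ac c) \<in> poly_fun N"
| coord: "i < N \<Longrightarrow> (\<lambda>v. v $ i) \<in> poly_fun N"
| add: "f \<in> poly_fun N \<Longrightarrow> g \<in> poly_fun N \<Longrightarrow> f + g \<in> poly_fun N"
| mult: "f \<in> poly_fun N \<Longrightarrow> g \<in> poly_fun N \<Longrightarrow> f * g \<in> poly_fun N"

lemma is_subring_poly_fun: "is_subring (poly_fun N)"
  unfolding is_subring_def
proof (intro conjI ballI)
  have "(\<lambda>v. to_ac 1) \<in> poly_fun N" by (rule poly_fun.const)
  thus "1 \<in> poly_fun N" by (simp add: one_fun_def)
  fix f assume f: "f \<in> poly_fun N"
  have "(\<lambda>v. to_ac (-1)) * f \<in> poly_fun N" by (intro poly_fun.intros f)
  moreover have "(\<lambda>v. to_ac (-1)) * f = - f" by (rule ext) (simp only: times_fun_def uminus_apply to_ac_minus to_ac_1, simp)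
  ultimately show "- f \<in> poly_fun N" by simp
qed (auto intro: poly_fun.intros)

lemma ring_homo_to_ac: "ring_homo (to_ac :: 'a::field \<Rightarrow> _)"
  by (simp add: ring_homo_def)

lemma poly_fun_imp_mpol:
  fixes f :: "'a::field_char_0 alg_closure vec \<Rightarrow> 'a alg_closure"
  assumes "f \<in> poly_fun N"
  shows "\<exists>p. mpol_vars p \<subseteq> {..<N} \<and> (\<forall>v. f v = ev to_ac p (\<lambda>i. v $ i))"
  using assms
proof (induction rule: poly_fun.induct)
  case (const c)
  show ?case
    by (intro exI[of _ "Poly_Mapping.single 0 c"])
      (auto simp: ev_single[OF ring_homo_to_ac] mpol_vars_def mono_val_def)
next
  case (coord i)
  show ?case
    by (intro exI[of _ "Poly_Mapping.single (Poly_Mapping.single i 1) 1"])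
      (use coord in \<open>auto simp: ev_single[OF ring_homo_to_ac] mpol_vars_def mono_val_def\<close>)
next
  case (add f g)
  then obtain p q where "mpol_vars p \<subseteq> {..<N}" "\<forall>v. f v = ev to_ac p (\<lambda>i. v $ i)"
    "mpol_vars q \<subseteq> {..<N}" "\<forall>v. g v = ev to_ac q (\<lambda>i. v $ i)" by blast
  moreover have "mpol_vars (p + q) \<subseteq> mpol_vars p \<union> mpol_vars q"
    unfolding mpol_vars_def using Poly_Mapping.keys_add[of p q] by blast
  ultimately show ?case by (intro exI[of _ "p + q"]) (auto simp: ev_add[OF ring_homo_to_ac])
next
  case (mult f g)
  then obtain p q where pq: "mpol_vars p \<subseteq> {..<N}" "\<forall>v. f v = ev to_ac p (\<lambda>i. v $ i)"
    "mpol_vars q \<subseteq> {..<N}" "\<forall>v. g v = ev to_ac q (\<lambda>i. v $ i)" by blast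
  have "mpol_vars (p * q) \<subseteq> mpol_vars p \<union> mpol_vars q"
  proof
    fix v assume "v \<in> mpol_vars (p * q)"
    then obtain t where t: "t \<in> Poly_Mapping.keys (p * q)" "v \<in> Poly_Mapping.keys t" unfolding mpol_vars_def by blast
    then obtain s s' where "t = s + s'" "s \<in> Poly_Mapping.keys p" "s' \<in> Poly_Mapping.keys q"
      using Poly_Mapping.keys_mult[of p q] by blast
    thus "v \<in> mpol_vars p \<union> mpol_vars q" unfolding mpol_vars_def using t(2) Poly_Mapping.keys_add[of s s'] by blast
  qed
  thus ?case using pq by (intro exI[of _ "p * q"]) (auto simp: ev_mult[OF ring_homo_to_ac])
qed

lemma mpol_imp_poly_fun:
  fixes p :: "(nat, 'a::field_char_0) mpol"
  assumes "mpol_vars p \<subseteq> {..<N}"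
  shows "(\<lambda>v. ev to_ac p (\<lambda>i. v $ i)) \<in> poly_fun N"
proof -
  note PR = is_subringD[OF is_subring_poly_fun[of N]]
  have sumf: "(\<lambda>v. \<Sum>i\<in>I. f i v) = (\<Sum>i\<in>I. f i)" for I :: "'i set" and f :: "'i \<Rightarrow> 'a alg_closure vec \<Rightarrow> 'a alg_closure"
    by (induction I rule: infinite_finite_induct) (auto simp: fun_eq_iff)
  have prodf: "(\<lambda>v. \<Prod>i\<in>I. f i v) = (\<Prod>i\<in>I. f i)" for I :: "'i set" and f :: "'i \<Rightarrow> 'a alg_closure vec \<Rightarrow> 'a alg_closure"
    by (induction I rule: infinite_finite_induct) (auto simp: fun_eq_iff)
  have multf: "(\<lambda>v. f v * g v) = f * g" for f g :: "'a alg_closure vec \<Rightarrow> 'a alg_closure" by (rule ext) simp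
  have powf: "(\<lambda>v :: 'a alg_closure vec. v $ i ^ n) \<in> poly_fun N" if "i < N" for i n
  proof (induction n)
    case 0 show ?case using PR(2) by (simp add: one_fun_def)
  next
    case (Suc n)
    have "(\<lambda>v :: 'a alg_closure vec. v $ i) * (\<lambda>v. v $ i ^ n) \<in> poly_fun N" by (intro poly_fun.mult poly_fun.coord that Suc)
    moreover have "(\<lambda>v. v $ i) * (\<lambda>v. v $ i ^ n) = (\<lambda>v :: 'a alg_closure vec. v $ i ^ Suc n)"
      by (rule ext) simp
    ultimately show ?case by simp
  qed
  have "(\<lambda>v :: 'a alg_closure vec. mono_val t (\<lambda>i. v $ i)) \<in> poly_fun N" if "t \<in> Poly_Mapping.keys p" for t
    unfolding mono_val_def prodf using assms that by (intro PR(11) powf) (auto simp: mpol_vars_def)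
  thus ?thesis unfolding ev_def sumf multf by (intro PR(10) PR(4) poly_fun.const) auto
qed

lemma zariski_closed_zero_set:
  assumes "f \<in> poly_fun N" shows "zariski_closed N {v \<in> carrier_vec N. f v = 0}"
proof -
  obtain p where "mpol_vars p \<subseteq> {..<N}" "\<forall>v. f v = ev to_ac p (\<lambda>i. v $ i)" using poly_fun_imp_mpol[OF assms] by blast
  thus ?thesis unfolding zariski_closed_def
    by (intro exI[of _ "{p}"]) (auto simp: mpol_eval_type_algebra)
qed

lemma zariski_closed_carrier: "zariski_closed N Z \<Longrightarrow> Z \<subseteq> carrier_vec N"
  unfolding zariski_closed_def by auto

lemma zariski_irreducible_prime:
  assumes A: "zariski_irreducible N A" "A \<subseteq> carrier_vec N" and fg: "f \<in> poly_fun N" "g \<in> poly_fun N"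
    and eq: "\<And>v. v \<in> A \<Longrightarrow> f v * g v = 0"
  shows "(\<forall>v\<in>A. f v = 0) \<or> (\<forall>v\<in>A. g v = 0)"
proof -
  let ?Z = "\<lambda>f. {v \<in> carrier_vec N. f v = 0}"
  have "A \<subseteq> ?Z f \<union> ?Z g" using A(2) eq by auto
  hence "A \<subseteq> ?Z f \<or> A \<subseteq> ?Z g"
    using A(1) zariski_closed_zero_set[OF fg(1)] zariski_closed_zero_set[OF fg(2)]
    unfolding zariski_irreducible_def by blast
  thus ?thesis by blast
qed

lemma zariski_closed_separate:
  fixes Z :: "'a::field_char_0 alg_closure vec set"
  assumes "zariski_closed N Z" "zariski_closed N Z'" "Z \<subset> Z'"
  shows "\<exists>f\<in>poly_fun N. (\<forall>v\<in>Z. f v = 0) \<and> (\<exists>v\<in>Z'. f v \<noteq> 0)"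
proof -
  obtain v where v: "v \<in> Z'" "v \<notin> Z" using assms(3) by blast
  obtain S where S: "\<And>p. p \<in> S \<Longrightarrow> mpol_vars p \<subseteq> {..<N}"
    "Z = {v \<in> carrier_vec N. \<forall>p\<in>S. ev to_ac p (\<lambda>i. v $ i) = 0}"
    using assms(1) unfolding zariski_closed_def mpol_eval_type_algebra by blast
  obtain p where p: "p \<in> S" "ev to_ac p (\<lambda>i. v $ i) \<noteq> 0"
    using v S(2) zariski_closed_carrier[OF assms(2)] by auto
  show ?thesis
    by (rule bexI[OF _ mpol_imp_poly_fun[OF S(1)[OF p(1)]]]) (use p v S(2) in auto)
qed

lemma zariski_closure_vanish:
  assumes "f \<in> poly_fun N" "A \<subseteq> carrier_vec N" "\<And>v. v \<in> A \<Longrightarrow> f v = 0" "v \<in> zariski_closure N A"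
  shows "f v = 0"
proof -
  have "v \<in> {v \<in> carrier_vec N. f v = 0}"
    using assms(4) zariski_closed_zero_set[OF assms(1)] assms(2,3) unfolding zariski_closure_def by blast
  thus ?thesis by simp
qed

section \<open>Krull dimension and transcendence\<close>

lemma ring_homo_apply: "ring_homo (\<lambda>f. f v)" for v :: 'v
  by (simp add: ring_homo_def)

lemma zariski_dim_chain:
  assumes "zariski_dim N W \<ge> enat r" "r \<ge> 1"
  obtains Z where "\<And>i. i \<le> r \<Longrightarrow> zariski_closed N (Z i) \<and> zariski_irreducible N (Z i) \<and> Z i \<subseteq> W"
    "\<And>i. i < r \<Longrightarrow> Z i \<subset> Z (Suc i)"
proof -
  let ?S = "{enat d | d. \<exists>Z. (\<forall>i\<le>d. zariski_closed N (Z i) \<and> zariski_irreducible N (Z i) \<and> Z i \<subseteq> W) \<and>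
     (\<forall>i<d. Z i \<subset> Z (Suc i))}"
  have "enat (r - 1) < Sup ?S" using assms unfolding zariski_dim_def by (cases r) (auto simp: Suc_ile_eq)
  then obtain x where "x \<in> ?S" "enat (r - 1) < x" unfolding less_Sup_iff by blast
  then obtain d Z where "r - 1 < d" and Z: "\<forall>i\<le>d. zariski_closed N (Z i) \<and> zariski_irreducible N (Z i) \<and> Z i \<subseteq> W"
     "\<forall>i<d. Z i \<subset> Z (Suc i)" by auto
  hence "r \<le> d" by simp
  thus thesis using Z by (intro that[of Z]) auto
qed

text \<open>
  Suppose \<open>star\<close> evaluates functions at a generic point of \<open>W\<close>. Along a chain \<open>Z\<^sub>0 \<subset> \<dots> \<subset> Z\<^sub>r\<close>, choose \<open>f\<^sub>i\<close> that vanishes on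
  \<open>Z\<^sub>i\<close> but not on \<open>Z\<^sub>i\<^sub>+\<^sub>1\<close>, and let \<open>A\<^sub>i\<close> be the ring generated by the constants and \<open>f\<^sub>0, \<dots>, f\<^sub>i\<^sub>-\<^sub>1\<close>. No
  nonzero element of \<open>A\<^sub>i\<close> vanishes on \<open>Z\<^sub>i\<close>, by induction on \<open>i\<close>: in an equation \<open>\<Sum> a\<^sub>j f\<^sub>i\<^sup>j = 0\<close> on \<open>Z\<^sub>i\<^sub>+\<^sub>1\<close> with
  coefficients in \<open>A\<^sub>i\<close>, divide by the largest possible power of \<open>f\<^sub>i\<close>, which is allowed since the ideal of \<open>Z\<^sub>i\<^sub>+\<^sub>1\<close> is prime, and
  restrict to \<open>Z\<^sub>i\<close>, where only the lowest coefficient survives. Hence every \<open>star f\<^sub>i\<close> is transcendental over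
  \<open>star ` A\<^sub>i\<close>. This gives derivations with a triangular matrix of values at the \<open>star f\<^sub>j\<close>, and the
  \<open>\<delta>\<^sub>l\<close> are obtained from them by duality.
\<close>
theorem chain_derivations:
  fixes star :: "('a::field_char_0 alg_closure vec \<Rightarrow> 'a alg_closure) \<Rightarrow> 'b::field_char_0"
  assumes dim: "zariski_dim N W \<ge> enat r" and r: "r \<ge> 1"
    and star: "ring_homo star"
    and gen: "\<And>f v. f \<in> poly_fun N \<Longrightarrow> star f = 0 \<Longrightarrow> v \<in> W \<Longrightarrow> f v = 0"
  shows "\<exists>f \<delta>. (\<forall>j<r. f j \<in> poly_fun N) \<and>
    (\<forall>l<r. \<delta> l \<in> der_over (range (\<lambda>c. star (\<lambda>v. to_ac c))) \<and> (\<forall>j<r. \<delta> l (star (f j)) = (if j = l then 1 else 0)))"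
proof -
  obtain Z where Z: "\<And>i. i \<le> r \<Longrightarrow> zariski_closed N (Z i)" "\<And>i. i \<le> r \<Longrightarrow> zariski_irreducible N (Z i)"
      "\<And>i. i \<le> r \<Longrightarrow> Z i \<subseteq> W" and strict: "\<And>i. i < r \<Longrightarrow> Z i \<subset> Z (Suc i)"
    using zariski_dim_chain[OF dim r] by metis
  have "\<exists>f. f \<in> poly_fun N \<and> (\<forall>v\<in>Z i. f v = 0) \<and> (\<exists>v\<in>Z (Suc i). f v \<noteq> 0)" if "i < r" for i
    using zariski_closed_separate[OF Z(1) Z(1) strict[OF that]] that by auto
  then obtain f where f: "\<And>i. i < r \<Longrightarrow> f i \<in> poly_fun N" "\<And>i v. i < r \<Longrightarrow> v \<in> Z i \<Longrightarrow> f i v = 0"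
    "\<And>i. i < r \<Longrightarrow> \<exists>v\<in>Z (Suc i). f i v \<noteq> 0" by metis
  define A where "A = rec_nat (range (\<lambda>c v. to_ac c) :: ('a alg_closure vec \<Rightarrow> 'a alg_closure) set) (\<lambda>i B. adjoin B (f i))"
  have A0: "A 0 = range (\<lambda>c v. to_ac c)" and AS: "A (Suc i) = adjoin (A i) (f i)" for i
    unfolding A_def by simp_all
  have sub0: "is_subring (A 0)" unfolding A0 is_subring_def
  proof (intro conjI ballI)
    show "1 \<in> range (\<lambda>c v. to_ac c)" by (rule image_eqI[of _ _ 1]) (auto simp: one_fun_def)
  next
    fix g h :: "'a alg_closure vec \<Rightarrow> 'a alg_closure" assume "g \<in> range (\<lambda>c v. to_ac c)" "h \<in> range (\<lambda>c v. to_ac c)"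
    then obtain c d where "g = (\<lambda>v. to_ac c)" "h = (\<lambda>v. to_ac d)" by blast
    hence "g + h = (\<lambda>v. to_ac (c + d))" "g * h = (\<lambda>v. to_ac (c * d))" by (simp_all add: fun_eq_iff)
    thus "g + h \<in> range (\<lambda>c v. to_ac c)" "g * h \<in> range (\<lambda>c v. to_ac c)" by blast+
  next
    fix g :: "'a alg_closure vec \<Rightarrow> 'a alg_closure" assume "g \<in> range (\<lambda>c v. to_ac c)"
    then obtain c where "g = (\<lambda>v. to_ac c)" by blast
    thus "- g \<in> range (\<lambda>c v. to_ac c)" by (auto intro!: image_eqI[of _ _ "- c"])
  qed
  have subA: "is_subring (A i)" for i by (induction i) (auto simp: sub0 AS intro: is_subring_adjoin)
  have AP: "A i \<subseteq> poly_fun N" if "i \<le> r" for i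
    using that
  proof (induction i)
    case 0 show ?case unfolding A0 by (auto intro: poly_fun.const)
  next
    case (Suc i)
    show ?case unfolding AS adjoin_def
    proof safe
      fix p assume "p \<in> polys_over (A i)"
      hence "p \<in> polys_over (poly_fun N)" using Suc polys_over_mono[of "A i" "poly_fun N"] by auto
      thus "poly p (f i) \<in> poly_fun N" using poly_in_subring[OF is_subring_poly_fun _ f(1)] Suc.prems by simp
    qed
  qed
  have applyp: "poly p g v = poly (map_poly (\<lambda>f. f v) p) (g v)" for p :: "('a alg_closure vec \<Rightarrow> 'a alg_closure) poly" and g v
    using ring_homo_poly[OF ring_homo_apply[of v], of p g] .
  have step: "p = 0" if i: "i < r" and IH: "\<And>a. a \<in> A i \<Longrightarrow> \<forall>v\<in>Z i. a v = 0 \<Longrightarrow> a = 0"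
    and p: "p \<in> polys_over (A i)" and van: "\<forall>v\<in>Z (Suc i). poly p (f i) v = 0" for i p
  proof (rule ccontr)
    assume "p \<noteq> 0"
    then obtain k q where q: "q \<in> polys_over (A i)" "coeff q 0 \<noteq> 0" "p = monom 1 k * q"
      using poly_split_X_power[OF subA p] by blast
    have qi: "poly q (f i) \<in> poly_fun N"
      using q(1) AP[of "Suc i"] i unfolding AS adjoin_def by auto
    have fk: "f i ^ k \<in> poly_fun N" using is_subringD(7)[OF is_subring_poly_fun f(1)[OF i]] .
    have irr: "zariski_irreducible N (Z (Suc i))" "Z (Suc i) \<subseteq> carrier_vec N"
      using Z[of "Suc i"] i zariski_closed_carrier by auto
    have powa: "(g ^ k) v = g v ^ k" for g :: "'a alg_closure vec \<Rightarrow> 'a alg_closure" and v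
      by (induction k) auto
    have "(f i ^ k) v * poly q (f i) v = 0" if "v \<in> Z (Suc i)" for v
    proof -
      have "poly p (f i) = f i ^ k * poly q (f i)" unfolding q(3) by (simp add: poly_monom)
      hence "poly p (f i) v = (f i ^ k) v * poly q (f i) v" by simp
      thus ?thesis using van that by simp
    qed
    hence "(\<forall>v\<in>Z (Suc i). (f i ^ k) v = 0) \<or> (\<forall>v\<in>Z (Suc i). poly q (f i) v = 0)"
      by (rule zariski_irreducible_prime[OF irr fk qi])
    moreover have "\<not> (\<forall>v\<in>Z (Suc i). (f i ^ k) v = 0)" using f(3)[OF i] unfolding powa by auto
    ultimately have "\<forall>v\<in>Z (Suc i). poly q (f i) v = 0" by blast
    hence z: "\<forall>v\<in>Z i. poly q (f i) v = 0" using strict[OF i] by blast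
    have "coeff q 0 v = 0" if v: "v \<in> Z i" for v
    proof -
      have "poly q (f i) v = poly (map_poly (\<lambda>f. f v) q) 0" unfolding applyp f(2)[OF i v] ..
      also have "\<dots> = coeff q 0 v" by (simp add: poly_0_coeff_0 coeff_map_poly)
      finally show ?thesis using z v by simp
    qed
    hence "coeff q 0 = 0" using q(1) by (intro IH) (auto simp: polys_over_def)
    thus False using q(2) by simp
  qed
  have zero: "a = 0" if "i \<le> r" "a \<in> A i" "\<forall>v\<in>Z i. a v = 0" for i a
    using that
  proof (induction i arbitrary: a)
    case 0
    then obtain c where c: "a = (\<lambda>v. to_ac c)" unfolding A0 by blast
    have "Z 0 \<noteq> {}" using Z(2)[of 0] unfolding zariski_irreducible_def by blast
    then obtain v where v: "v \<in> Z 0" by blast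
    have "a v = 0" using 0(3) v by blast
    hence "c = 0" unfolding c by simp
    thus ?case unfolding c by (simp add: zero_fun_def)
  next
    case (Suc i)
    obtain p where p: "p \<in> polys_over (A i)" "a = poly p (f i)" using Suc.prems unfolding AS adjoin_def by blast
    have "p = 0"
    proof (rule step[of i p])
      show "i < r" using Suc.prems by simp
      show "b = 0" if "b \<in> A i" "\<forall>v\<in>Z i. b v = 0" for b
        by (rule Suc.IH[OF _ that]) (use Suc.prems in simp)
      show "p \<in> polys_over (A i)" by (rule p)
      show "\<forall>v\<in>Z (Suc i). poly p (f i) v = 0" using Suc.prems(3) unfolding p(2) .
    qed
    thus ?case using p by simp
  qed
  have trans: "\<not> algebraic_over (star ` A i) (star (f i))" if i: "i < r" for i
  proof
    assume "algebraic_over (star ` A i) (star (f i))"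
    then obtain P where P: "P \<in> polys_over (star ` A i)" "P \<noteq> 0" "poly P (star (f i)) = 0" unfolding algebraic_over_def by blast
    obtain p where p: "p \<in> polys_over (A i)" "map_poly star p = P" using polys_over_lift[OF subA star P(1)] by blast
    have "star (poly p (f i)) = 0" using ring_homo_poly[OF star, of p "f i"] p P by simp
    moreover have "poly p (f i) \<in> poly_fun N" using p(1) AP[of "Suc i"] i unfolding AS adjoin_def by auto
    ultimately have "\<forall>v\<in>Z (Suc i). poly p (f i) v = 0" using gen Z(3)[of "Suc i"] i by auto
    hence "p = 0" using step[OF i _ p(1)] zero[of i] i by auto
    thus False using p P by simp
  qed
  have Amono: "A i \<subseteq> A (i + j)" for i j
    by (induction j) (auto simp: AS dest: subset_adjoin[OF subA, THEN subsetD])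
  have fA: "f j \<in> A i" if "j < i" for i j
  proof -
    have "f j \<in> A (Suc j)" unfolding AS by (rule in_adjoin[OF subA])
    thus ?thesis using Amono[of "Suc j" "i - Suc j"] that by auto
  qed
  have "\<exists>d. is_deriv d \<and> (\<forall>a\<in>star ` A i. d a = 0) \<and> d (star (f i)) = 1" if "i < r" for i
    by (rule transcendental_deriv[OF is_subring_image[OF subA star] trans[OF that]])
  then obtain e where e: "\<And>i. i < r \<Longrightarrow> is_deriv (e i)" "\<And>i a. i < r \<Longrightarrow> a \<in> A i \<Longrightarrow> e i (star a) = 0"
    "\<And>i. i < r \<Longrightarrow> e i (star (f i)) = 1" by (metis image_eqI)
  let ?k = "range (\<lambda>c. star (\<lambda>v. to_ac c))"
  have ek: "e i \<in> der_over ?k" if "i < r" for i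
  proof -
    have "(\<lambda>v. to_ac c) \<in> A i" for c using Amono[of 0 i] unfolding A0 by auto
    thus ?thesis unfolding der_over_def using e[OF that] by auto
  qed
  have ind: "\<forall>i<r. a i = 0" if a: "\<And>d. d \<in> der_over ?k \<Longrightarrow> (\<Sum>i<r. a i * d (star (f i))) = 0" for a
  proof (rule ccontr)
    assume "\<not> (\<forall>i<r. a i = 0)"
    then obtain i where i: "i < r" "a i \<noteq> 0" "\<And>j. j < r \<Longrightarrow> a j \<noteq> 0 \<Longrightarrow> j \<le> i"
      using Nat.ex_has_greatest_nat[of "\<lambda>i. i < r \<and> a i \<noteq> 0" _ r] by (metis less_imp_le)
    have "(\<Sum>j<r. a j * e i (star (f j))) = (\<Sum>j\<in>{i}. a j * e i (star (f j)))"
    proof (rule sum.mono_neutral_right)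
      show "\<forall>j\<in>{..<r} - {i}. a j * e i (star (f j)) = 0"
      proof
        fix j assume j: "j \<in> {..<r} - {i}"
        show "a j * e i (star (f j)) = 0"
        proof (cases "j < i")
          case True thus ?thesis using e(2)[OF i(1) fA] by simp
        next
          case False hence "a j = 0" using i(3)[of j] j by auto
          thus ?thesis by simp
        qed
      qed
    qed (use i in auto)
    also have "\<dots> = a i" using e(3)[OF i(1)] by simp
    finally show False using a[OF ek[OF i(1)]] i by simp
  qed
  have "\<exists>d. \<forall>l<r. d l \<in> der_over ?k \<and> (\<forall>i<r. d l (star (f i)) = (if i = l then 1 else 0))"
    by (rule dual_vectors[OF linset_der_over linfun_apply ind])
  then obtain \<delta> where "\<forall>l<r. \<delta> l \<in> der_over ?k \<and> (\<forall>i<r. \<delta> l (star (f i)) = (if i = l then 1 else 0))" by (elim exE)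
  thus ?thesis using f(1) by (intro exI[of _ f] exI[of _ \<delta>]) auto
qed

section \<open>Ultrafilters\<close>

text \<open>
  Filters as families of sets, so that Zorn's lemma for inclusion applies directly.
\<close>
definition set_filter :: "'i set set \<Rightarrow> bool" where
  "set_filter \<F> \<longleftrightarrow> {} \<notin> \<F> \<and> (\<forall>A\<in>\<F>. \<forall>B\<in>\<F>. A \<inter> B \<in> \<F>) \<and> (\<forall>A\<in>\<F>. \<forall>B. A \<subseteq> B \<longrightarrow> B \<in> \<F>)"

lemma set_filterD:
  assumes "set_filter \<F>"
  shows "{} \<notin> \<F>" "A \<in> \<F> \<Longrightarrow> B \<in> \<F> \<Longrightarrow> A \<inter> B \<in> \<F>" "A \<in> \<F> \<Longrightarrow> A \<subseteq> B \<Longrightarrow> B \<in> \<F>"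
  using assms unfolding set_filter_def by blast+

lemma set_filter_adjoin:
  assumes F: "set_filter \<F>" and S: "\<And>A. A \<in> \<F> \<Longrightarrow> A \<inter> S \<noteq> {}"
  shows "set_filter {B. \<exists>A\<in>\<F>. A \<inter> S \<subseteq> B}"
  unfolding set_filter_def
proof (intro conjI ballI allI impI)
  show "{} \<notin> {B. \<exists>A\<in>\<F>. A \<inter> S \<subseteq> B}" using S by blast
next
  fix B B' assume "B \<in> {B. \<exists>A\<in>\<F>. A \<inter> S \<subseteq> B}" "B' \<in> {B. \<exists>A\<in>\<F>. A \<inter> S \<subseteq> B}"
  then obtain A A' where "A \<in> \<F>" "A \<inter> S \<subseteq> B" "A' \<in> \<F>" "A' \<inter> S \<subseteq> B'" by blast
  moreover from this have "A \<inter> A' \<in> \<F>" using set_filterD(2)[OF F] by blast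
  ultimately show "B \<inter> B' \<in> {B. \<exists>A\<in>\<F>. A \<inter> S \<subseteq> B}" by blast
qed blast

lemma ultrafilter_exists:
  assumes fip: "\<And>\<S>. finite \<S> \<Longrightarrow> \<S> \<subseteq> \<B> \<Longrightarrow> \<Inter>\<S> \<noteq> {}"
  shows "\<exists>\<U>. set_filter \<U> \<and> \<B> \<subseteq> \<U> \<and> (\<forall>A. A \<in> \<U> \<or> - A \<in> \<U>)"
proof -
  let ?A = "{\<F>. set_filter \<F> \<and> \<B> \<subseteq> \<F>}"
  have "\<exists>M\<in>?A. \<forall>Y\<in>?A. M \<subseteq> Y \<longrightarrow> Y = M"
  proof (rule subset_Zorn_nonempty)
    have "set_filter {A. \<exists>\<S>. finite \<S> \<and> \<S> \<subseteq> \<B> \<and> \<Inter>\<S> \<subseteq> A}"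
      unfolding set_filter_def
    proof (intro conjI ballI allI impI)
      show "{} \<notin> {A. \<exists>\<S>. finite \<S> \<and> \<S> \<subseteq> \<B> \<and> \<Inter>\<S> \<subseteq> A}" using fip by blast
    next
      fix A B assume "A \<in> {A. \<exists>\<S>. finite \<S> \<and> \<S> \<subseteq> \<B> \<and> \<Inter>\<S> \<subseteq> A}" "B \<in> {A. \<exists>\<S>. finite \<S> \<and> \<S> \<subseteq> \<B> \<and> \<Inter>\<S> \<subseteq> A}"
      then obtain S T where "finite S" "S \<subseteq> \<B>" "\<Inter>S \<subseteq> A" "finite T" "T \<subseteq> \<B>" "\<Inter>T \<subseteq> B" by blast
      hence "finite (S \<union> T) \<and> S \<union> T \<subseteq> \<B> \<and> \<Inter>(S \<union> T) \<subseteq> A \<inter> B" by auto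
      thus "A \<inter> B \<in> {A. \<exists>\<S>. finite \<S> \<and> \<S> \<subseteq> \<B> \<and> \<Inter>\<S> \<subseteq> A}" by blast
    qed blast
    moreover have "\<B> \<subseteq> {A. \<exists>\<S>. finite \<S> \<and> \<S> \<subseteq> \<B> \<and> \<Inter>\<S> \<subseteq> A}"
    proof
      fix A assume "A \<in> \<B>"
      hence "finite {A} \<and> {A} \<subseteq> \<B> \<and> \<Inter>{A} \<subseteq> A" by simp
      thus "A \<in> {A. \<exists>\<S>. finite \<S> \<and> \<S> \<subseteq> \<B> \<and> \<Inter>\<S> \<subseteq> A}" by blast
    qed
    ultimately show "?A \<noteq> {}" by blast
  next
    fix C assume C: "C \<noteq> {}" "subset.chain ?A C"
    have CA: "set_filter \<F>" "\<B> \<subseteq> \<F>" if "\<F> \<in> C" for \<F> using C(2) that unfolding subset.chain_def by auto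
    have "set_filter (\<Union>C)"
      unfolding set_filter_def
    proof (intro conjI ballI allI impI)
      show "{} \<notin> \<Union>C" using CA(1) set_filterD(1) by blast
    next
      fix A B assume "A \<in> \<Union>C" "B \<in> \<Union>C"
      then obtain F G where FG: "F \<in> C" "A \<in> F" "G \<in> C" "B \<in> G" by blast
      have "F \<subseteq> G \<or> G \<subseteq> F" using C(2) FG unfolding subset_chain_def by blast
      then obtain H where "H \<in> C" "A \<in> H" "B \<in> H" using FG by blast
      thus "A \<inter> B \<in> \<Union>C" using set_filterD(2)[OF CA(1)] by blast
    next
      fix A B assume "A \<in> \<Union>C" "A \<subseteq> B"
      thus "B \<in> \<Union>C" using set_filterD(3)[OF CA(1)] by blast
    qed
    moreover have "\<B> \<subseteq> \<Union>C" using C(1) CA(2) by blast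
    ultimately show "\<Union>C \<in> ?A" by blast
  qed
  then obtain \<U> where UA: "\<U> \<in> ?A" and max: "\<forall>Y\<in>?A. \<U> \<subseteq> Y \<longrightarrow> Y = \<U>" by (elim bexE)
  have U: "set_filter \<U>" "\<B> \<subseteq> \<U>" using UA by auto
  have "A \<in> \<U> \<or> - A \<in> \<U>" for A
  proof (rule ccontr)
    assume no: "\<not> ?thesis"
    have ne: "\<U> \<noteq> {}"
    proof
      assume "\<U> = {}"
      hence "\<B> = {}" using U by blast
      hence "{UNIV} \<in> ?A" by (auto simp: set_filter_def)
      thus False using max \<open>\<U> = {}\<close> by blast
    qed
    have "B \<inter> A \<noteq> {}" if B: "B \<in> \<U>" for B
    proof
      assume "B \<inter> A = {}"
      hence "B \<subseteq> - A" by blast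
      thus False using set_filterD(3)[OF U(1) B] no by blast
    qed
    hence E: "set_filter {B. \<exists>D\<in>\<U>. D \<inter> A \<subseteq> B}" by (rule set_filter_adjoin[OF U(1)])
    have sub: "\<U> \<subseteq> {B. \<exists>D\<in>\<U>. D \<inter> A \<subseteq> B}" by blast
    hence "{B. \<exists>D\<in>\<U>. D \<inter> A \<subseteq> B} \<in> ?A" using E U(2) by blast
    hence "{B. \<exists>D\<in>\<U>. D \<inter> A \<subseteq> B} = \<U>" using max sub by simp
    moreover have "A \<in> {B. \<exists>D\<in>\<U>. D \<inter> A \<subseteq> B}" using ne by blast
    ultimately show False using no by simp
  qed
  thus ?thesis using U by blast
qed

section \<open>A field with generic points of all irreducible sets\<close>

text \<open>
  A type cannot depend on the variety \<open>V\<close>. The index set of the ultrapower therefore consists of functions that pick a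
  point for every pair of a dimension and a set at once, and the ultrafilter makes all these picks generic simultaneously.
\<close>
type_synonym 'a choice = "nat \<times> 'a alg_closure vec set \<Rightarrow> 'a alg_closure vec"

definition irreducible_space :: "nat \<times> 'a::field_char_0 alg_closure vec set \<Rightarrow> bool" where
  "irreducible_space s \<longleftrightarrow> zariski_irreducible (fst s) (snd s) \<and> snd s \<subseteq> carrier_vec (fst s)"

text \<open>
  The conditions for the point picked in the irreducible set \<open>snd s\<close> to be generic.
\<close>
definition generic_sets :: "'a::field_char_0 choice set set" where
  "generic_sets = {S. \<exists>s f. irreducible_space s \<and> f \<in> poly_fun (fst s) \<and> (\<exists>v\<in>snd s. f v \<noteq> 0) \<and>
     S = {p. p s \<in> snd s \<and> f (p s) \<noteq> 0}}"

lemma irreducible_common_nonzero: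
  assumes s: "irreducible_space s" and "finite I"
    and "\<And>i. i \<in> I \<Longrightarrow> f i \<in> poly_fun (fst s) \<and> (\<exists>v\<in>snd s. f i v \<noteq> 0)"
  shows "\<exists>v\<in>snd s. \<forall>i\<in>I. f i v \<noteq> 0"
proof -
  have "(\<Prod>i\<in>I. f i) \<in> poly_fun (fst s) \<and> (\<exists>v\<in>snd s. (\<Prod>i\<in>I. f i) v \<noteq> 0)"
    using assms(2,3)
  proof (induction I rule: finite_induct)
    case empty
    have "snd s \<noteq> {}" using s unfolding irreducible_space_def zariski_irreducible_def by blast
    moreover have "(1 :: 'a alg_closure vec \<Rightarrow> 'a alg_closure) \<in> poly_fun (fst s)"
      by (rule is_subringD(2)[OF is_subring_poly_fun])
    ultimately show ?case unfolding prod.empty by (metis one_fun_apply zero_neq_one ex_in_conv)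
  next
    case (insert i I)
    have 1: "f i \<in> poly_fun (fst s)" "\<exists>v\<in>snd s. f i v \<noteq> 0" using insert.prems by auto
    have 2: "(\<Prod>i\<in>I. f i) \<in> poly_fun (fst s)" "\<exists>v\<in>snd s. (\<Prod>i\<in>I. f i) v \<noteq> 0" using insert by auto
    have "\<exists>v\<in>snd s. f i v * (\<Prod>i\<in>I. f i) v \<noteq> 0"
      using zariski_irreducible_prime[OF _ _ 1(1) 2(1), of "snd s"] s 1(2) 2(2) unfolding irreducible_space_def by blast
    hence "\<exists>v\<in>snd s. (f i * prod f I) v \<noteq> 0" by simp
    thus ?case unfolding prod.insert[OF insert(1,2)] using poly_fun.mult[OF 1(1) 2(1)] by (rule conjI[rotated])
  qed
  then obtain v where v: "v \<in> snd s" "(\<Prod>i\<in>I. f i) v \<noteq> 0" by blast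
  have "(\<Prod>i\<in>J. f i) v = (\<Prod>i\<in>J. f i v)" for J by (rule ring_homoD(9)[OF ring_homo_apply])
  thus ?thesis using v assms(2) by auto
qed

text \<open>
  Conditions at different spaces are independent of each other, and finitely many nonempty open subsets of one irreducible
  space have a common point.
\<close>
lemma generic_sets_fip:
  assumes "finite \<S>" "\<S> \<subseteq> (generic_sets :: 'a::field_char_0 choice set set)"
  shows "\<Inter>\<S> \<noteq> {}"
proof -
  define W where "W S sf \<longleftrightarrow> irreducible_space (fst sf) \<and> snd sf \<in> poly_fun (fst (fst sf)) \<and> (\<exists>v\<in>snd (fst sf). snd sf v \<noteq> 0) \<and>
     S = {p. p (fst sf) \<in> snd (fst sf) \<and> snd sf (p (fst sf)) \<noteq> 0}"
    for S and sf :: "(nat \<times> 'a alg_closure vec set) \<times> ('a alg_closure vec \<Rightarrow> 'a alg_closure)"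
  have "\<exists>sf. W S sf" if SS: "S \<in> \<S>" for S
  proof -
    obtain s f where "irreducible_space s \<and> f \<in> poly_fun (fst s) \<and> (\<exists>v\<in>snd s. f v \<noteq> 0) \<and>
       S = {p. p s \<in> snd s \<and> f (p s) \<noteq> 0}"
      using subsetD[OF assms(2) SS] unfolding generic_sets_def mem_Collect_eq by (elim exE)
    hence "W S (s, f)" unfolding W_def by simp
    thus ?thesis by (rule exI[of _ "(s, f)"])
  qed
  hence "\<forall>S\<in>\<S>. \<exists>sf. W S sf" by blast
  from bchoice[OF this] obtain sf where sfW: "\<forall>S\<in>\<S>. W S (sf S)" by (elim exE)
  have sf: "irreducible_space (fst (sf S))"
    "snd (sf S) \<in> poly_fun (fst (fst (sf S))) \<and> (\<exists>v\<in>snd (fst (sf S)). snd (sf S) v \<noteq> 0)"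
    "S = {p. p (fst (sf S)) \<in> snd (fst (sf S)) \<and> snd (sf S) (p (fst (sf S))) \<noteq> 0}" if "S \<in> \<S>" for S
    using bspec[OF sfW that] unfolding W_def by simp_all
  define Q where "Q s v \<longleftrightarrow> v \<in> snd s \<and> (\<forall>S\<in>\<S>. fst (sf S) = s \<longrightarrow> snd (sf S) v \<noteq> 0)" for s v
  have ex: "\<exists>v. Q s v" if "irreducible_space s" for s
    using irreducible_common_nonzero[OF that, of "{S \<in> \<S>. fst (sf S) = s}" "\<lambda>S. snd (sf S)"] assms(1) sf(2)
    unfolding Q_def by auto
  define p where "p s = (SOME v. Q s v)" for s
  have "Q (fst (sf S)) (p (fst (sf S)))" if "S \<in> \<S>" for S
    unfolding p_def using someI_ex[OF ex[OF sf(1)[OF that]]] .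
  hence "p (fst (sf S)) \<in> snd (fst (sf S)) \<and> snd (sf S) (p (fst (sf S))) \<noteq> 0" if "S \<in> \<S>" for S
    using that unfolding Q_def by blast
  hence "p \<in> S" if "S \<in> \<S>" for S using sf(3)[OF that] that by blast
  thus ?thesis by blast
qed

definition ultra :: "'a::field_char_0 choice set set" where
  "ultra = (SOME \<U>. set_filter \<U> \<and> generic_sets \<subseteq> \<U> \<and> (\<forall>A. A \<in> \<U> \<or> - A \<in> \<U>))"

lemma ultra:
  fixes A :: "'a::field_char_0 choice set"
  shows "set_filter (ultra :: 'a choice set set)" "generic_sets \<subseteq> (ultra :: 'a choice set set)" "A \<in> ultra \<or> - A \<in> ultra"
proof -
  have "set_filter (ultra :: 'a choice set set) \<and> generic_sets \<subseteq> (ultra :: 'a choice set set) \<and>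
      (\<forall>A :: 'a choice set. A \<in> ultra \<or> - A \<in> ultra)"
    unfolding ultra_def by (rule someI_ex[OF ultrafilter_exists[OF generic_sets_fip]])
  thus "set_filter (ultra :: 'a choice set set)" "generic_sets \<subseteq> (ultra :: 'a choice set set)" "A \<in> ultra \<or> - A \<in> ultra"
    by simp_all
qed

lemma empty_ultra [simp]: "{} \<notin> ultra"
  by (rule set_filterD(1)[OF ultra(1)])

lemma UNIV_ultra [simp]: "UNIV \<in> ultra"
  using ultra(3)[of UNIV] by auto

lemma ultra_mono: "A \<in> ultra \<Longrightarrow> A \<subseteq> B \<Longrightarrow> B \<in> ultra"
  by (rule set_filterD(3)[OF ultra(1)])

lemma ultra_mono2: "A \<in> ultra \<Longrightarrow> B \<in> ultra \<Longrightarrow> A \<inter> B \<subseteq> C \<Longrightarrow> C \<in> ultra"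
  using set_filterD(2)[OF ultra(1), of A B] ultra_mono by blast

definition ultra_eq :: "('a::field_char_0 choice \<Rightarrow> 'a alg_closure) \<Rightarrow> ('a choice \<Rightarrow> 'a alg_closure) \<Rightarrow> bool" where
  "ultra_eq f g \<longleftrightarrow> {p. f p = g p} \<in> ultra"

quotient_type (overloaded) 'a ultrapower = "'a::field_char_0 choice \<Rightarrow> 'a alg_closure" / ultra_eq
proof (rule equivpI)
  show "reflp (ultra_eq :: ('a choice \<Rightarrow> 'a alg_closure) \<Rightarrow> _)"
    by (rule reflpI) (simp add: ultra_eq_def UNIV_ultra)
  show "symp (ultra_eq :: ('a choice \<Rightarrow> 'a alg_closure) \<Rightarrow> _)"
    by (rule sympI) (simp add: ultra_eq_def eq_commute)
  show "transp (ultra_eq :: ('a choice \<Rightarrow> 'a alg_closure) \<Rightarrow> _)"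
  proof (rule transpI)
    fix f g h :: "'a choice \<Rightarrow> 'a alg_closure" assume "ultra_eq f g" "ultra_eq g h"
    thus "ultra_eq f h" unfolding ultra_eq_def by (rule ultra_mono2) auto
  qed
qed

instantiation ultrapower :: (field_char_0) field
begin

lift_definition zero_ultrapower :: "'a ultrapower" is "\<lambda>p. 0" .
lift_definition one_ultrapower :: "'a ultrapower" is "\<lambda>p. 1" .
lift_definition plus_ultrapower :: "'a ultrapower \<Rightarrow> 'a ultrapower \<Rightarrow> 'a ultrapower" is "\<lambda>f g p. f p + g p"
  unfolding ultra_eq_def by (erule (1) ultra_mono2) auto
lift_definition minus_ultrapower :: "'a ultrapower \<Rightarrow> 'a ultrapower \<Rightarrow> 'a ultrapower" is "\<lambda>f g p. f p - g p"
  unfolding ultra_eq_def by (erule (1) ultra_mono2) auto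
lift_definition times_ultrapower :: "'a ultrapower \<Rightarrow> 'a ultrapower \<Rightarrow> 'a ultrapower" is "\<lambda>f g p. f p * g p"
  unfolding ultra_eq_def by (erule (1) ultra_mono2) auto
lift_definition divide_ultrapower :: "'a ultrapower \<Rightarrow> 'a ultrapower \<Rightarrow> 'a ultrapower" is "\<lambda>f g p. f p / g p"
  unfolding ultra_eq_def by (erule (1) ultra_mono2) auto
lift_definition uminus_ultrapower :: "'a ultrapower \<Rightarrow> 'a ultrapower" is "\<lambda>f p. - f p"
  unfolding ultra_eq_def by (erule ultra_mono) auto
lift_definition inverse_ultrapower :: "'a ultrapower \<Rightarrow> 'a ultrapower" is "\<lambda>f p. inverse (f p)"
  unfolding ultra_eq_def by (erule ultra_mono) auto

instance
proof standard
  fix a b c :: "'a ultrapower"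
  show "a + b + c = a + (b + c)" by transfer (simp add: ultra_eq_def UNIV_ultra add.assoc)
  show "a + b = b + a" by transfer (simp add: ultra_eq_def UNIV_ultra add.commute)
  show "0 + a = a" by transfer (simp add: ultra_eq_def UNIV_ultra)
  show "- a + a = 0" by transfer (simp add: ultra_eq_def UNIV_ultra)
  show "a - b = a + - b" by transfer (simp add: ultra_eq_def UNIV_ultra)
  show "a * b * c = a * (b * c)" by transfer (simp add: ultra_eq_def UNIV_ultra mult.assoc)
  show "a * b = b * a" by transfer (simp add: ultra_eq_def UNIV_ultra mult.commute)
  show "1 * a = a" by transfer (simp add: ultra_eq_def UNIV_ultra)
  show "(a + b) * c = a * c + b * c" by transfer (simp add: ultra_eq_def UNIV_ultra distrib_right)
  show "(0::'a ultrapower) \<noteq> 1" by transfer (simp add: ultra_eq_def)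
  show "a div b = a * inverse b" by transfer (simp add: ultra_eq_def UNIV_ultra divide_inverse)
  show "inverse 0 = (0 :: 'a ultrapower)" by transfer (simp add: ultra_eq_def UNIV_ultra)
  show "inverse a * a = 1" if "a \<noteq> 0"
    using that
  proof transfer
    fix f :: "'a choice \<Rightarrow> 'a alg_closure" assume "\<not> ultra_eq f (\<lambda>p. 0)"
    hence "- {p. f p = 0} \<in> ultra" using ultra(3) unfolding ultra_eq_def by blast
    thus "ultra_eq (\<lambda>p. inverse (f p) * f p) (\<lambda>p. 1)" unfolding ultra_eq_def by (rule ultra_mono) auto
  qed
qed

end

lemma ring_homo_abs_ultrapower: "ring_homo (abs_ultrapower :: ('a::field_char_0 choice \<Rightarrow> 'a alg_closure) \<Rightarrow> 'a ultrapower)"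
  unfolding ring_homo_def plus_fun_def times_fun_def one_fun_def
  by (simp add: one_ultrapower_def plus_ultrapower.abs_eq times_ultrapower.abs_eq)

lemma abs_ultrapower_eq_0: "abs_ultrapower f = 0 \<longleftrightarrow> {p. f p = 0} \<in> ultra"
  unfolding zero_ultrapower_def ultrapower.abs_eq_iff ultra_eq_def ..

instance ultrapower :: (field_char_0) field_char_0
proof
  have "(of_nat m :: 'a ultrapower) \<noteq> of_nat n" if "m \<noteq> n" for m n
  proof
    assume "(of_nat m :: 'a ultrapower) = of_nat n"
    hence "abs_ultrapower (of_nat m - of_nat n :: 'a choice \<Rightarrow> 'a alg_closure) = 0"
      by (simp add: ring_homoD[OF ring_homo_abs_ultrapower])
    hence "{p :: 'a choice. (of_nat m - of_nat n :: 'a choice \<Rightarrow> 'a alg_closure) p = 0} \<in> ultra"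
      unfolding abs_ultrapower_eq_0 .
    moreover have "(of_nat k :: 'a choice \<Rightarrow> 'a alg_closure) p = of_nat k" for k p by (induction k) auto
    ultimately show False using that by simp
  qed
  thus "inj (of_nat :: nat \<Rightarrow> 'a ultrapower)" by (auto simp: inj_def)
qed

text \<open>
  The value of the function \<open>f\<close> at the generic point of \<open>snd s\<close>. Since \<open>f\<close> is arbitrary, this is a ring homomorphism
  on the ring of all functions, and it vanishes on a polynomial function \<open>f\<close> iff \<open>f\<close> vanishes on \<open>snd s\<close>. The algebraic
  closure is taken because the Galois argument for residues needs an algebraically closed field.
\<close>
definition generic_value :: "nat \<times> 'a::field_char_0 alg_closure vec set \<Rightarrow> ('a alg_closure vec \<Rightarrow> 'a alg_closure) \<Rightarrow> 'a ultrapower alg_closure" where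
  "generic_value s f = to_ac (abs_ultrapower (\<lambda>p. f (p s)))"

lemma ring_homo_comp: "ring_homo f \<Longrightarrow> ring_homo g \<Longrightarrow> ring_homo (\<lambda>x. f (g x))"
  unfolding ring_homo_def by simp

lemma ring_homo_generic_value: "ring_homo (generic_value s)"
proof -
  have "ring_homo (\<lambda>f (p :: 'a choice). f (p s) :: 'a alg_closure)" by (auto simp: ring_homo_def)
  from ring_homo_comp[OF ring_homo_to_ac ring_homo_comp[OF ring_homo_abs_ultrapower this]]
  show ?thesis unfolding generic_value_def .
qed

lemma generic_value_eq_0:
  assumes s: "irreducible_space s" and van: "\<And>v. v \<in> snd s \<Longrightarrow> f v = 0"
  shows "generic_value s f = 0"
proof -
  have "{p. p s \<in> snd s \<and> (1 :: 'a alg_closure vec \<Rightarrow> 'a alg_closure) (p s) \<noteq> 0} \<in> generic_sets"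
  proof -
    have "snd s \<noteq> {}" using s unfolding irreducible_space_def zariski_irreducible_def by blast
    hence "\<exists>v\<in>snd s. (1 :: 'a alg_closure vec \<Rightarrow> 'a alg_closure) v \<noteq> 0" by auto
    moreover have "(1 :: 'a alg_closure vec \<Rightarrow> 'a alg_closure) \<in> poly_fun (fst s)"
      by (rule is_subringD(2)[OF is_subring_poly_fun])
    ultimately show ?thesis unfolding generic_sets_def using s by blast
  qed
  hence "{p. p s \<in> snd s \<and> (1 :: 'a alg_closure vec \<Rightarrow> 'a alg_closure) (p s) \<noteq> 0} \<in> ultra" using ultra(2) by blast
  hence "{p. f (p s) = 0} \<in> ultra" by (rule ultra_mono) (use van in auto)
  thus ?thesis unfolding generic_value_def by (simp add: abs_ultrapower_eq_0)
qed

lemma generic_value_eq_0_imp: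
  assumes s: "irreducible_space s" and f: "f \<in> poly_fun (fst s)" and z: "generic_value s f = 0" and v: "v \<in> snd s"
  shows "f v = 0"
proof (rule ccontr)
  assume "f v \<noteq> 0"
  hence "{p. p s \<in> snd s \<and> f (p s) \<noteq> 0} \<in> generic_sets" unfolding generic_sets_def using s f v by blast
  hence 1: "{p. p s \<in> snd s \<and> f (p s) \<noteq> 0} \<in> ultra" using ultra(2) by blast
  have "{p. f (p s) = 0} \<in> ultra" using z unfolding generic_value_def by (simp add: abs_ultrapower_eq_0)
  hence "({} :: 'a choice set) \<in> ultra" by (rule ultra_mono2[OF 1]) auto
  thus False by simp
qed

section \<open>Clearing the denominators of a monomial map\<close>

text \<open>
  The negative exponents in a monomial map are compensated by a power of the product of the multiplicative coordinates. So a
  polynomial relation between the coordinates of \<open>[M](v)\<close> amounts to a polynomial relation between those of \<open>v\<close>.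
\<close>
lemma G_map_clear_denominators:
  fixes f :: "'a::field_char_0 alg_closure vec \<Rightarrow> 'a alg_closure"
  assumes f: "f \<in> poly_fun (2 * k)" and M: "M \<in> carrier_mat k n"
  shows "\<exists>g\<in>poly_fun (2 * n). \<exists>e. \<forall>v. (\<forall>j<n. v $ (n + j) \<noteq> 0) \<longrightarrow> g v = f (G_map M v) * (\<Prod>j<n. v $ (n + j)) ^ e"
  using f
proof (induction rule: poly_fun.induct)
  case (const c)
  show ?case by (intro bexI[OF _ poly_fun.const[of c]] exI[of _ 0]) auto
next
  case (coord i)
  note PR = is_subringD[OF is_subring_poly_fun[where 'a = 'a]]
  have dim: "dim_row M = k" "dim_col M = n" using M by auto
  show ?case
  proof (cases "i < k")
    case True
    let ?g = "\<Sum>j<n. (\<lambda>v. to_ac (of_int (M $$ (i, j)))) * (\<lambda>v. v $ j) :: 'a alg_closure vec \<Rightarrow> 'a alg_closure"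
    have "?g \<in> poly_fun (2 * n)" by (intro PR(10) poly_fun.mult poly_fun.const poly_fun.coord) auto
    moreover have "?g v = G_map M v $ i" for v :: "'a alg_closure vec"
      unfolding ring_homoD(8)[OF ring_homo_apply] using True dim by (simp add: G_map_def)
    ultimately show ?thesis by (intro bexI[of _ ?g] exI[of _ 0]) auto
  next
    case False
    define r where "r = i - k"
    define E where "E = (\<Sum>j<n. nat \<bar>M $$ (r, j)\<bar>)"
    let ?g = "\<Prod>j<n. (\<lambda>v. v $ (n + j)) ^ nat (M $$ (r, j) + int E) :: 'a alg_closure vec \<Rightarrow> 'a alg_closure"
    have "?g \<in> poly_fun (2 * n)" by (intro PR(11) PR(7) poly_fun.coord) auto
    moreover have "?g v = G_map M v $ i * (\<Prod>j<n. v $ (n + j)) ^ E" if v: "\<forall>j<n. v $ (n + j) \<noteq> 0" for v :: "'a alg_closure vec"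
    proof -
      have "?g v = (\<Prod>j<n. (v $ (n + j)) ^ nat (M $$ (r, j) + int E))"
        by (simp add: ring_homoD(7,9)[OF ring_homo_apply])
      also have "\<dots> = (\<Prod>j<n. v $ (n + j) powi (M $$ (r, j)) * (v $ (n + j)) ^ E)"
      proof (rule prod.cong)
        fix j assume j: "j \<in> {..<n}"
        have "nat \<bar>M $$ (r, j)\<bar> \<le> E" unfolding E_def using j by (intro member_le_sum) auto
        hence "M $$ (r, j) + int E \<ge> 0" by linarith
        hence "(v $ (n + j)) ^ nat (M $$ (r, j) + int E) = v $ (n + j) powi (M $$ (r, j) + int E)"
          by (simp add: power_int_def)
        also have "\<dots> = v $ (n + j) powi (M $$ (r, j)) * (v $ (n + j)) ^ E"
          using v j by (subst power_int_add) auto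
        finally show "(v $ (n + j)) ^ nat (M $$ (r, j) + int E) = v $ (n + j) powi (M $$ (r, j)) * (v $ (n + j)) ^ E" .
      qed simp
      also have "\<dots> = (\<Prod>j<n. v $ (n + j) powi (M $$ (r, j))) * (\<Prod>j<n. v $ (n + j)) ^ E"
        by (simp add: prod.distrib prod_power_distrib)
      also have "(\<Prod>j<n. v $ (n + j) powi (M $$ (r, j))) = G_map M v $ i"
        using coord False dim by (simp add: G_map_def Let_def r_def)
      finally show ?thesis .
    qed
    ultimately show ?thesis by (intro bexI[of _ ?g] exI[of _ E]) auto
  qed
next
  case (add f f')
  then obtain g e g' e' where g: "g \<in> poly_fun (2 * n)" "\<And>v. \<forall>j<n. v $ (n + j) \<noteq> 0 \<Longrightarrow> g v = f (G_map M v) * (\<Prod>j<n. v $ (n + j)) ^ e"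
    "g' \<in> poly_fun (2 * n)" "\<And>v. \<forall>j<n. v $ (n + j) \<noteq> 0 \<Longrightarrow> g' v = f' (G_map M v) * (\<Prod>j<n. v $ (n + j)) ^ e'" by blast
  note PR = is_subringD[OF is_subring_poly_fun[where 'a = 'a]]
  define Y where "Y = (\<Prod>j<n. (\<lambda>v. v $ (n + j)) :: 'a alg_closure vec \<Rightarrow> 'a alg_closure)"
  have Y: "Y \<in> poly_fun (2 * n)" unfolding Y_def by (intro PR(11) poly_fun.coord) auto
  have Yv: "Y v = (\<Prod>j<n. v $ (n + j))" for v unfolding Y_def by (simp add: ring_homoD(9)[OF ring_homo_apply])
  have pw: "(h ^ i) v = h v ^ i" for h :: "'a alg_closure vec \<Rightarrow> 'a alg_closure" and i v by (rule ring_homoD(7)[OF ring_homo_apply])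
  show ?case
  proof (intro bexI[of _ "g * Y ^ e' + g' * Y ^ e"] exI[of _ "e + e'"] allI impI)
    show "g * Y ^ e' + g' * Y ^ e \<in> poly_fun (2 * n)" by (intro PR(3) PR(4) PR(7) g Y)
    fix v :: "'a alg_closure vec" assume v: "\<forall>j<n. v $ (n + j) \<noteq> 0"
    show "(g * Y ^ e' + g' * Y ^ e) v = (f + f') (G_map M v) * (\<Prod>j<n. v $ (n + j)) ^ (e + e')"
      unfolding plus_fun_apply times_fun_apply pw Yv g(2)[OF v] g(4)[OF v] by (simp add: power_add algebra_simps)
  qed
next
  case (mult f f')
  then obtain g e g' e' where g: "g \<in> poly_fun (2 * n)" "\<And>v. \<forall>j<n. v $ (n + j) \<noteq> 0 \<Longrightarrow> g v = f (G_map M v) * (\<Prod>j<n. v $ (n + j)) ^ e"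
    "g' \<in> poly_fun (2 * n)" "\<And>v. \<forall>j<n. v $ (n + j) \<noteq> 0 \<Longrightarrow> g' v = f' (G_map M v) * (\<Prod>j<n. v $ (n + j)) ^ e'" by blast
  show ?case
  proof (intro bexI[of _ "g * g'"] exI[of _ "e + e'"] allI impI)
    show "g * g' \<in> poly_fun (2 * n)" by (intro poly_fun.mult g)
    fix v :: "'a alg_closure vec" assume v: "\<forall>j<n. v $ (n + j) \<noteq> 0"
    show "(g * g') v = (f * f') (G_map M v) * (\<Prod>j<n. v $ (n + j)) ^ (e + e')"
      unfolding times_fun_apply g(2)[OF v] g(4)[OF v] by (simp add: power_add algebra_simps)
  qed
qed

text \<open>
  The pivot columns form a diagonal minor with nonzero determinant.
\<close>
lemma diag_family_rank:
  assumes dg: "diag_family n u \<mu> \<pi>"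
  shows "u \<le> int_mat_rank (mat u n (\<lambda>(j, i). \<mu> j i))"
proof -
  let ?M = "mat u n (\<lambda>(j, i). \<mu> j i)"
  define A where "A = map_mat rat_of_int ?M"
  define B where "B = mat u u (\<lambda>(j, l). rat_of_int (\<mu> j (\<pi> l)))"
  have A: "A \<in> carrier_mat u n" and B: "B \<in> carrier_mat u u" by (auto simp: A_def B_def)
  have "det B = prod_list (diag_mat B)"
    by (rule det_lower_triangular[OF _ B]) (use dg in \<open>auto simp: B_def diag_family_def\<close>)
  also have "\<dots> \<noteq> 0" using dg unfolding diag_family_def by (auto simp: diag_mat_def B_def prod_list_zero_iff)
  finally have "det B \<noteq> 0" .
  hence rB: "vec_space.rank u B = u" by (rule vec_space.low_rank_det_zero[OF B])
  have dist: "distinct (cols B)" using vec_space.non_distinct_low_rank[OF B] rB by fastforce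
  have sub: "set (cols B) \<subseteq> set (cols A)"
  proof
    fix c assume "c \<in> set (cols B)"
    then obtain l where l: "l < u" "c = col B l" using B by (auto simp: cols_def)
    have p: "\<pi> l < n" using dg l unfolding diag_family_def by blast
    have "c = col A (\<pi> l)" unfolding l(2) using l p by (intro eq_vecI) (auto simp: A_def B_def)
    thus "c \<in> set (cols A)" using p A by (auto simp: cols_def)
  qed
  have "card (set (cols B)) \<le> vec_space.rank u A"
    by (rule vec_space.rank_ge_card_indpt[OF A sub vec_space.full_rank_lin_indpt[OF B rB dist]])
  hence "u \<le> vec_space.rank u A" using dist B by (simp add: distinct_card)
  thus ?thesis unfolding int_mat_rank_def A_def by simp
qed

section \<open>Subfields of small cardinality\<close>

context
  includes cardinal_syntax
begin

text \<open>
  The closure of \<open>A\<close> under countably many operations is a countable union of stages, each of which is no larger than the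
  infinite type \<open>'a\<close>.
\<close>
lemma small_closure:
  fixes ops :: "nat \<Rightarrow> 'b \<Rightarrow> 'b \<Rightarrow> 'b" and A :: "'b set"
  assumes inf: "infinite (UNIV :: 'a set)" and A: "|A| \<le>o |UNIV :: 'a set|"
  obtains K where "A \<subseteq> K" "\<And>i a b. a \<in> K \<Longrightarrow> b \<in> K \<Longrightarrow> ops i a b \<in> K" "|K| \<le>o |UNIV :: 'a set|"
    "\<And>M. A \<subseteq> M \<Longrightarrow> (\<And>i a b. a \<in> M \<Longrightarrow> b \<in> M \<Longrightarrow> ops i a b \<in> M) \<Longrightarrow> K \<subseteq> M"
proof -
  define stage where "stage = rec_nat A (\<lambda>_ B. B \<union> (\<Union>i. \<Union>a\<in>B. \<Union>b\<in>B. {ops i a b}))"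
  have s0: "stage 0 = A" and sS: "stage (Suc s) = stage s \<union> (\<Union>i. \<Union>a\<in>stage s. \<Union>b\<in>stage s. {ops i a b})" for s
    unfolding stage_def by simp_all
  have mono: "stage s \<subseteq> stage (s + t)" for s t by (induction t) (auto simp: sS)
  have nat: "|UNIV :: nat set| \<le>o |UNIV :: 'a set|" using inf by (simp add: infinite_iff_card_of_nat)
  have card: "|stage s| \<le>o |UNIV :: 'a set|" for s
  proof (induction s)
    case 0 show ?case unfolding s0 by (rule A)
  next
    case (Suc s)
    have "|\<Union>i. \<Union>a\<in>stage s. \<Union>b\<in>stage s. {ops i a b}| \<le>o |UNIV :: 'a set|"
      by (intro card_of_UNION_ordLeq_infinite[OF inf] ballI nat Suc card_of_singl_ordLeq) simp
    thus ?case unfolding sS using inf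
      by (intro card_of_Un_ordLeq_infinite_Field Suc card_of_Card_order) (simp_all add: Field_card_of)
  qed
  define K where "K = (\<Union>s. stage s)"
  have closed: "ops i a b \<in> K" if ab: "a \<in> K" "b \<in> K" for i a b
  proof -
    obtain s t where "a \<in> stage s" "b \<in> stage t" using ab unfolding K_def by blast
    hence "a \<in> stage (s + t)" "b \<in> stage (s + t)" using mono[of s t] mono[of t s] by (auto simp: add.commute)
    hence "ops i a b \<in> stage (Suc (s + t))" unfolding sS by blast
    thus ?thesis unfolding K_def by blast
  qed
  have least: "K \<subseteq> M" if M: "A \<subseteq> M" "\<And>i a b. a \<in> M \<Longrightarrow> b \<in> M \<Longrightarrow> ops i a b \<in> M" for M
  proof -
    have "stage s \<subseteq> M" for s
    proof (induction s)
      case (Suc s)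
      have "ops i a b \<in> M" if "a \<in> stage s" "b \<in> stage s" for i a b using M(2) Suc that by blast
      thus ?case unfolding sS using Suc by blast
    qed (use M(1) s0 in simp)
    thus ?thesis unfolding K_def by blast
  qed
  have "|K| \<le>o |UNIV :: 'a set|" unfolding K_def
    by (intro card_of_UNION_ordLeq_infinite[OF inf] ballI nat card)
  moreover have "A \<subseteq> K" unfolding K_def using s0 by blast
  ultimately show thesis using that closed least by blast
qed

end

section \<open>Transport of a field to another type\<close>

definition transported :: "('b \<Rightarrow> 'a) \<Rightarrow> 'b::field set \<Rightarrow> 'a ring" where
  "transported g K = \<lparr> carrier = g ` K, monoid.mult = (\<lambda>a b. g (inv_into K g a * inv_into K g b)),
     one = g 1, ring.zero = g 0, add = (\<lambda>a b. g (inv_into K g a + inv_into K g b)) \<rparr>"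

context
  fixes g :: "'b::field_char_0 \<Rightarrow> 'a" and K :: "'b set"
  assumes K: "is_subfield K" and g: "inj_on g K"
begin

lemma transported_inv [simp]: "a \<in> K \<Longrightarrow> inv_into K g (g a) = a"
  using g by (rule inv_into_f_f)

lemma transported_ops:
  "carrier (transported g K) = g ` K" "\<one>\<^bsub>transported g K\<^esub> = g 1" "\<zero>\<^bsub>transported g K\<^esub> = g 0"
  "a \<in> K \<Longrightarrow> b \<in> K \<Longrightarrow> g a \<oplus>\<^bsub>transported g K\<^esub> g b = g (a + b)"
  "a \<in> K \<Longrightarrow> b \<in> K \<Longrightarrow> g a \<otimes>\<^bsub>transported g K\<^esub> g b = g (a * b)"
  by (simp_all add: transported_def)

lemma transported_eq_iff: "a \<in> K \<Longrightarrow> b \<in> K \<Longrightarrow> g a = g b \<longleftrightarrow> a = b"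
  using g by (auto dest: inj_onD)

lemma field_transported: "field (transported g K)"
proof -
  note KR = is_subringD[OF is_subfield_subring[OF K]]
  have "cring (transported g K)"
  proof (rule cringI)
    show "abelian_group (transported g K)"
    proof (rule abelian_groupI)
      fix a assume "a \<in> carrier (transported g K)"
      then obtain x where "x \<in> K" "a = g x" by (auto simp: transported_ops)
      thus "\<exists>b\<in>carrier (transported g K). b \<oplus>\<^bsub>transported g K\<^esub> a = \<zero>\<^bsub>transported g K\<^esub>"
        using KR(5)[of x] by (intro bexI[of _ "g (- x)"]) (auto simp: transported_ops)
    qed (use KR in \<open>auto simp: transported_ops add_ac\<close>)
    show "comm_monoid (transported g K)"
      by (rule comm_monoidI) (use KR in \<open>auto simp: transported_ops mult_ac\<close>)
  qed (use KR in \<open>auto simp: transported_ops distrib_right\<close>)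
  then interpret R: cring "transported g K" .
  show ?thesis
  proof (rule R.field_intro2)
    show "\<zero>\<^bsub>transported g K\<^esub> \<noteq> \<one>\<^bsub>transported g K\<^esub>" using KR by (simp add: transported_ops transported_eq_iff)
    fix a assume a: "a \<in> carrier (transported g K) - {\<zero>\<^bsub>transported g K\<^esub>}"
    then obtain x where x: "x \<in> K" "a = g x" "x \<noteq> 0" by (auto simp: transported_ops)
    have i: "inverse x \<in> K" using is_subfield_inverse[OF K x(1)] .
    show "a \<in> Units (transported g K)" unfolding Units_def
      using x i by (auto simp: transported_ops intro!: bexI[of _ "inverse x"])
  qed
qed

lemma transported_finsum:
  assumes "\<And>i. i \<in> A \<Longrightarrow> f i \<in> K"
  shows "finsum (transported g K) (\<lambda>i. g (f i)) A = g (\<Sum>i\<in>A. f i)"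
proof -
  interpret R: field "transported g K" by (rule field_transported)
  note KR = is_subringD[OF is_subfield_subring[OF K]]
  show ?thesis using assms
  proof (induction A rule: infinite_finite_induct)
    case (infinite A) thus ?case by (simp add: R.finsum_infinite transported_ops)
  next
    case empty show ?case by (simp add: transported_ops)
  next
    case (insert i A)
    have "finsum (transported g K) (\<lambda>i. g (f i)) (insert i A) = g (f i) \<oplus>\<^bsub>transported g K\<^esub> finsum (transported g K) (\<lambda>i. g (f i)) A"
      using insert by (intro R.finsum_insert) (auto simp: transported_ops)
    also have "\<dots> = g (f i + (\<Sum>i\<in>A. f i))"
      using insert KR(10)[of A f] by (simp add: transported_ops)
    finally show ?case using insert by simp
  qed
qed

lemma transported_finprod:
  assumes "\<And>i. i \<in> A \<Longrightarrow> f i \<in> K"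
  shows "finprod (transported g K) (\<lambda>i. g (f i)) A = g (\<Prod>i\<in>A. f i)"
proof -
  interpret R: field "transported g K" by (rule field_transported)
  note KR = is_subringD[OF is_subfield_subring[OF K]]
  show ?thesis using assms
  proof (induction A rule: infinite_finite_induct)
    case (infinite A) thus ?case by (simp add: R.finprod_infinite transported_ops)
  next
    case empty show ?case by (simp add: transported_ops)
  next
    case (insert i A)
    have "finprod (transported g K) (\<lambda>i. g (f i)) (insert i A) = g (f i) \<otimes>\<^bsub>transported g K\<^esub> finprod (transported g K) (\<lambda>i. g (f i)) A"
      using insert by (intro R.finprod_insert) (auto simp: transported_ops)
    also have "\<dots> = g (f i * (\<Prod>i\<in>A. f i))"
      using insert KR(11)[of A f] by (simp add: transported_ops)
    finally show ?case using insert by simp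
  qed
qed

lemma transported_nat_pow: "a \<in> K \<Longrightarrow> g a [^]\<^bsub>transported g K\<^esub> (n::nat) = g (a ^ n)"
proof -
  assume a: "a \<in> K"
  interpret R: field "transported g K" by (rule field_transported)
  note KR = is_subringD[OF is_subfield_subring[OF K]]
  show ?thesis
  proof (induction n)
    case (Suc n)
    thus ?case using a KR(7)[OF a, of n] by (simp add: R.nat_pow_Suc transported_ops mult.commute)
  qed (simp add: transported_ops)
qed

lemma transported_mpol_eval:
  assumes h: "\<And>c. h c \<in> K" and a: "\<And>v. a v \<in> K" and b: "\<And>v. v \<in> mpol_vars p \<Longrightarrow> b v = g (a v)"
  shows "mpol_eval (transported g K) (\<lambda>c. g (h c)) p b = g (ev h p a)"
proof -
  interpret R: field "transported g K" by (rule field_transported)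
  note KR = is_subringD[OF is_subfield_subring[OF K]]
  have m: "mono_val t a \<in> K" for t unfolding mono_val_def by (intro KR(11) KR(7) a)
  have P: "finprod (transported g K) (\<lambda>v. b v [^]\<^bsub>transported g K\<^esub> Poly_Mapping.lookup t v) (Poly_Mapping.keys t) = g (mono_val t a)"
    if t: "t \<in> Poly_Mapping.keys p" for t
  proof -
    have bt: "b v [^]\<^bsub>transported g K\<^esub> Poly_Mapping.lookup t v = g (a v ^ Poly_Mapping.lookup t v)" if "v \<in> Poly_Mapping.keys t" for v
    proof -
      have "b v = g (a v)" using b t that unfolding mpol_vars_def by blast
      thus ?thesis using transported_nat_pow[OF a] by simp
    qed
    have "finprod (transported g K) (\<lambda>v. b v [^]\<^bsub>transported g K\<^esub> Poly_Mapping.lookup t v) (Poly_Mapping.keys t) =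
        finprod (transported g K) (\<lambda>v. g (a v ^ Poly_Mapping.lookup t v)) (Poly_Mapping.keys t)"
      by (rule R.finprod_cong') (use bt KR(7)[OF a] in \<open>auto simp: transported_ops\<close>)
    also have "\<dots> = g (mono_val t a)" unfolding mono_val_def by (intro transported_finprod KR(7) a)
    finally show ?thesis .
  qed
  have "mpol_eval (transported g K) (\<lambda>c. g (h c)) p b =
      finsum (transported g K) (\<lambda>t. g (h (Poly_Mapping.lookup p t) * mono_val t a)) (Poly_Mapping.keys p)"
    unfolding mpol_eval_def
    by (rule R.finsum_cong') (use P KR(4) h m in \<open>auto simp: transported_ops\<close>)
  also have "\<dots> = g (ev h p a)" unfolding ev_def by (intro transported_finsum KR(4) h m)
  finally show ?thesis .
qed

lemma transported_char_0: "(n::nat) > 0 \<Longrightarrow> [n] \<cdot>\<^bsub>transported g K\<^esub> \<one>\<^bsub>transported g K\<^esub> \<noteq> \<zero>\<^bsub>transported g K\<^esub>"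
proof -
  interpret R: field "transported g K" by (rule field_transported)
  note KR = is_subringD[OF is_subfield_subring[OF K]]
  have "[n] \<cdot>\<^bsub>transported g K\<^esub> \<one>\<^bsub>transported g K\<^esub> = g (of_nat n)" for n :: nat
  proof (induction n)
    case (Suc n)
    have "[Suc n] \<cdot>\<^bsub>transported g K\<^esub> \<one>\<^bsub>transported g K\<^esub> = [n] \<cdot>\<^bsub>transported g K\<^esub> \<one>\<^bsub>transported g K\<^esub> \<oplus>\<^bsub>transported g K\<^esub> \<one>\<^bsub>transported g K\<^esub>"
      by (rule R.add.nat_pow_Suc)
    thus ?case unfolding Suc using KR(2) KR(8)[of n] by (simp add: transported_ops add.commute)
  qed (simp add: transported_ops)
  moreover assume "n > 0"
  ultimately show ?thesis using KR(1) KR(8)[of n] by (simp add: transported_ops transported_eq_iff)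
qed

lemma transported_diff_field_ext:
  fixes D :: "nat \<Rightarrow> 'c::field_char_0 \<Rightarrow> 'c" and E :: "nat \<Rightarrow> 'b \<Rightarrow> 'b" and h :: "'c \<Rightarrow> 'b"
  assumes D: "diff_field m (ring_of_type_algebra :: 'c ring) D"
    and E: "\<And>s. s < m \<Longrightarrow> is_deriv (E s)" "\<And>s a. s < m \<Longrightarrow> a \<in> K \<Longrightarrow> E s a \<in> K"
    and comm: "\<And>s t a. s < m \<Longrightarrow> t < m \<Longrightarrow> a \<in> K \<Longrightarrow> E s (E t a) = E t (E s a)"
    and h: "ring_homo h" "\<And>c. h c \<in> K" and Eh: "\<And>s c. s < m \<Longrightarrow> E s (h c) = h (D s c)"
  shows "diff_field_ext m ring_of_type_algebra D (transported g K) (\<lambda>s a. g (E s (inv_into K g a))) (\<lambda>c. g (h c))"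
proof -
  note KR = is_subringD[OF is_subfield_subring[OF K]]
  have "derivation (transported g K) (\<lambda>a. g (E s (inv_into K g a)))" if s: "s < m" for s
    unfolding derivation_def
    using E(2)[OF s] KR(3,4) by (auto simp: transported_ops is_derivD[OF E(1)[OF s]])
  hence "diff_field m (transported g K) (\<lambda>s a. g (E s (inv_into K g a)))"
    unfolding diff_field_def using field_transported transported_char_0 E(2) comm
    by (auto simp: transported_ops)
  moreover have "(\<lambda>c. g (h c)) \<in> Ring.ring_hom ring_of_type_algebra (transported g K)"
    by (rule ring_hom_memI) (use h in \<open>auto simp: transported_ops ring_of_type_algebra_def ring_homoD[OF h(1)]\<close>)
  ultimately show ?thesis unfolding diff_field_ext_def using D E(2) h(2) Eh by simp
qed

end

section \<open>The generic point of a rotund variety\<close>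

lemma generic_value_inverse: "generic_value s (\<lambda>v. inverse (f v)) = inverse (generic_value s f)"
  unfolding generic_value_def by (simp add: inverse_ultrapower.abs_eq[symmetric])

lemma generic_value_powi: "generic_value s (\<lambda>v. f v powi k) = generic_value s f powi k"
proof -
  have pw: "generic_value s (\<lambda>v. f v ^ m) = generic_value s f ^ m" for f m
  proof -
    have "(\<lambda>v. f v ^ m) = f ^ m" by (rule ext) (simp add: ring_homoD(7)[OF ring_homo_apply])
    thus ?thesis by (simp add: ring_homoD(7)[OF ring_homo_generic_value])
  qed
  show ?thesis unfolding power_int_def by (simp add: pw generic_value_inverse)
qed

lemma generic_value_sum: "generic_value s (\<lambda>v. \<Sum>i\<in>I. f i v) = (\<Sum>i\<in>I. generic_value s (f i))"
proof -
  have "(\<lambda>v. \<Sum>i\<in>I. f i v) = (\<Sum>i\<in>I. f i)" by (rule ext) (simp add: ring_homoD(8)[OF ring_homo_apply])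
  thus ?thesis by (simp add: ring_homoD(8)[OF ring_homo_generic_value])
qed

lemma generic_value_prod: "generic_value s (\<lambda>v. \<Prod>i\<in>I. f i v) = (\<Prod>i\<in>I. generic_value s (f i))"
proof -
  have "(\<lambda>v. \<Prod>i\<in>I. f i v) = (\<Prod>i\<in>I. f i)" by (rule ext) (simp add: ring_homoD(9)[OF ring_homo_apply])
  thus ?thesis by (simp add: ring_homoD(9)[OF ring_homo_generic_value])
qed

lemma generic_value_mult: "generic_value s (\<lambda>v. f v * g v) = generic_value s f * generic_value s g"
  using ring_homoD(4)[OF ring_homo_generic_value, of s f g] by (simp add: times_fun_def)

lemma generic_value_of_int: "generic_value s (\<lambda>v. of_int k) = of_int k"
proof -
  have "(\<lambda>v. of_int k) = (of_int k :: 'a alg_closure vec \<Rightarrow> 'a alg_closure)"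
    by (rule ext) (simp add: ring_homoD(11)[OF ring_homo_apply])
  thus ?thesis by (simp add: ring_homoD(11)[OF ring_homo_generic_value])
qed

definition const_emb :: "nat \<times> 'a::field_char_0 alg_closure vec set \<Rightarrow> 'a \<Rightarrow> 'a ultrapower alg_closure" where
  "const_emb s c = generic_value s (\<lambda>v. to_ac c)"

lemma ring_homo_const_emb: "ring_homo (const_emb s)"
proof -
  have "ring_homo (\<lambda>c (v :: 'a alg_closure vec). to_ac c)" by (auto simp: ring_homo_def)
  from ring_homo_comp[OF ring_homo_generic_value this] show ?thesis unfolding const_emb_def .
qed

lemma generic_value_ev:
  "generic_value s (\<lambda>v. ev to_ac p (\<lambda>i. v $ i)) = ev (const_emb s) p (\<lambda>i. generic_value s (\<lambda>v. v $ i))"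
proof -
  have "(\<lambda>v :: 'a alg_closure vec. ev to_ac p (\<lambda>i. v $ i)) = ev (\<lambda>c v. to_ac c) p (\<lambda>i v. v $ i)"
    by (rule ext) (simp add: ev_hom[OF ring_homo_apply])
  thus ?thesis unfolding const_emb_def by (simp add: ev_hom[OF ring_homo_generic_value])
qed

text \<open>
  Rotundity applied to the matrix with rows \<open>\<mu>\<close>, whose rank is at least \<open>u\<close>. The functions obtained from a chain in the closure
  of the image are polynomials in \<open>[\<mu>](x, y)\<close>, so a derivation killing the latter kills their values.
\<close>
lemma rotund_transcendence:
  fixes V :: "'a::field_char_0 alg_closure vec set"
  assumes V: "rotund n V" and u: "u \<ge> 1" and dg: "diag_family n u \<mu> \<pi>"
  defines "s \<equiv> (2 * n, V)"
  defines "x \<equiv> \<lambda>i. generic_value s (\<lambda>v. v $ i)" and "y \<equiv> \<lambda>i. generic_value s (\<lambda>v. v $ (n + i))"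
  shows "\<exists>c \<delta>.
      (\<forall>d\<in>der_over (range (const_emb s)). (\<forall>j<u. d (\<Sum>i<n. of_int (\<mu> j i) * x i) = 0 \<and> d (\<Prod>i<n. y i powi \<mu> j i) = 0) \<longrightarrow>
          (\<forall>j<u. d (c j) = 0)) \<and>
      (\<forall>l<u. \<delta> l \<in> der_over (range (const_emb s)) \<and> (\<forall>j<u. \<delta> l (c j) = (if j = l then 1 else 0)))"
proof -
  have un: "u \<le> n" by (rule diag_family_bound[OF dg])
  define M where "M = mat u n (\<lambda>(j, i). \<mu> j i)"
  have M: "M \<in> carrier_mat u n" by (simp add: M_def)
  have GV: "G_variety n V" and irr: "zariski_irreducible (2 * n) V" using V unfolding rotund_def by blast+
  have VG: "V \<subseteq> carrier_vec (2 * n)" "\<And>v j. v \<in> V \<Longrightarrow> j < n \<Longrightarrow> v $ (n + j) \<noteq> 0"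
    using GV unfolding G_variety_def G_points_def by (auto simp: ring_of_type_algebra_def)
  have s: "irreducible_space s" unfolding irreducible_space_def s_def using irr VG by simp
  let ?W = "zariski_closure (2 * u) (G_map M ` V)"
  have "enat u \<le> enat (int_mat_rank M)" using diag_family_rank[OF dg] unfolding M_def by simp
  also have "\<dots> \<le> zariski_dim (2 * u) ?W" using V u un M unfolding rotund_def by blast
  finally have dim: "zariski_dim (2 * u) ?W \<ge> enat u" .
  define star where "star f = generic_value s (\<lambda>v. f (G_map M v))" for f :: "'a alg_closure vec \<Rightarrow> 'a alg_closure"
  have star: "ring_homo star"
  proof -
    have "ring_homo (\<lambda>f (v :: 'a alg_closure vec). f (G_map M v) :: 'a alg_closure)" by (auto simp: ring_homo_def)
    from ring_homo_comp[OF ring_homo_generic_value this] show ?thesis unfolding star_def .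
  qed
  have gen: "f w = 0" if f: "f \<in> poly_fun (2 * u)" and z: "star f = 0" and w: "w \<in> ?W" for f w
  proof -
    obtain g e where g: "g \<in> poly_fun (2 * n)"
      "\<And>v. \<forall>j<n. v $ (n + j) \<noteq> 0 \<Longrightarrow> g v = f (G_map M v) * (\<Prod>j<n. v $ (n + j)) ^ e"
      using G_map_clear_denominators[OF f M] by blast
    \<comment> \<open>\<open>q\<close> agrees with the polynomial function \<open>g\<close> on \<open>V\<close>, which is all that matters for the generic value.\<close>
    define q where "q = (\<lambda>v :: 'a alg_closure vec. f (G_map M v) * (\<Prod>j<n. v $ (n + j)) ^ e)"
    have "generic_value s (g - q) = 0" by (rule generic_value_eq_0[OF s]) (use g(2) VG(2) in \<open>auto simp: q_def s_def\<close>)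
    moreover have "generic_value s q = 0" unfolding q_def generic_value_mult using z unfolding star_def by simp
    ultimately have "generic_value s g = 0" by (simp add: ring_homoD(6)[OF ring_homo_generic_value])
    hence "g v = 0" if "v \<in> V" for v using generic_value_eq_0_imp[OF s, of g v] g(1) that by (simp add: s_def)
    hence fv: "f (G_map M v) = 0" if "v \<in> V" for v using g(2)[of v] VG(2) that by auto
    show ?thesis
      by (rule zariski_closure_vanish[OF f _ _ w]) (use fv in \<open>auto simp: G_map_def Let_def M_def\<close>)
  qed
  have "\<exists>f \<delta>. (\<forall>j<u. f j \<in> poly_fun (2 * u)) \<and>
    (\<forall>l<u. \<delta> l \<in> der_over (range (\<lambda>c. star (\<lambda>v. to_ac c))) \<and> (\<forall>j<u. \<delta> l (star (f j)) = (if j = l then 1 else 0)))"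
    by (rule chain_derivations[OF dim u star]) (rule gen)
  then obtain f \<delta> where f: "\<forall>j<u. f j \<in> poly_fun (2 * u)" and
    \<delta>: "\<forall>l<u. \<delta> l \<in> der_over (range (\<lambda>c. star (\<lambda>v. to_ac c))) \<and> (\<forall>j<u. \<delta> l (star (f j)) = (if j = l then 1 else 0))"
    by (elim exE conjE)
  have range: "range (\<lambda>c. star (\<lambda>v. to_ac c)) = range (const_emb s)" unfolding star_def const_emb_def ..
  have kill: "d (star h) = 0" if d: "d \<in> der_over (range (const_emb s))"
    "\<forall>j<u. d (\<Sum>i<n. of_int (\<mu> j i) * x i) = 0 \<and> d (\<Prod>i<n. y i powi \<mu> j i) = 0"
    and h: "h \<in> poly_fun (2 * u)" for d h
    using h
  proof (induction rule: poly_fun.induct)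
    case (const c)
    have "star (\<lambda>v. to_ac c) \<in> range (const_emb s)" using range by blast
    thus ?case using d(1) unfolding der_over_def by blast
  next
    case (coord i)
    show ?case
    proof (cases "i < u")
      case True
      have "star (\<lambda>v. v $ i) = generic_value s (\<lambda>v. \<Sum>j<n. of_int (\<mu> i j) * v $ j)"
        unfolding star_def G_map_def M_def using True by (simp add: Let_def)
      also have "\<dots> = (\<Sum>j<n. of_int (\<mu> i j) * x j)"
        unfolding generic_value_sum generic_value_mult generic_value_of_int x_def ..
      finally show ?thesis using d(2) True by simp
    next
      case False
      hence iu: "i - u < u" using coord by simp
      have "star (\<lambda>v. v $ i) = generic_value s (\<lambda>v. \<Prod>j<n. v $ (n + j) powi \<mu> (i - u) j)"
        unfolding star_def G_map_def M_def using False coord iu by (simp add: Let_def)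
      also have "\<dots> = (\<Prod>j<n. y j powi \<mu> (i - u) j)"
        unfolding generic_value_prod generic_value_powi y_def ..
      finally show ?thesis using d(2) iu by simp
    qed
  next
    case (add g h)
    have "is_deriv d" using d(1) unfolding der_over_def by blast
    thus ?case unfolding ring_homoD(3)[OF star] using add by (simp add: is_derivD(1))
  next
    case (mult g h)
    have "is_deriv d" using d(1) unfolding der_over_def by blast
    thus ?case unfolding ring_homoD(4)[OF star] using mult by (simp add: is_derivD(2))
  qed
  show ?thesis
    by (rule exI[of _ "\<lambda>j. star (f j)"], rule exI[of _ \<delta>]) (use \<delta> range kill f in simp)
qed

text \<open>
  The derivations of \<open>F\<close> are first extended to the large field in an arbitrary way; neither the exponential equations nor
  commutativity are expected from these extensions.
\<close>
theorem rotund_exp_point: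
  fixes D :: "nat \<Rightarrow> 'a::field_char_0 \<Rightarrow> 'a" and V :: "'a alg_closure vec set"
  assumes D: "diff_field m (ring_of_type_algebra :: 'a ring) D" and V: "rotund n V"
  obtains h :: "'a \<Rightarrow> 'a ultrapower alg_closure" and x y :: "nat \<Rightarrow> 'a ultrapower alg_closure" and E M
  where "ring_homo h" "is_subfield M" "range h \<subseteq> M" "\<And>i. i < n \<Longrightarrow> x i \<in> M \<and> y i \<in> M"
    "\<And>i. i < n \<Longrightarrow> y i \<noteq> 0"
    "\<And>p. p \<in> vanishing_ideal (2 * n) V \<Longrightarrow> ev h p (\<lambda>i. if i < n then x i else y (i - n)) = 0"
    "\<And>s. s < m \<Longrightarrow> is_deriv (E s)" "\<And>s c. s < m \<Longrightarrow> E s (h c) = h (D s c)"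
    "\<And>s i. s < m \<Longrightarrow> i < n \<Longrightarrow> E s (y i) = y i * E s (x i)"
    "\<And>s a. s < m \<Longrightarrow> a \<in> M \<Longrightarrow> E s a \<in> M"
    "\<And>s t a. s < m \<Longrightarrow> t < m \<Longrightarrow> a \<in> M \<Longrightarrow> E s (E t a) = E t (E s a)"
proof -
  define sp where "sp = (2 * n, V)"
  define h where "h = const_emb sp"
  define x where "x i = generic_value sp (\<lambda>v. v $ i)" for i
  define y where "y i = generic_value sp (\<lambda>v. v $ (n + i))" for i
  have GV: "G_variety n V" and irr: "zariski_irreducible (2 * n) V" using V unfolding rotund_def by blast+
  have VG: "V \<subseteq> carrier_vec (2 * n)" "\<And>v j. v \<in> V \<Longrightarrow> j < n \<Longrightarrow> v $ (n + j) \<noteq> 0"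
    using GV unfolding G_variety_def G_points_def by (auto simp: ring_of_type_algebra_def)
  have sp: "irreducible_space sp" unfolding irreducible_space_def sp_def using irr VG by simp
  have h: "ring_homo h" unfolding h_def by (rule ring_homo_const_emb)
  have y0: "y i \<noteq> 0" if i: "i < n" for i
  proof
    assume "y i = 0"
    hence z: "generic_value sp (\<lambda>v. v $ (n + i)) = 0" unfolding y_def .
    obtain v where v: "v \<in> V" using irr unfolding zariski_irreducible_def by blast
    have "v $ (n + i) = 0"
      using generic_value_eq_0_imp[OF sp _ z, of v] poly_fun.coord[of "n + i" "2 * n"] i v by (simp add: sp_def)
    thus False using VG(2)[OF v i] by simp
  qed
  define k where "k = range h"
  have injh: "inj h"
  proof (rule injI)
    fix a b assume "h a = h b"
    hence "h (a - b) = 0" by (simp add: ring_homoD(6)[OF h])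
    thus "a = b" using ring_homo_inverse(3)[OF h] by simp
  qed
  have k: "is_subfield k"
  proof (rule is_subfieldI_inverse)
    have "is_subring (UNIV :: 'a set)" by (simp add: is_subring_def)
    thus "is_subring k" unfolding k_def by (rule is_subring_image[OF _ h])
    fix a assume "a \<in> k"
    then obtain c where "a = h c" unfolding k_def by blast
    hence "inverse a = h (inverse c)" by (simp add: ring_homo_inverse(1)[OF h])
    thus "inverse a \<in> k" unfolding k_def by blast
  qed
  have Ds: "D s (a + b) = D s a + D s b" "D s (a * b) = a * D s b + b * D s a" if "s < m" for s a b
    using D that unfolding diff_field_def derivation_def by (auto simp: ring_of_type_algebra_def)
  have Dcomm: "D s (D t a) = D t (D s a)" if "s < m" "t < m" for s t a
    using D that unfolding diff_field_def by (auto simp: ring_of_type_algebra_def)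
  have "\<exists>d. is_deriv d \<and> (\<forall>c. d (h c) = h (D s c))" if s: "s < m" for s
  proof -
    have "\<exists>d. is_deriv d \<and> (\<forall>a\<in>k. d a = h (D s (inv_into UNIV h a)))"
    proof (rule deriv_extension[OF k])
      fix a b assume "a \<in> k" "b \<in> k"
      then obtain a' b' where ab: "a = h a'" "b = h b'" unfolding k_def by blast
      have e: "a + b = h (a' + b')" "a * b = h (a' * b')" using ab by (simp_all add: ring_homoD[OF h])
      show "h (D s (inv_into UNIV h (a + b))) = h (D s (inv_into UNIV h a)) + h (D s (inv_into UNIV h b))"
        "h (D s (inv_into UNIV h (a * b))) = a * h (D s (inv_into UNIV h b)) + b * h (D s (inv_into UNIV h a))"
        unfolding e inv_into_f_f[OF injh UNIV_I] Ds[OF s]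
        unfolding ab inv_into_f_f[OF injh UNIV_I] by (simp_all add: ring_homoD[OF h])
    qed
    then obtain d where "is_deriv d" "\<forall>a\<in>k. d a = h (D s (inv_into UNIV h a))" by blast
    thus ?thesis by (intro exI[of _ d]) (auto simp: k_def inv_into_f_f[OF injh])
  qed
  hence "\<forall>s\<in>{..<m}. \<exists>d. is_deriv d \<and> (\<forall>c. d (h c) = h (D s c))" by simp
  from bchoice[OF this] obtain Dt where Dt0: "\<forall>s\<in>{..<m}. is_deriv (Dt s) \<and> (\<forall>c. Dt s (h c) = h (D s c))" by (elim exE)
  have Dt: "is_deriv (Dt s)" "\<And>c. Dt s (h c) = h (D s c)" if "s < m" for s using Dt0 that by auto
  have ind: "\<forall>i<n. f i = 0" if "\<And>d. d \<in> der_over k \<Longrightarrow> (\<Sum>i<n. f i * exp_form x y i d) = 0" for f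
  proof (rule ax_independence[OF y0 _ that])
    fix u \<mu> \<pi> assume "u \<ge> 1" "diag_family n u \<mu> \<pi>"
    from rotund_transcendence[OF V this]
    show "\<exists>c \<delta>.
      (\<forall>d\<in>der_over k. (\<forall>j<u. d (\<Sum>i<n. of_int (\<mu> j i) * x i) = 0 \<and> d (\<Prod>i<n. y i powi \<mu> j i) = 0) \<longrightarrow>
          (\<forall>j<u. d (c j) = 0)) \<and>
      (\<forall>l<u. \<delta> l \<in> der_over k \<and> (\<forall>j<u. \<delta> l (c j) = (if j = l then 1 else 0)))"
      unfolding k_def h_def x_def y_def sp_def .
  qed
  obtain E M where EM: "is_subfield M" "k \<subseteq> M" "\<And>i. i < n \<Longrightarrow> x i \<in> M \<and> y i \<in> M"
    "\<And>s. s < m \<Longrightarrow> is_deriv (E s)" "\<And>s c. s < m \<Longrightarrow> c \<in> k \<Longrightarrow> E s c = Dt s c"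
    "\<And>s i. s < m \<Longrightarrow> i < n \<Longrightarrow> E s (y i) = y i * E s (x i)"
    "\<And>s a. s < m \<Longrightarrow> a \<in> M \<Longrightarrow> E s a \<in> M"
    "\<And>s t a. s < m \<Longrightarrow> t < m \<Longrightarrow> a \<in> M \<Longrightarrow> E s (E t a) = E t (E s a)"
  proof (rule commuting_exp_derivations[where k = k and D = Dt and m = m and n = n and x = x and y = y])
    show "y i \<noteq> 0" if "i < n" for i by (rule y0[OF that])
    show "\<forall>i<n. f i = 0" if "\<And>d. d \<in> der_over k \<Longrightarrow> (\<Sum>i<n. f i * exp_form x y i d) = 0" for f
      by (rule ind[OF that])
    show "is_deriv (Dt s)" if "s < m" for s by (rule Dt(1)[OF that])
    show "Dt s c \<in> k" if "s < m" "c \<in> k" for s c using that Dt(2) unfolding k_def by auto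
    show "Dt s (Dt t c) = Dt t (Dt s c)" if "s < m" "t < m" "c \<in> k" for s t c
      using that Dt(2) Dcomm unfolding k_def by auto
  qed blast
  have van: "ev h p (\<lambda>i. if i < n then x i else y (i - n)) = 0" if p: "p \<in> vanishing_ideal (2 * n) V" for p
  proof -
    have "ev h p (\<lambda>i. if i < n then x i else y (i - n)) = ev h p (\<lambda>i. generic_value sp (\<lambda>v. v $ i))"
      by (rule ev_cong) (simp add: x_def y_def)
    also have "\<dots> = generic_value sp (\<lambda>v. ev to_ac p (\<lambda>i. v $ i))" unfolding h_def by (rule generic_value_ev[symmetric])
    also have "\<dots> = 0"
      by (rule generic_value_eq_0[OF sp]) (use p in \<open>simp add: vanishing_ideal_def mpol_eval_type_algebra sp_def\<close>)
    finally show ?thesis .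
  qed
  have Eh: "E s (h c) = h (D s c)" if "s < m" for s c using EM(5)[OF that, of "h c"] Dt(2)[OF that] unfolding k_def by simp
  show thesis
    by (rule that[OF h EM(1) EM(2)[unfolded k_def] EM(3) y0 van EM(4) Eh EM(6-8)])
qed

section \<open>Differential polynomials\<close>

lemma mono_val_0 [simp]: "mono_val 0 a = 1"
  by (simp add: mono_val_def)

lemma mono_val_single [simp]: "mono_val (Poly_Mapping.single v k) a = a v ^ k"
  by (simp add: mono_val_def)

lemma mono_val_sum: "mono_val (\<Sum>i\<in>I. t i) a = (\<Prod>i\<in>I. mono_val (t i) a)"
  by (induction I rule: infinite_finite_induct) (auto simp: mono_val_add)

text \<open>
  An ordinary polynomial, considered as a differential polynomial of order \<open>0\<close>.
\<close>
definition order_zero :: "(nat, 'a::comm_ring_1) mpol \<Rightarrow> (nat \<times> (nat \<Rightarrow> nat), 'a) mpol" where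
  "order_zero p = (\<Sum>t\<in>Poly_Mapping.keys p.
     Poly_Mapping.single (\<Sum>v\<in>Poly_Mapping.keys t. Poly_Mapping.single (v, \<lambda>_. 0) (Poly_Mapping.lookup t v)) (Poly_Mapping.lookup p t))"

lemma ev_order_zero:
  assumes h: "ring_homo h" shows "ev h (order_zero p) a = ev h p (\<lambda>j. a (j, \<lambda>_. 0))"
  unfolding order_zero_def ev_sum[OF h] ev_single[OF h] mono_val_sum mono_val_single
  by (simp add: ev_def mono_val_def)

definition unit_order :: "nat \<Rightarrow> nat \<Rightarrow> nat" where
  "unit_order s = (\<lambda>k. if k = s then 1 else 0)"

text \<open>
  The differential polynomial \<open>D\<^sub>s y\<^sub>i - y\<^sub>i D\<^sub>s x\<^sub>i\<close>.
\<close>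
definition exp_diff_pol :: "nat \<Rightarrow> nat \<Rightarrow> nat \<Rightarrow> (nat \<times> (nat \<Rightarrow> nat), 'a::comm_ring_1) mpol" where
  "exp_diff_pol n i s = Poly_Mapping.single (Poly_Mapping.single (n + i, unit_order s) 1) 1 +
     Poly_Mapping.single (Poly_Mapping.single (n + i, \<lambda>_. 0) 1 + Poly_Mapping.single (i, unit_order s) 1) (- 1)"

lemma ev_exp_diff_pol:
  assumes h: "ring_homo h"
  shows "ev h (exp_diff_pol n i s) a = a (n + i, unit_order s) - a (n + i, \<lambda>_. 0) * a (i, unit_order s)"
  unfolding exp_diff_pol_def ev_add[OF h] ev_single[OF h] mono_val_add mono_val_single
  by (simp add: ring_homoD[OF h])

lemma foldr_deriv_zero:
  "(\<And>k. k \<in> set ks \<Longrightarrow> e k = 0) \<Longrightarrow> foldr (\<lambda>k f. (E k ^^ e k) \<circ> f) ks id = id"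
  by (induction ks) auto

lemma deriv_op_zero: "deriv_op m E (\<lambda>_. 0) = id"
  unfolding deriv_op_def by (rule foldr_deriv_zero) simp

lemma foldr_deriv_unit:
  "distinct ks \<Longrightarrow> s \<in> set ks \<Longrightarrow> foldr (\<lambda>k f. (E k ^^ unit_order s k) \<circ> f) ks id = E s"
proof (induction ks)
  case (Cons k ks)
  show ?case
  proof (cases "k = s")
    case True
    hence "foldr (\<lambda>k f. (E k ^^ unit_order s k) \<circ> f) ks id = id"
      using Cons.prems by (intro foldr_deriv_zero) (auto simp: unit_order_def)
    moreover have "unit_order s k = Suc 0" using True by (simp add: unit_order_def)
    ultimately show ?thesis unfolding foldr.simps comp_apply[where x = id] using True by simp
  next
    case False
    hence "foldr (\<lambda>k f. (E k ^^ unit_order s k) \<circ> f) ks id = E s"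
      using Cons.prems by (intro Cons.IH) auto
    moreover have "unit_order s k = 0" using False by (simp add: unit_order_def)
    ultimately show ?thesis unfolding foldr.simps comp_apply[where x = id] by simp
  qed
qed simp

lemma deriv_op_unit: "s < m \<Longrightarrow> deriv_op m E (unit_order s) = E s"
  unfolding deriv_op_def by (rule foldr_deriv_unit) auto

lemma deriv_op_transported:
  assumes g: "inj_on g K" and E: "\<And>s a. s < m \<Longrightarrow> a \<in> K \<Longrightarrow> E s a \<in> K" and a: "a \<in> K"
  shows "deriv_op m E e a \<in> K \<and> deriv_op m (\<lambda>s a. g (E s (inv_into K g a))) e (g a) = g (deriv_op m E e a)"
proof -
  let ?E = "\<lambda>s a. g (E s (inv_into K g a))"
  have pow: "(E s ^^ j) b \<in> K \<and> (?E s ^^ j) (g b) = g ((E s ^^ j) b)" if "s < m" "b \<in> K" for s j b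
    by (induction j) (use that E g in auto)
  have "foldr (\<lambda>k f. (E k ^^ e k) \<circ> f) ks id a \<in> K \<and>
      foldr (\<lambda>k f. (?E k ^^ e k) \<circ> f) ks id (g a) = g (foldr (\<lambda>k f. (E k ^^ e k) \<circ> f) ks id a)"
    if "set ks \<subseteq> {..<m}" for ks
    using that by (induction ks) (use a pow in auto)
  thus ?thesis unfolding deriv_op_def by (simp add: lessThan_atLeast0)
qed

section \<open>Solutions in differential field extensions\<close>

context
  includes cardinal_syntax
begin

lemma small_image_union_finite:
  assumes "infinite (UNIV :: 'a set)" "finite F"
  shows "|range (h :: 'a \<Rightarrow> 'b) \<union> F| \<le>o |UNIV :: 'a set|"
proof -
  obtain T :: "'a set" where "finite T" "card T = card F" using infinite_arbitrarily_large[OF assms(1)] by blast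
  then obtain f where "bij_betw f F T" using finite_same_card_bij[OF assms(2)] by metis
  hence "inj_on f F \<and> f ` F \<subseteq> UNIV" by (simp add: bij_betw_def)
  hence "|F| \<le>o |UNIV :: 'a set|" unfolding card_of_ordLeq[symmetric] by blast
  thus ?thesis using assms(1)
    by (intro card_of_Un_ordLeq_infinite_Field card_of_image card_of_Card_order) (simp_all add: Field_card_of)
qed

text \<open>
  The five kinds of operations are coded by one sequence of binary operations, unary ones ignoring the second argument;
  the derivation \<open>E s\<close> has code \<open>s + 4\<close>.
\<close>
lemma small_differential_subfield:
  fixes h :: "'a::field_char_0 \<Rightarrow> 'b::field_char_0" and E :: "nat \<Rightarrow> 'b \<Rightarrow> 'b" and m :: nat
  assumes h: "ring_homo h" and F: "finite F"
    and M: "is_subfield M" "range h \<subseteq> M" "F \<subseteq> M" "\<And>s a. s < m \<Longrightarrow> a \<in> M \<Longrightarrow> E s a \<in> M"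
  obtains K and g :: "'b \<Rightarrow> 'a" where "is_subfield K" "range h \<subseteq> K" "F \<subseteq> K" "K \<subseteq> M"
    "\<And>s a. s < m \<Longrightarrow> a \<in> K \<Longrightarrow> E s a \<in> K" "inj_on g K"
proof -
  define ops where "ops i a b = (if i = 0 then a + b else if i = 1 then a * b else if i = 2 then - a
      else if i = 3 then inverse a else if i - 4 < m then E (i - 4) a else a)" for i :: nat and a b
  note MR = is_subringD[OF is_subfield_subring[OF M(1)]]
  have opM: "ops i a b \<in> M" if "a \<in> M" "b \<in> M" for i a b
    unfolding ops_def using that MR(3,4,5) is_subfield_inverse[OF M(1)] M(4) by auto
  obtain K where K: "range h \<union> F \<subseteq> K" "\<And>i a b. a \<in> K \<Longrightarrow> b \<in> K \<Longrightarrow> ops i a b \<in> K" "|K| \<le>o |UNIV :: 'a set|"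
    "\<And>M. range h \<union> F \<subseteq> M \<Longrightarrow> (\<And>i a b. a \<in> M \<Longrightarrow> b \<in> M \<Longrightarrow> ops i a b \<in> M) \<Longrightarrow> K \<subseteq> M"
    using small_closure[OF infinite_UNIV_char_0 small_image_union_finite[OF infinite_UNIV_char_0 F, of h], of ops] by blast
  have "1 \<in> K" using K(1) ring_homoD(2)[OF h] by (metis UnCI range_eqI subsetD)
  moreover have "a + b \<in> K" "a * b \<in> K" "- a \<in> K" "inverse a \<in> K" if "a \<in> K" "b \<in> K" for a b
    using K(2)[OF that, of 0] K(2)[OF that, of 1] K(2)[OF that, of 2] K(2)[OF that, of 3] by (simp_all add: ops_def)
  ultimately have "is_subfield K" by (intro is_subfieldI_inverse) (auto simp: is_subring_def)
  moreover have "E s a \<in> K" if "s < m" "a \<in> K" for s a using K(2)[OF that(2) that(2), of "s + 4"] that(1) by (simp add: ops_def)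
  moreover have "K \<subseteq> M" using K(4)[of M] M(2,3) opM by blast
  moreover obtain g :: "'b \<Rightarrow> 'a" where "inj_on g K" using K(3) unfolding card_of_ordLeq[symmetric] by blast
  ultimately show thesis using that K(1) by blast
qed

end

text \<open>
  The solution constructed in the large field lives in the subfield \<open>M\<close>. It is moved along an injection \<open>g\<close> of a small
  differential subfield \<open>K\<close> to the type of \<open>F\<close>. For differentially closed \<open>F\<close>, only the finitely many
  polynomials defining \<open>V\<close> are put into the system; a solution of these in \<open>F\<close> is a point of \<open>V\<close>, at which the
  whole vanishing ideal vanishes.
\<close>
theorem theorem4p3:
  fixes D :: "nat \<Rightarrow> 'a::field_char_0 \<Rightarrow> 'a"
    and m n :: nat
    and V :: "'a alg_closure vec set"
  assumes "diff_field m (ring_of_type_algebra :: 'a ring) D"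
    and "n \<ge> 1"
    and "rotund n V"
  shows "(\<exists>(K :: 'a ring) E h. diff_field_ext m ring_of_type_algebra D K E h \<and>
            (\<exists>v \<in> K_points n V K h. \<forall>i<n. (v $ i, v $ (n + i)) \<in> Exp m K E)) \<and>
         (differentially_closed m D \<longrightarrow>
            (\<exists>v \<in> K_points n V ring_of_type_algebra id.
               \<forall>i<n. (v $ i, v $ (n + i)) \<in> Exp m ring_of_type_algebra D))"
proof -
  obtain h :: "'a \<Rightarrow> 'a ultrapower alg_closure" and x y :: "nat \<Rightarrow> 'a ultrapower alg_closure" and E M
    where h: "ring_homo h" and M: "is_subfield M" "range h \<subseteq> M" and xyM: "\<And>i. i < n \<Longrightarrow> x i \<in> M \<and> y i \<in> M"
    and y0: "\<And>i. i < n \<Longrightarrow> y i \<noteq> 0"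
    and van: "\<And>p. p \<in> vanishing_ideal (2 * n) V \<Longrightarrow> ev h p (\<lambda>i. if i < n then x i else y (i - n)) = 0"
    and E: "\<And>s. s < m \<Longrightarrow> is_deriv (E s)" "\<And>s c. s < m \<Longrightarrow> E s (h c) = h (D s c)"
    and Ey: "\<And>s i. s < m \<Longrightarrow> i < n \<Longrightarrow> E s (y i) = y i * E s (x i)"
    and EM: "\<And>s a. s < m \<Longrightarrow> a \<in> M \<Longrightarrow> E s a \<in> M"
    and comm: "\<And>s t a. s < m \<Longrightarrow> t < m \<Longrightarrow> a \<in> M \<Longrightarrow> E s (E t a) = E t (E s a)"
    by (rule rotund_exp_point[OF assms(1,3)]) (rule that, assumption+)
  obtain K and g :: "'a ultrapower alg_closure \<Rightarrow> 'a" where K: "is_subfield K" "range h \<subseteq> K"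
    "x ` {..<n} \<union> y ` {..<n} \<subseteq> K" "K \<subseteq> M" "\<And>s a. s < m \<Longrightarrow> a \<in> K \<Longrightarrow> E s a \<in> K" and g: "inj_on g K"
  proof (rule small_differential_subfield[OF h _ M, of "x ` {..<n} \<union> y ` {..<n}" m E])
    show "x ` {..<n} \<union> y ` {..<n} \<subseteq> M" using xyM by auto
  qed (use EM in auto)
  note KR = is_subringD[OF is_subfield_subring[OF K(1)]]
  have hK: "h c \<in> K" for c using K(2) by blast
  have xyK: "x i \<in> K" "y i \<in> K" if "i < n" for i using K(3) that by auto
  define R where "R = transported g K"
  define E' where "E' = (\<lambda>s a. g (E s (inv_into K g a)))"
  define h' where "h' = (\<lambda>c. g (h c))"
  note ops = transported_ops[OF K(1) g, folded R_def]
  have inv [simp]: "inv_into K g (g a) = a" if "a \<in> K" for a using g that by (rule inv_into_f_f)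
  have ext: "diff_field_ext m ring_of_type_algebra D R E' h'"
    unfolding R_def E'_def h'_def
  proof (rule transported_diff_field_ext[where g = g and K = K and D = D and E = E and h = h and m = m])
    show "E s (E t a) = E t (E s a)" if "s < m" "t < m" "a \<in> K" for s t a
      by (rule comm[OF that(1,2) subsetD[OF K(4) that(3)]])
    show "E s (h c) = h (D s c)" if "s < m" for s c by (rule E(2)[OF that])
    show "is_deriv (E s)" if "s < m" for s by (rule E(1)[OF that])
    show "E s a \<in> K" if "s < m" "a \<in> K" for s a by (rule K(5)[OF that])
  qed (rule K(1) g assms(1) h hK)+
  define w where "w j = (if j < n then x j else if j < 2 * n then y (j - n) else 0)" for j
  have wK: "w j \<in> K" for j unfolding w_def using xyK KR(1) by auto
  define v where "v = vec (2 * n) (\<lambda>j. g (w j))"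
  have vj: "v $ j = g (w j)" if "j < 2 * n" for j using that by (simp add: v_def)

  have vK: "v \<in> K_points n V R h'"
    unfolding K_points_def
  proof (intro CollectI conjI ballI)
    show "v \<in> G_points n R"
      unfolding G_points_def
    proof (intro CollectI conjI allI impI)
      show "v \<in> carrier_vec (2 * n)" by (simp add: v_def)
      show "v $ i \<in> carrier R" if "i < 2 * n" for i using that wK by (simp add: vj ops)
      show "v $ (n + i) \<noteq> \<zero>\<^bsub>R\<^esub>" if "i < n" for i
        using that y0[OF that] xyK[OF that] KR(1) g by (auto simp: vj w_def ops dest: inj_onD)
    qed
    fix p assume p: "p \<in> vanishing_ideal (2 * n) V"
    hence pv: "mpol_vars p \<subseteq> {..<2 * n}" unfolding vanishing_ideal_def by blast
    have "mpol_eval R h' p (\<lambda>i. v $ i) = g (ev h p w)"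
      unfolding R_def h'_def by (rule transported_mpol_eval[OF K(1) g hK wK]) (use pv vj in auto)
    also have "ev h p w = ev h p (\<lambda>i. if i < n then x i else y (i - n))"
      using pv by (intro ev_cong) (auto simp: w_def)
    also have "\<dots> = 0" by (rule van[OF p])
    finally show "mpol_eval R h' p (\<lambda>i. v $ i) = \<zero>\<^bsub>R\<^esub>" by (simp add: ops)
  qed
  have vE: "(v $ i, v $ (n + i)) \<in> Exp m R E'" if i: "i < n" for i
  proof -
    have "v $ i = g (x i)" "v $ (n + i) = g (y i)" using i by (simp_all add: vj w_def)
    thus ?thesis unfolding Exp_def E'_def using xyK[OF i] K(5) Ey i by (simp add: ops)
  qed
  have part1: "\<exists>(K :: 'a ring) E h. diff_field_ext m ring_of_type_algebra D K E h \<and>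
            (\<exists>v \<in> K_points n V K h. \<forall>i<n. (v $ i, v $ (n + i)) \<in> Exp m K E)"
    using ext vK vE by blast
  have part2: "\<exists>v \<in> K_points n V ring_of_type_algebra id.
               \<forall>i<n. (v $ i, v $ (n + i)) \<in> Exp m ring_of_type_algebra D" if dc: "differentially_closed m D"
  proof -
    obtain Z where Z: "zariski_closed (2 * n) Z" "V = Z \<inter> G_points n ring_of_type_algebra"
      using assms(3) unfolding rotund_def G_variety_def by blast
    obtain S0 :: "(nat, 'a) mpol set" where S0: "finite S0" "\<And>p. p \<in> S0 \<Longrightarrow> mpol_vars p \<subseteq> {..<2 * n}"
      "Z = {v \<in> carrier_vec (2 * n). \<forall>p\<in>S0. ev to_ac p (\<lambda>i. v $ i) = 0}"
      using Z(1) unfolding zariski_closed_def mpol_eval_type_algebra by blast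
    have S0I: "S0 \<subseteq> vanishing_ideal (2 * n) V"
      using S0 Z(2) unfolding vanishing_ideal_def mpol_eval_type_algebra by auto
    define S where "S = order_zero ` S0 \<union> (\<lambda>(i, s). exp_diff_pol n i s) ` ({..<n} \<times> {..<m})"
    define T :: "(nat \<times> (nat \<Rightarrow> nat), 'a) mpol set" where
      "T = (\<lambda>i. Poly_Mapping.single (Poly_Mapping.single (n + i, \<lambda>_. 0) 1) 1) ` {..<n}"
    define a where "a = (\<lambda>(j, e). deriv_op m E e (w j))"
    have dop: "deriv_op m E e (w j) \<in> K \<and> deriv_op m E' e (g (w j)) = g (deriv_op m E e (w j))" for e j
      unfolding E'_def by (rule deriv_op_transported[where m = m and E = E, OF g _ wK]) (rule K(5))
    have aK: "a je \<in> K" for je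
      unfolding a_def using dop by (auto split: prod.split)
    have dpe: "diff_pol_eval m R E' h' p (\<lambda>j. g (w j)) = g (ev h p a)" for p
    proof -
      have "(\<lambda>(j, e). deriv_op m E' e (g (w j))) = (\<lambda>je. g (a je))"
        unfolding a_def using dop by (auto simp: fun_eq_iff)
      thus ?thesis unfolding diff_pol_eval_def R_def h'_def
        using transported_mpol_eval[OF K(1) g hK aK, of p "\<lambda>je. g (a je)"] by simp
    qed
    have a0: "a (j, \<lambda>_. 0) = w j" for j by (simp add: a_def deriv_op_zero)
    have au: "a (j, unit_order s) = E s (w j)" if "s < m" for j s by (simp add: a_def deriv_op_unit[OF that])
    have wxy: "w i = x i" "w (n + i) = y i" if "i < n" for i using that by (simp_all add: w_def)
    have "ev h p a = 0" if "p \<in> S" for p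
      using that unfolding S_def
    proof
      assume "p \<in> order_zero ` S0"
      then obtain q where q: "q \<in> S0" "p = order_zero q" by blast
      have "ev h p a = ev h q w" unfolding q(2) ev_order_zero[OF h] a0 ..
      also have "\<dots> = ev h q (\<lambda>i. if i < n then x i else y (i - n))"
        using S0(2)[OF q(1)] by (intro ev_cong) (auto simp: w_def)
      also have "\<dots> = 0" using van q(1) S0I by blast
      finally show ?thesis .
    next
      assume "p \<in> (\<lambda>(i, s). exp_diff_pol n i s) ` ({..<n} \<times> {..<m})"
      then obtain i s where idx: "i < n" "s < m" "p = exp_diff_pol n i s" by auto
      show ?thesis unfolding idx(3) ev_exp_diff_pol[OF h] a0 au[OF idx(2)] wxy[OF idx(1)] using Ey[OF idx(2,1)] by simp
    qed
    hence sol1: "\<forall>p\<in>S. diff_pol_eval m R E' h' p (\<lambda>j. g (w j)) = \<zero>\<^bsub>R\<^esub>" by (simp add: dpe ops)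
    have sol2: "\<forall>q\<in>T. diff_pol_eval m R E' h' q (\<lambda>j. g (w j)) \<noteq> \<zero>\<^bsub>R\<^esub>"
    proof
      fix q assume "q \<in> T"
      then obtain i where i: "i < n" "q = Poly_Mapping.single (Poly_Mapping.single (n + i, \<lambda>_. 0) 1) 1" unfolding T_def by blast
      have "ev h q a = y i" unfolding i(2) ev_single[OF h] by (simp add: a0 wxy[OF i(1)] ring_homoD[OF h])
      thus "diff_pol_eval m R E' h' q (\<lambda>j. g (w j)) \<noteq> \<zero>\<^bsub>R\<^esub>"
        unfolding dpe ops using y0[OF i(1)] xyK[OF i(1)] KR(1) g by (auto dest: inj_onD)
    qed
    have "range (\<lambda>j. g (w j)) \<subseteq> carrier R" using wK by (auto simp: ops)
    moreover have "finite S" "finite T" unfolding S_def T_def using S0(1) by auto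
    ultimately obtain z where z: "\<forall>p\<in>S. diff_pol_eval m ring_of_type_algebra D id p z = 0"
      "\<forall>q\<in>T. diff_pol_eval m ring_of_type_algebra D id q z \<noteq> 0"
      using dc ext sol1 sol2 unfolding differentially_closed_def by metis
    have idh: "ring_homo (id :: 'a \<Rightarrow> 'a)" by (simp add: ring_homo_def)
    define b where "b = (\<lambda>(j, e). deriv_op m D e (z j))"
    have dpeF: "diff_pol_eval m ring_of_type_algebra D id p z = ev id p b" for p
      unfolding diff_pol_eval_def mpol_eval_type_algebra b_def ..
    have b0: "b (j, \<lambda>_. 0) = z j" for j by (simp add: b_def deriv_op_zero)
    have bu: "b (j, unit_order s) = D s (z j)" if "s < m" for j s by (simp add: b_def deriv_op_unit[OF that])
    have zexp: "D s (z (n + i)) = z (n + i) * D s (z i)" if "i < n" "s < m" for i s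
    proof -
      have "exp_diff_pol n i s \<in> S" unfolding S_def using that by auto
      hence "ev id (exp_diff_pol n i s) b = 0" using z(1) dpeF by metis
      thus ?thesis unfolding ev_exp_diff_pol[OF idh] b0 bu[OF that(2)] by simp
    qed
    have znz: "z (n + i) \<noteq> 0" if "i < n" for i
    proof -
      have "Poly_Mapping.single (Poly_Mapping.single (n + i, \<lambda>_. 0) 1) 1 \<in> T" unfolding T_def using that by auto
      hence "ev id (Poly_Mapping.single (Poly_Mapping.single (n + i, \<lambda>_. 0) 1) 1) b \<noteq> 0" using z(2) dpeF by metis
      thus ?thesis unfolding ev_single[OF idh] by (simp add: b0)
    qed
    have zS: "ev id p z = 0" if "p \<in> S0" for p
    proof -
      have "order_zero p \<in> S" unfolding S_def using that by auto
      hence "ev id (order_zero p) b = 0" using z(1) dpeF by metis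
      thus ?thesis unfolding ev_order_zero[OF idh] b0 .
    qed
    define vz where "vz = vec (2 * n) z"
    define vc where "vc = vec (2 * n) (\<lambda>i. to_ac (z i))"
    have evc: "ev to_ac p (\<lambda>i. vc $ i) = to_ac (ev id p z)" if "mpol_vars p \<subseteq> {..<2 * n}" for p
    proof -
      have "ev to_ac p (\<lambda>i. vc $ i) = ev to_ac p (\<lambda>i. to_ac (z i))"
        using that by (intro ev_cong) (auto simp: vc_def)
      thus ?thesis using ev_hom[OF ring_homo_to_ac, of id p z] by simp
    qed
    have vcV: "vc \<in> V"
      unfolding Z(2) S0(3)
    proof (intro IntI CollectI conjI ballI)
      show "vc \<in> carrier_vec (2 * n)" by (simp add: vc_def)
      show "ev to_ac p (\<lambda>i. vc $ i) = 0" if "p \<in> S0" for p using evc[OF S0(2)[OF that]] zS[OF that] by simp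
      show "vc \<in> G_points n ring_of_type_algebra"
        unfolding G_points_def using znz by (auto simp: vc_def ring_of_type_algebra_def)
    qed
    have "vz \<in> K_points n V ring_of_type_algebra id"
      unfolding K_points_def
    proof (intro CollectI conjI ballI)
      show "vz \<in> G_points n ring_of_type_algebra"
        unfolding G_points_def using znz by (auto simp: vz_def ring_of_type_algebra_def)
      fix p assume p: "p \<in> vanishing_ideal (2 * n) V"
      hence pv: "mpol_vars p \<subseteq> {..<2 * n}" and "ev to_ac p (\<lambda>i. vc $ i) = 0"
        using vcV unfolding vanishing_ideal_def mpol_eval_type_algebra by auto
      hence "ev id p z = 0" using evc[OF pv] by simp
      moreover have "ev id p (\<lambda>i. vz $ i) = ev id p z" using pv by (intro ev_cong) (auto simp: vz_def)
      ultimately show "mpol_eval ring_of_type_algebra id p (\<lambda>i. vz $ i) = \<zero>\<^bsub>ring_of_type_algebra\<^esub>"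
        unfolding mpol_eval_type_algebra by (simp add: ring_of_type_algebra_def)
    qed
    moreover have "(vz $ i, vz $ (n + i)) \<in> Exp m ring_of_type_algebra D" if "i < n" for i
      using zexp[OF that] that by (auto simp: Exp_def vz_def ring_of_type_algebra_def)
    ultimately show ?thesis by blast
  qed
  show ?thesis using part1 part2 by blast
qed

end
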